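(* Let $N,p,q,\sigma$ be real numbers with $q>p-1>0$ and $p>-\sigma>N$. Consider the positive solutions of $$-(|w'|^{p-2}w')'-\frac{N-1}{r}|w'|^{p-2}w'=\varepsilon r^{\sigma}w^{q},\qquad \varepsilon=\pm1 .$$ For $\varepsilon=\pm1$ there exist local (nonglobal) solutions near $0$ of two types: $$\lim_{r\to0}w=w_0>0,\qquad \lim_{r\to0}r^{-\frac{\sigma+1}{p-1}}w'=\varepsilon D,\quad D>0;$$ $$\lim_{r\to0}w=0,\qquad \lim_{r\to0}r^{\frac{N-p}{p-1}}w=k>0,\qquad \lim_{r\to0}r^{\frac{N-1}{p-1}}w'=d(k)>0.$$ For $\varepsilon=-1$ there exist two types of global solutions in $(0,\infty)$: • $w^*(r)=a^*r^{-\frac{p+\sigma}{q+1-p}}$; • solutions such that $\lim_{r\to0}w=w_0>0$, $\lim_{r\to0}r^{-\frac{\sigma+1}{p-1}}w'=d<0$, and $w\sim w^*$ as $r\to\infty$. Moreover, for $\varepsilon=-1$, there exist also solutions on some $(0,r_0)$, $r_0>0$, such that $w(r_0)=0$ and $w\sim w^*$ as $r\to0$; others on some $(0,r_0)$ such that $\lim_{r\to r_0}w=\infty$ and $w\sim w^*$ as $r\to0$; and nonglobal solutions on some $(r_0,\infty)$ such that $w\sim w^*$ as $r\to\infty$ and $\lim_{r\to r_0}w=\infty$. For $\varepsilon=1$ there is no local solution in $(r_0,\infty)$, $r_0>0$.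
   Context: $N$ is not necessarily an integer. With $\gamma=\frac{p+\sigma}{q+1-p}$, $a^*>0$ is defined by $(a^* )^{q-p+1}=\varepsilon|\gamma|^{p-2}\gamma\,(N-p-(p-1)\gamma)$ with $\varepsilon=-1$. A local solution near $0$ is a positive solution on $(0,r_0)$ for some $r_0>0$; a solution is global if it is a positive solution on $(0,\infty)$. $d(\cdot)$ denotes a positive constant associated with the solution. $f\sim g$ means $f/g\to1$. *)

theory Defs
  imports "HOL-Analysis.Analysis" "HOL-Library.Landau_Symbols"
begin

unbundle asymp_equiv_syntax

text \<open>The nonlinearity of the one-dimensional \<open>p\<close>-Laplacian. Since \<open>0 powr a = 0\<close>, its value at
  \<open>0\<close> is \<open>0\<close>, also for \<open>1 < p < 2\<close>.\<close>

definition flux :: "real \<Rightarrow> real \<Rightarrow> real" where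
  "flux p s = \<bar>s\<bar> powr (p - 2) * s"

text \<open>Classical solutions: \<open>w\<close> and \<open>flux p w'\<close> are differentiable. As \<open>1 < p\<close>, this forces
  both to be of class \<open>C\<^sup>1\<close>. It is meant for open intervals \<open>I\<close> of positive reals, so the values
  of \<open>w\<close> outside \<open>I\<close> are irrelevant.\<close>

definition positive_solution ::
  "real \<Rightarrow> real \<Rightarrow> real \<Rightarrow> real \<Rightarrow> real \<Rightarrow> real set \<Rightarrow> (real \<Rightarrow> real) \<Rightarrow> bool" where
  "positive_solution N p q \<sigma> \<epsilon> I w \<longleftrightarrow>
     (\<forall>r\<in>I. w r > 0 \<and>
        w differentiable (at r) \<and>
        (\<lambda>s. flux p (deriv w s)) differentiable (at r) \<and>
        - deriv (\<lambda>s. flux p (deriv w s)) r - (N - 1) / r * flux p (deriv w r)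
          = \<epsilon> * r powr \<sigma> * w r powr q)"

text \<open>A solution on \<open>I\<close> is nonglobal if it is not the restriction of a positive solution on
  the whole half-line.\<close>

definition nonglobal ::
  "real \<Rightarrow> real \<Rightarrow> real \<Rightarrow> real \<Rightarrow> real \<Rightarrow> real set \<Rightarrow> (real \<Rightarrow> real) \<Rightarrow> bool" where
  "nonglobal N p q \<sigma> \<epsilon> I w \<longleftrightarrow>
     \<not> (\<exists>v. positive_solution N p q \<sigma> \<epsilon> {0<..} v \<and> (\<forall>r\<in>I. v r = w r))"

definition gam :: "real \<Rightarrow> real \<Rightarrow> real \<Rightarrow> real" where
  "gam p q \<sigma> = (p + \<sigma>) / (q + 1 - p)"

text \<open>The constant for \<open>\<epsilon> = -1\<close>.\<close>

definition astar :: "real \<Rightarrow> real \<Rightarrow> real \<Rightarrow> real \<Rightarrow> real" where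
  "astar N p q \<sigma> = (THE a. a > 0 \<and>
     a powr (q - p + 1) =
       (-1) * \<bar>gam p q \<sigma>\<bar> powr (p - 2) * gam p q \<sigma> * (N - p - (p - 1) * gam p q \<sigma>))"

definition wstar :: "real \<Rightarrow> real \<Rightarrow> real \<Rightarrow> real \<Rightarrow> real \<Rightarrow> real" where
  "wstar N p q \<sigma> r = astar N p q \<sigma> * r powr (- gam p q \<sigma>)"

lemma astar_well_defined:
  assumes "q > p - 1" "p - 1 > 0" "p > -\<sigma>" "-\<sigma> > N"
  shows "\<exists>!a. a > 0 \<and> a powr (q - p + 1) =
       (-1) * \<bar>gam p q \<sigma>\<bar> powr (p - 2) * gam p q \<sigma> * (N - p - (p - 1) * gam p q \<sigma>)"
proof -
  define c where
    "c = (-1) * \<bar>gam p q \<sigma>\<bar> powr (p - 2) * gam p q \<sigma> * (N - p - (p - 1) * gam p q \<sigma>)"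
  have g: "gam p q \<sigma> > 0" using assms by (simp add: gam_def)
  have "(p - 1) * gam p q \<sigma> > 0" using g assms by simp
  then have "N - p - (p - 1) * gam p q \<sigma> < 0" using assms by linarith
  then have "\<bar>gam p q \<sigma>\<bar> powr (p - 2) * gam p q \<sigma> * (N - p - (p - 1) * gam p q \<sigma>) < 0"
    using g by (intro mult_pos_neg mult_pos_pos) auto
  then have c: "c > 0" by (simp add: c_def)
  have e: "q - p + 1 > 0" using assms by simp
  have "\<exists>!a. a > 0 \<and> a powr (q - p + 1) = c"
  proof (rule ex1I[of _ "c powr (1 / (q - p + 1))"])
    show "c powr (1 / (q - p + 1)) > 0 \<and> (c powr (1 / (q - p + 1))) powr (q - p + 1) = c"
      using c e by (simp add: powr_powr)
    show "a = c powr (1 / (q - p + 1))" if "a > 0 \<and> a powr (q - p + 1) = c" for a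
    proof -
      have "c powr (1 / (q - p + 1)) = (a powr (q - p + 1)) powr (1 / (q - p + 1))"
        using that by simp
      also have "\<dots> = a" unfolding powr_powr using that e by simp
      finally show ?thesis by simp
    qed
  qed
  then show ?thesis unfolding c_def .
qed

end

theory Submission imports Defs begin

text \<open>
  In the variable \<open>t = ln r\<close>, with \<open>\<gamma> = (p + \<sigma>) / (q + 1 - p)\<close>, \<open>\<kappa> = (p - 1) \<gamma> + p - N\<close> and \<open>\<alpha> = 1 / (p - 1)\<close>, put
  \<open>w(r) = a r\<^sup>-\<^sup>\<gamma> y(t)\<close>, where \<open>a\<close> is the constant of \<open>w\<^sup>*\<close>, and let \<open>- z(t)\<close> be the correspondingly normalized flux.
  The radial equation becomes the autonomous system \<open>y' = \<gamma> (y - \<psi>(z))\<close>, \<open>z' = \<kappa> (z + \<epsilon> y\<^sup>q)\<close>, where \<open>\<psi>\<close> is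
  the odd power with exponent \<open>\<alpha>\<close>. Dilations of \<open>r\<close> are translations of \<open>t\<close>, so one solution with a positive
  limit \<open>w\<^sub>0\<close>, or a positive \<open>k\<close>, yields all values of \<open>w\<^sub>0\<close> or \<open>k\<close>. The assumptions on the exponents
  say that \<open>\<gamma>\<close> and \<open>\<alpha>\<close> are positive, \<open>\<alpha> q > 1\<close> and \<open>\<gamma> q < \<kappa>\<close>.

  For \<open>\<epsilon> = -1\<close> the solution \<open>w\<^sup>*\<close> is the equilibrium \<open>(1, 1)\<close>, and \<open>\<alpha> q > 1\<close> makes it a saddle. The solutions
  sought that are asymptotic to \<open>w\<^sup>*\<close> are four half-branches, which leave it in one of the two directions of time. Measured by
  the absolute deviations \<open>h = \<bar>y - 1\<bar>\<close>, \<open>k = \<bar>z - 1\<bar>\<close> and with time pointing away from the equilibrium,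
  all four obey the same kind of system \<open>h' = \<omega> h + \<Phi>(k)\<close>, \<open>k' = \<omega>' k + \<Psi>(h)\<close> with increasing \<open>\<Phi>\<close>, \<open>\<Psi>\<close>.
  One theorem, \<open>unstable_branch\<close>, serves them all. Its proof rewrites the system as a fixed point equation for a monotone
  integral operator on functions with values in \<open>[0, \<infinity>]\<close>. The functions \<open>x - \<mu> x\<^sup>2\<close> and \<open>x + \<mu> x\<^sup>2\<close>, with
  \<open>x = exp (\<rho> t)\<close> and \<open>\<rho>\<close> the positive eigenvalue, are up to constant factors a lower and an upper solution near the equilibrium,
  and the Knaster-Tarski theorem gives a fixed point between them. The order takes the place of a Lipschitz condition, which
  \<open>\<psi>\<close> and \<open>y\<^sup>q\<close> may violate at \<open>0\<close>. As the least fixed point above the lower solution is taken, it is also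
  maximal in time: it can become infinite only by actually blowing up.

  The fate of the branches is read off from two devices. A weighted sum \<open>L\<close> of \<open>ln y\<close> and \<open>ln z\<close>
  satisfies \<open>L' \<ge> exp (c L) - 1\<close> by convexity of the exponential function, so a branch with both components above \<open>1\<close>
  blows up in finite time; with \<open>- z\<close> in place of \<open>z\<close>, so does every solution with \<open>z < 0 < y\<close>. On the branch with both components below \<open>1\<close>,
  which is global, comparison with the explicit functions \<open>(c + r\<^sup>\<theta>)\<^sup>-\<^sup>\<gamma>\<^sup>/\<^sup>\<theta>\<close> bounds \<open>w\<close> at
  \<open>r = 0\<close> and gives the limit \<open>w\<^sub>0 > 0\<close>. The remaining two branches have \<open>y - 1\<close> and \<open>z - 1\<close>
  of opposite signs: \<open>y\<close> reaches \<open>0\<close>, or \<open>z\<close> becomes negative and \<open>y\<close> blows up.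

  Near \<open>r = 0\<close> the other local solutions are again fixed points of monotone integral operators, now with constant or
  power-like bounds (\<open>local_system\<close>). They are nonglobal because there is no solution near infinity at all when
  \<open>\<epsilon> = 1\<close>, while for \<open>\<epsilon> = -1\<close> the one with limit \<open>w\<^sub>0\<close> is constructed so as to reach \<open>0\<close>, and
  the increasing ones blow up.
\<close>

section \<open>Odd powers\<close>

text \<open>
  The nonlinearity \<open>flux p\<close> is the odd power with exponent \<open>p - 1\<close>; its inverse has exponent \<open>1 / (p - 1)\<close>.
\<close>
definition spow :: "real \<Rightarrow> real \<Rightarrow> real" where
  "spow e x = sgn x * \<bar>x\<bar> powr e"

lemma spow_pos: "x > 0 \<Longrightarrow> spow e x = x powr e"
  by (simp add: spow_def)

lemma spow_nonneg: "x \<ge> 0 \<Longrightarrow> spow e x = x powr e"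
  by (cases "x = 0") (simp_all add: spow_def)

lemma spow_minus: "spow e (- x) = - spow e x"
  by (simp add: spow_def sgn_minus)

lemma spow_simps [simp]: "spow e 0 = 0" "spow e 1 = 1"
  by (simp_all add: spow_def)

lemma spow_less: assumes "e > 0" "x < y" shows "spow e x < spow e y"
proof -
  consider "x \<ge> 0" | "x < 0" "y \<ge> 0" | "y < 0" by linarith
  then show ?thesis
  proof cases
    case 1 then show ?thesis using assms by (simp add: spow_nonneg powr_less_mono2)
  next
    case 2
    then have "spow e x < 0" "spow e y \<ge> 0" by (simp_all add: spow_def)
    then show ?thesis by linarith
  next
    case 3
    then have "(- y) powr e < (- x) powr e" using assms by (intro powr_less_mono2) auto
    then show ?thesis using 3 assms by (simp add: spow_def)
  qed
qed

lemma spow_le: "e > 0 \<Longrightarrow> x \<le> y \<Longrightarrow> spow e x \<le> spow e y"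
  using spow_less[of e x y] by (cases "x = y") auto

lemma spow_mult: "c > 0 \<Longrightarrow> spow e (c * x) = c powr e * spow e x"
  by (simp add: spow_def sgn_mult abs_mult powr_mult)

lemma spow_spow: "spow e (spow d x) = spow (d * e) x"
  by (cases "x = 0") (auto simp: spow_def sgn_mult abs_mult powr_powr sgn_if)

lemma flux_spow: "flux p s = spow (p - 1) s"
proof (cases "s = 0")
  case False
  have "\<bar>s\<bar> powr (p - 1) = \<bar>s\<bar> powr (p - 2) * \<bar>s\<bar>"
    using False powr_add[of "\<bar>s\<bar>" "p - 2" 1] by simp
  then show ?thesis using False by (auto simp: flux_def spow_def sgn_if)
qed (simp add: flux_def)

lemma continuous_spow: assumes "e > 0" shows "continuous_on UNIV (spow e)"
proof -
  have eq: "spow e = (\<lambda>x. (max 0 x) powr e - (max 0 (- x)) powr e)"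
    using assms by (auto simp: spow_def fun_eq_iff sgn_if max_def)
  have "continuous_on UNIV (\<lambda>x::real. (max 0 x) powr e)"
    using assms by (intro continuous_on_powr' continuous_intros) auto
  moreover have "continuous_on UNIV (\<lambda>x::real. (max 0 (- x)) powr e)"
    using assms by (intro continuous_on_powr' continuous_intros) auto
  ultimately show ?thesis unfolding eq by (intro continuous_on_diff)
qed

lemma isCont_spow: "e > 0 \<Longrightarrow> isCont (spow e) x"
  using continuous_spow by (simp add: continuous_on_eq_continuous_at)

text \<open>
  Taylor's formula at \<open>0\<close>; on \<open>[-1/2, 1/2]\<close> the second derivative is bounded for every real exponent.
\<close>
lemma powr_quadratic_bound:
  fixes e :: real
  obtains C where "C \<ge> 0" "\<And>x. \<bar>x\<bar> \<le> 1/2 \<Longrightarrow> \<bar>(1 + x) powr e - 1 - e * x\<bar> \<le> C * x\<^sup>2"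
proof -
  have "continuous_on {-1/2..1/2} (\<lambda>x. e * (e - 1) * (1 + x) powr (e - 2))"
    by (intro continuous_intros) auto
  then have "compact ((\<lambda>x. e * (e - 1) * (1 + x) powr (e - 2)) ` {-1/2..1/2})"
    by (rule compact_continuous_image) auto
  then have "bounded ((\<lambda>x. e * (e - 1) * (1 + x) powr (e - 2)) ` {-1/2..1/2})"
    by (rule compact_imp_bounded)
  then obtain C where C: "\<And>x. x \<in> {-1/2..1/2} \<Longrightarrow> \<bar>e * (e - 1) * (1 + x) powr (e - 2)\<bar> \<le> C"
    unfolding bounded_iff real_norm_def by (metis (no_types, lifting) imageI)
  have C0: "C \<ge> 0" using C[of 0] by (auto intro: order_trans[OF abs_ge_zero])
  have "\<bar>(1 + x) powr e - 1 - e * x\<bar> \<le> C * x\<^sup>2" if x: "\<bar>x\<bar> \<le> 1/2" for x :: real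
  proof -
    define D where "D = (\<lambda>m::nat. if m = 0 then (\<lambda>x. (1 + x) powr e) else
       if m = 1 then (\<lambda>x. e * (1 + x) powr (e - 1)) else (\<lambda>x. e * (e - 1) * (1 + x) powr (e - 2)))"
    show ?thesis
    proof (cases "x = 0")
      case False
      have "\<exists>t. (if x < 0 then x < t \<and> t < 0 else 0 < t \<and> t < x) \<and>
        D 0 x = (\<Sum>m<2. (D m 0 / fact m) * (x - 0) ^ m) + (D 2 t / fact 2) * (x - 0) ^ 2"
      proof (rule Taylor[where a = "-1/2" and b = "1/2"])
        show "\<forall>m t. m < 2 \<and> - 1 / 2 \<le> t \<and> t \<le> 1 / 2 \<longrightarrow> DERIV (D m) t :> D (Suc m) t"
        proof (intro allI impI)
          fix m :: nat and t :: real
          assume a: "m < 2 \<and> - 1 / 2 \<le> t \<and> t \<le> 1 / 2"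
          then consider "m = 0" | "m = 1" by linarith
          then show "DERIV (D m) t :> D (Suc m) t"
          proof cases
            case 1
            then show ?thesis using a unfolding D_def
              by (auto intro!: derivative_eq_intros)
          next
            case 2
            then show ?thesis using a unfolding D_def
              by (auto intro!: derivative_eq_intros)
          qed
        qed
      qed (use x False in auto)
      then obtain t where t: "if x < 0 then x < t \<and> t < 0 else 0 < t \<and> t < x"
        and eq: "D 0 x = (\<Sum>m<2. (D m 0 / fact m) * x ^ m) + (D 2 t / fact 2) * x\<^sup>2"
        by auto
      have "(1 + x) powr e - 1 - e * x = e * (e - 1) * (1 + t) powr (e - 2) / 2 * x\<^sup>2"
        using eq by (simp add: D_def numeral_2_eq_2)
      then have "\<bar>(1 + x) powr e - 1 - e * x\<bar> = \<bar>e * (e - 1) * (1 + t) powr (e - 2)\<bar> / 2 * x\<^sup>2"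
        by (simp only: abs_mult abs_divide) simp
      moreover have "\<bar>e * (e - 1) * (1 + t) powr (e - 2)\<bar> \<le> C"
        using C[of t] t x by (auto split: if_splits)
      ultimately show ?thesis using C0
        by (simp only:, intro mult_right_mono) auto
    qed simp
  qed
  then show ?thesis using that C0 by blast
qed

text \<open>
  The deviation of the odd power from its value at \<open>1\<close> when its argument deviates from \<open>1\<close> to the side \<open>s\<close>. The outer
  factor \<open>s\<close> makes it increasing for both signs.
\<close>
definition dev :: "real \<Rightarrow> real \<Rightarrow> real \<Rightarrow> real" where
  "dev e s x = s * (spow e (1 + s * x) - 1)"

lemma dev_mono: "e > 0 \<Longrightarrow> s \<in> {1, -1} \<Longrightarrow> mono (dev e s)"
  by (auto simp: mono_def dev_def intro!: spow_le)

lemma dev_continuous: "e > 0 \<Longrightarrow> continuous_on UNIV (dev e s)"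
  unfolding dev_def[abs_def]
  by (intro continuous_intros continuous_on_compose2[OF continuous_spow]) auto

lemma dev_quadratic:
  obtains C where "C \<ge> 0"
    "\<And>s k. s \<in> {1, -1} \<Longrightarrow> 0 \<le> k \<Longrightarrow> k \<le> 1/2 \<Longrightarrow> \<bar>dev e s k - e * k\<bar> \<le> C * k\<^sup>2"
proof -
  obtain C where C: "C \<ge> 0" "\<And>x. \<bar>x\<bar> \<le> 1/2 \<Longrightarrow> \<bar>(1 + x) powr e - 1 - e * x\<bar> \<le> C * x\<^sup>2"
    using powr_quadratic_bound by blast
  show ?thesis
  proof (rule that[OF C(1)])
    fix s k :: real assume a: "s \<in> {1, -1}" "0 \<le> k" "k \<le> 1/2"
    then have "dev e s k - e * k = s * ((1 + s * k) powr e - 1 - e * (s * k))"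
      by (auto simp: dev_def spow_nonneg algebra_simps)
    then have "\<bar>dev e s k - e * k\<bar> = \<bar>(1 + s * k) powr e - 1 - e * (s * k)\<bar>"
      using a by (auto simp: abs_mult abs_minus_commute)
    also have "\<dots> \<le> C * (s * k)\<^sup>2" using a by (intro C(2)) auto
    also have "\<dots> = C * k\<^sup>2" using a by auto
    finally show "\<bar>dev e s k - e * k\<bar> \<le> C * k\<^sup>2" .
  qed
qed

lemma dev_nonneg: "e > 0 \<Longrightarrow> s \<in> {1, -1} \<Longrightarrow> x \<ge> 0 \<Longrightarrow> dev e s x \<ge> 0"
  using monoD[OF dev_mono[of e s], of 0 x] by (simp add: dev_def)

section \<open>Integrals of nonnegative functions\<close>

text \<open>
  The flag tells at which end the data are prescribed: at minus infinity, or at time \<open>0\<close>. Values in \<open>[0, \<infinity>]\<close> allow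
  integrals to be formed before anything is known about their finiteness.
\<close>
definition cum :: "bool \<Rightarrow> (real \<Rightarrow> ennreal) \<Rightarrow> real \<Rightarrow> ennreal" where
  "cum d X t = (\<integral>\<^sup>+s\<in>(if d then {..t} else {t..0}). X s \<partial>lborel)"

lemma cum_mono: "(\<And>s. X s \<le> Y s) \<Longrightarrow> cum d X t \<le> cum d Y t"
  unfolding cum_def by (intro nn_integral_mono mult_right_mono) auto

lemma upclosed_borel:
  fixes S :: "real set"
  assumes "\<And>x y. x \<in> S \<Longrightarrow> x \<le> y \<Longrightarrow> y \<in> S"
  shows "S \<in> sets borel"
proof -
  have "is_interval S" using assms by (auto simp: is_interval_1)
  then show ?thesis by (rule real_interval_borel_measurable)
qed

lemma downclosed_borel:
  fixes S :: "real set"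
  assumes "\<And>x y. x \<in> S \<Longrightarrow> y \<le> x \<Longrightarrow> y \<in> S"
  shows "S \<in> sets borel"
proof -
  have "is_interval S" using assms by (auto simp: is_interval_1)
  then show ?thesis by (rule real_interval_borel_measurable)
qed

lemma cum_up_mono: "s \<le> t \<Longrightarrow> cum True X s \<le> cum True X t"
  unfolding cum_def by (intro nn_integral_mono mult_left_mono) (auto simp: indicator_def)

lemma cum_down_mono: "s \<le> t \<Longrightarrow> cum False X t \<le> cum False X s"
  unfolding cum_def by (intro nn_integral_mono mult_left_mono) (auto simp: indicator_def)

text \<open>
  A cumulative integral is a monotone function, whatever its integrand is. Hence every fixed point of an operator built from
  cumulative integrals is measurable.
\<close>
lemma cum_borel [measurable]: "cum d X \<in> borel_measurable borel"
proof (rule borel_measurableI_greater)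
  fix y :: ennreal
  show "{x \<in> space borel. y < cum d X x} \<in> sets borel"
  proof (cases d)
    case True
    have "{x. y < cum d X x} \<in> sets borel"
    proof (rule upclosed_borel)
      fix r s assume "r \<in> {x. y < cum d X x}" "r \<le> s"
      then show "s \<in> {x. y < cum d X x}"
        using order_less_le_trans[OF _ cum_up_mono] True by simp
    qed
    then show ?thesis by simp
  next
    case False
    have "{x. y < cum d X x} \<in> sets borel"
    proof (rule downclosed_borel)
      fix r s assume "r \<in> {x. y < cum d X x}" "s \<le> r"
      then show "s \<in> {x. y < cum d X x}"
        using order_less_le_trans[OF _ cum_down_mono] False by simp
    qed
    then show ?thesis by simp
  qed
qed

lemma cum_split_up:
  assumes [measurable]: "X \<in> borel_measurable borel" and "s \<le> t"
  shows "cum True X t = cum True X s + (\<integral>\<^sup>+r\<in>{s..t}. X r \<partial>lborel)"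
proof -
  have "cum True X t = (\<integral>\<^sup>+r. X r * indicator {..s} r + X r * indicator {s<..t} r \<partial>lborel)"
    unfolding cum_def using assms(2) by (intro nn_integral_cong) (auto simp: indicator_def)
  also have "\<dots> = cum True X s + (\<integral>\<^sup>+r\<in>{s<..t}. X r \<partial>lborel)"
    unfolding cum_def by (subst nn_integral_add) auto
  also have "(\<integral>\<^sup>+r\<in>{s<..t}. X r \<partial>lborel) = (\<integral>\<^sup>+r\<in>{s..t}. X r \<partial>lborel)"
  proof (rule nn_integral_cong_AE)
    have "AE r in lborel. r \<noteq> s" by (rule AE_lborel_singleton)
    then show "AE r in lborel. X r * indicator {s<..t} r = X r * indicator {s..t} r"
      by eventually_elim (auto simp: indicator_def)
  qed
  finally show ?thesis .
qed

lemma cum_split_down: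
  assumes [measurable]: "X \<in> borel_measurable borel" and "s \<le> t" "t \<le> 0"
  shows "cum False X s = cum False X t + (\<integral>\<^sup>+r\<in>{s..t}. X r \<partial>lborel)"
proof -
  have "cum False X s = (\<integral>\<^sup>+r. X r * indicator {t..0} r + X r * indicator {s..<t} r \<partial>lborel)"
    unfolding cum_def using assms(2,3) by (intro nn_integral_cong) (auto simp: indicator_def)
  also have "\<dots> = cum False X t + (\<integral>\<^sup>+r\<in>{s..<t}. X r \<partial>lborel)"
    unfolding cum_def by (subst nn_integral_add) auto
  also have "(\<integral>\<^sup>+r\<in>{s..<t}. X r \<partial>lborel) = (\<integral>\<^sup>+r\<in>{s..t}. X r \<partial>lborel)"
  proof (rule nn_integral_cong_AE)
    have "AE r in lborel. r \<noteq> t" by (rule AE_lborel_singleton)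
    then show "AE r in lborel. X r * indicator {s..<t} r = X r * indicator {s..t} r"
      by eventually_elim (auto simp: indicator_def)
  qed
  finally show ?thesis .
qed

lemma cum_split:
  assumes "X \<in> borel_measurable borel" "s \<le> t" "d \<or> t \<le> 0"
  shows "if d then cum d X t = cum d X s + (\<integral>\<^sup>+r\<in>{s..t}. X r \<partial>lborel)
         else cum d X s = cum d X t + (\<integral>\<^sup>+r\<in>{s..t}. X r \<partial>lborel)"
  using assms cum_split_up[of X s t] cum_split_down[of X s t] by (cases d) auto

lemma cum_le_max:
  assumes "s \<le> r" "r \<le> t" shows "cum d X r \<le> max (cum d X s) (cum d X t)"
  using assms cum_up_mono[of r t X] cum_down_mono[of s r X] by (cases d) (auto simp: max_def intro: order_trans)

lemma cum_cong_up: "(\<And>r. r \<le> t \<Longrightarrow> X r = Y r) \<Longrightarrow> cum True X t = cum True Y t"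
  unfolding cum_def by (intro nn_integral_cong) (auto simp: indicator_def)

text \<open>
  An integral that starts at time \<open>0\<close> takes all times up to \<open>0\<close> into account, hence the restriction on \<open>t1\<close>.
\<close>
lemma cum_prefix_mono:
  assumes "\<And>r. r \<le> t1 \<Longrightarrow> X r \<le> Y r" "t \<le> t1" "d \<or> t1 = 0"
  shows "cum d X t \<le> cum d Y t"
  unfolding cum_def using assms by (intro nn_integral_mono) (auto simp: indicator_def)

lemma nn_integral_Icc_continuous:
  fixes x :: "real \<Rightarrow> real"
  assumes "continuous_on {s..t} x" and "\<And>r. r \<in> {s..t} \<Longrightarrow> 0 \<le> x r"
  shows "(\<integral>\<^sup>+r\<in>{s..t}. ennreal (x r) \<partial>lborel) = ennreal (integral {s..t} x)"
proof -
  have "(\<integral>\<^sup>+r\<in>{s..t}. ennreal (x r) \<partial>lborel) = (\<integral>\<^sup>+r. ennreal (if r \<in> {s..t} then x r else 0) \<partial>lborel)"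
    by (intro nn_integral_cong) (auto simp: indicator_def)
  also have "\<dots> = ennreal (integral {s..t} x)"
  proof (rule nn_integral_has_integral_lborel)
    show "(\<lambda>r. if r \<in> {s..t} then x r else 0) \<in> borel_measurable borel"
      by (rule borel_measurable_continuous_on_if) (use assms in auto)
    show "((\<lambda>r. if r \<in> {s..t} then x r else 0) has_integral integral {s..t} x) UNIV"
      using assms(1) by (subst has_integral_restrict_UNIV) (auto intro: integrable_integral integrable_continuous_real)
  qed (use assms in auto)
  finally show ?thesis .
qed

lemma nn_integral_Icc_le:
  fixes x :: "real \<Rightarrow> real"
  assumes "s \<le> t" "continuous_on {s..t} x" "\<And>r. r \<in> {s..t} \<Longrightarrow> 0 \<le> x r"
    "\<And>r. r \<in> {s..t} \<Longrightarrow> (U has_real_derivative U' r) (at r)" "\<And>r. r \<in> {s..t} \<Longrightarrow> x r \<le> U' r"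
  shows "(\<integral>\<^sup>+r\<in>{s..t}. ennreal (x r) \<partial>lborel) \<le> ennreal (U t - U s)"
proof -
  have "(U' has_integral (U t - U s)) {s..t}"
    using assms(1,4) by (intro fundamental_theorem_of_calculus)
      (simp_all add: has_real_derivative_iff_has_vector_derivative[symmetric] has_field_derivative_at_within)
  moreover have "(x has_integral integral {s..t} x) {s..t}"
    using assms(2) by (intro integrable_integral integrable_continuous_real)
  ultimately have "integral {s..t} x \<le> U t - U s"
    using assms(5) has_integral_le[of x "integral {s..t} x" "{s..t}" U' "U t - U s"] by blast
  then show ?thesis using assms(2,3)
    by (subst nn_integral_Icc_continuous) (auto intro: ennreal_leI)
qed

lemma nn_integral_Icc_ge:
  fixes x :: "real \<Rightarrow> real"
  assumes "s \<le> t" "continuous_on {s..t} x" "\<And>r. r \<in> {s..t} \<Longrightarrow> 0 \<le> x r"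
    "\<And>r. r \<in> {s..t} \<Longrightarrow> (V has_real_derivative V' r) (at r)" "\<And>r. r \<in> {s..t} \<Longrightarrow> V' r \<le> x r"
  shows "ennreal (V t - V s) \<le> (\<integral>\<^sup>+r\<in>{s..t}. ennreal (x r) \<partial>lborel)"
proof -
  have "(V' has_integral (V t - V s)) {s..t}"
    using assms(1,4) by (intro fundamental_theorem_of_calculus)
      (simp_all add: has_real_derivative_iff_has_vector_derivative[symmetric] has_field_derivative_at_within)
  moreover have "(x has_integral integral {s..t} x) {s..t}"
    using assms(2) by (intro integrable_integral integrable_continuous_real)
  ultimately have "V t - V s \<le> integral {s..t} x"
    using assms(5) by (rule has_integral_le)
  then show ?thesis using assms(2,3)
    by (subst nn_integral_Icc_continuous) (auto intro: ennreal_leI)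
qed

text \<open>
  The integral over \<open>{t - n..t}\<close> is at most \<open>U t - U (t - n) \<le> U t\<close> for every \<open>n\<close>.
\<close>
lemma cum_up_le:
  fixes x :: "real \<Rightarrow> real"
  assumes X: "\<And>r. r \<le> t \<Longrightarrow> X r \<le> ennreal (x r)"
    and x: "continuous_on {..t} x" "\<And>r. r \<le> t \<Longrightarrow> 0 \<le> x r"
    and U: "\<And>r. r \<le> t \<Longrightarrow> (U has_real_derivative U' r) (at r)"
      "\<And>r. r \<le> t \<Longrightarrow> x r \<le> U' r" "\<And>r. r \<le> t \<Longrightarrow> 0 \<le> U r"
  shows "cum True X t \<le> ennreal (U t)"
proof -
  define y where "y = (\<lambda>r. if r \<in> {..t} then x r else 0)"
  have [measurable]: "y \<in> borel_measurable borel"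
    unfolding y_def by (rule borel_measurable_continuous_on_if) (use x in auto)
  define Z where "Z = (\<lambda>n r. ennreal (y r) * indicator {t - real n..t} r)"
  have "cum True X t \<le> (\<integral>\<^sup>+r. (SUP n. Z n r) \<partial>lborel)"
    unfolding cum_def
  proof (rule nn_integral_mono)
    fix r :: real
    show "X r * indicator (if True then {..t} else {t..0}) r \<le> (SUP n. Z n r)"
    proof (cases "r \<le> t")
      case True
      obtain n :: nat where "t - r \<le> real n" using real_arch_simple by blast
      then have "ennreal (x r) \<le> Z n r" using True by (simp add: Z_def y_def indicator_def)
      also have "\<dots> \<le> (SUP n. Z n r)" by (rule SUP_upper) simp
      finally show ?thesis using X[OF True] True by simp
    qed simp
  qed
  also have "\<dots> = (SUP n. \<integral>\<^sup>+r. Z n r \<partial>lborel)"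
  proof (rule nn_integral_monotone_convergence_SUP)
    show "incseq Z"
      unfolding incseq_def le_fun_def Z_def by (auto simp: indicator_def)
  qed (simp add: Z_def)
  also have "\<dots> \<le> ennreal (U t)"
  proof (rule SUP_least)
    fix n
    have "(\<integral>\<^sup>+r. Z n r \<partial>lborel) = (\<integral>\<^sup>+r\<in>{t - real n..t}. ennreal (x r) \<partial>lborel)"
      unfolding Z_def y_def by (intro nn_integral_cong) (auto simp: indicator_def)
    also have "\<dots> \<le> ennreal (U t - U (t - real n))"
      by (rule nn_integral_Icc_le[where U' = U']) (use x U in \<open>auto intro: continuous_on_subset\<close>)
    also have "\<dots> \<le> ennreal (U t)" using U(3)[of "t - real n"] by (intro ennreal_leI) auto
    finally show "(\<integral>\<^sup>+r. Z n r \<partial>lborel) \<le> ennreal (U t)" .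
  qed
  finally show ?thesis .
qed

text \<open>
  The integral is at least \<open>V t - V s\<close> for every \<open>s\<close>, and \<open>V s\<close> tends to \<open>0\<close>.
\<close>
lemma cum_up_ge:
  fixes x :: "real \<Rightarrow> real"
  assumes X: "\<And>r. r \<le> t \<Longrightarrow> ennreal (x r) \<le> X r"
    and x: "continuous_on {..t} x" "\<And>r. r \<le> t \<Longrightarrow> 0 \<le> x r"
    and V: "\<And>r. r \<le> t \<Longrightarrow> (V has_real_derivative V' r) (at r)"
      "\<And>r. r \<le> t \<Longrightarrow> V' r \<le> x r" "(V \<longlongrightarrow> 0) at_bot"
  shows "ennreal (V t) \<le> cum True X t"
proof -
  have *: "ennreal (V t - V s) \<le> cum True X t" if "s \<le> t" for s
  proof -
    have "ennreal (V t - V s) \<le> (\<integral>\<^sup>+r\<in>{s..t}. ennreal (x r) \<partial>lborel)"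
      by (rule nn_integral_Icc_ge[where V' = V']) (use that x V in \<open>auto intro: continuous_on_subset\<close>)
    also have "\<dots> \<le> cum True X t"
      unfolding cum_def using X by (intro nn_integral_mono) (auto simp: indicator_def)
    finally show ?thesis .
  qed
  have "((\<lambda>s. ennreal (V t - V s)) \<longlongrightarrow> ennreal (V t - 0)) at_bot"
    by (intro tendsto_ennrealI tendsto_intros V)
  moreover have "\<forall>\<^sub>F s in at_bot. ennreal (V t - V s) \<le> cum True X t"
    using eventually_le_at_bot[of t] by eventually_elim (rule *)
  ultimately have "ennreal (V t - 0) \<le> cum True X t"
    by (rule tendsto_upperbound) (rule trivial_limit_at_bot_linorder)
  then show ?thesis by simp
qed

lemma cum_down_le:
  fixes x :: "real \<Rightarrow> real"
  assumes t: "t \<le> 0" and X: "\<And>r. t \<le> r \<Longrightarrow> r \<le> 0 \<Longrightarrow> X r \<le> ennreal (x r)"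
    and x: "continuous_on {t..0} x" "\<And>r. t \<le> r \<Longrightarrow> r \<le> 0 \<Longrightarrow> 0 \<le> x r"
    and U: "\<And>r. t \<le> r \<Longrightarrow> r \<le> 0 \<Longrightarrow> (U has_real_derivative U' r) (at r)"
      "\<And>r. t \<le> r \<Longrightarrow> r \<le> 0 \<Longrightarrow> x r \<le> - U' r" "0 \<le> U 0"
  shows "cum False X t \<le> ennreal (U t)"
proof -
  have "cum False X t \<le> (\<integral>\<^sup>+r\<in>{t..0}. ennreal (x r) \<partial>lborel)"
    unfolding cum_def using X by (intro nn_integral_mono) (auto simp: indicator_def)
  also have "\<dots> \<le> ennreal ((- U 0) - (- U t))"
    by (rule nn_integral_Icc_le[where U' = "\<lambda>r. - U' r"]) (use t x U in \<open>auto intro!: DERIV_minus\<close>)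
  also have "\<dots> \<le> ennreal (U t)" using U(3) by (intro ennreal_leI) auto
  finally show ?thesis .
qed

lemma nn_integral_Icc_bound:
  assumes "\<And>r. r \<in> {s..t} \<Longrightarrow> X r \<le> ennreal K" "K \<ge> 0" "s \<le> t"
  shows "(\<integral>\<^sup>+r\<in>{s..t}. X r \<partial>lborel) \<le> ennreal (K * (t - s))"
proof -
  have "(\<integral>\<^sup>+r\<in>{s..t}. X r \<partial>lborel) \<le> (\<integral>\<^sup>+r\<in>{s..t}. ennreal K \<partial>lborel)"
    using assms by (intro nn_integral_mono) (auto simp: indicator_def)
  also have "\<dots> = ennreal (K * (t - s))"
    using assms by (simp add: nn_integral_cmult_indicator ennreal_mult)
  finally show ?thesis .
qed

lemma enn2real_increment:
  assumes "F < top" "F = G + I" "I \<le> ennreal K" "K \<ge> 0"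
  shows "\<bar>enn2real F - enn2real G\<bar> \<le> K"
proof -
  have "G < top" "I < top" using assms(1,2) by auto
  then have "enn2real F = enn2real G + enn2real I" using assms(2) by (simp add: enn2real_plus)
  moreover have "enn2real I \<le> K" using assms(3,4) by (rule enn2real_leI[rotated])
  ultimately show ?thesis using enn2real_nonneg[of I] by linarith
qed

section \<open>Monotone Volterra systems\<close>

text \<open>
  A weighted nonlinearity extended to \<open>[0, \<infinity>]\<close>. Sending \<open>\<infinity>\<close> to \<open>\<infinity>\<close> keeps it monotone and lets an
  infinite value stand for a solution that has already blown up.
\<close>
definition lift :: "(real \<Rightarrow> real) \<Rightarrow> real \<Rightarrow> real \<Rightarrow> real \<Rightarrow> ennreal \<Rightarrow> ennreal" where
  "lift \<Phi> a b s X = (if X = top then top else ennreal (exp (a * s) * \<Phi> (exp (b * s) * enn2real X)))"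

lemma lift_mono:
  assumes "mono \<Phi>" "X \<le> Y" shows "lift \<Phi> a b s X \<le> lift \<Phi> a b s Y"
proof (cases "Y = top")
  case False
  then have "X \<noteq> top" "enn2real X \<le> enn2real Y"
    using assms(2) by (auto simp: top_unique intro!: enn2real_mono simp: top.not_eq_extremum)
  then show ?thesis using False assms(1)
    by (auto simp: lift_def mono_def intro!: ennreal_leI)
qed (simp add: lift_def)

lemma lift_ennreal: "u \<ge> 0 \<Longrightarrow> lift \<Phi> a b s (ennreal u) = ennreal (exp (a * s) * \<Phi> (exp (b * s) * u))"
  by (simp add: lift_def)

lemma lift_borel [measurable (raw)]:
  assumes "mono \<Phi>" and [measurable]: "X \<in> borel_measurable borel"
  shows "(\<lambda>s. lift \<Phi> a b s (X s)) \<in> borel_measurable borel"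
proof -
  have [measurable]: "\<Phi> \<in> borel_measurable borel" using assms(1) by (rule borel_measurable_mono)
  show ?thesis unfolding lift_def by measurable
qed

lemma lift_le_Icc:
  assumes "mono \<Phi>" "\<Phi> 0 \<ge> 0" "U \<ge> 0"
  obtains K where "K \<ge> 0" "\<And>r X. r \<in> {s..t} \<Longrightarrow> X \<le> ennreal U \<Longrightarrow> lift \<Phi> a b r X \<le> ennreal K"
proof -
  define K where "K = exp (max (a * s) (a * t)) * \<Phi> (exp (max (b * s) (b * t)) * U)"
  have nn: "0 \<le> \<Phi> x" if "x \<ge> 0" for x using assms(1,2) that by (metis monoD order_trans)
  have "lift \<Phi> a b r X \<le> ennreal K" if r: "r \<in> {s..t}" and X: "X \<le> ennreal U" for r X
  proof -
    have m: "c * r \<le> max (c * s) (c * t)" for c :: real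
    proof (cases "c \<ge> 0")
      case True then have "c * r \<le> c * t" using r by (intro mult_left_mono) auto
      then show ?thesis by simp
    next
      case False then have "c * r \<le> c * s" using r by (intro mult_left_mono_neg) auto
      then show ?thesis by simp
    qed
    have "exp (b * r) * U \<le> exp (max (b * s) (b * t)) * U"
      using m[of b] assms(3) by (intro mult_right_mono) auto
    then have "\<Phi> (exp (b * r) * U) \<le> \<Phi> (exp (max (b * s) (b * t)) * U)"
      using assms(1) by (simp add: mono_def)
    then have "exp (a * r) * \<Phi> (exp (b * r) * U) \<le> K"
      unfolding K_def using m[of a] assms(3) by (intro mult_mono nn) auto
    then have "lift \<Phi> a b r (ennreal U) \<le> ennreal K"
      using assms(3) by (simp add: lift_ennreal ennreal_leI)
    then show ?thesis using lift_mono[OF assms(1) X] by (rule order_trans[rotated])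
  qed
  moreover have "K \<ge> 0" unfolding K_def using assms(3) by (intro mult_nonneg_nonneg nn) auto
  ultimately show ?thesis using that by blast
qed

text \<open>
  The continuity of a solution has to be known before its integrand can be seen to be continuous; it follows from local
  boundedness of the integrand.
\<close>
lemma increment_continuous:
  fixes F X :: "real \<Rightarrow> ennreal"
  assumes D: "open D" "is_interval D" and fin: "\<And>t. t \<in> D \<Longrightarrow> F t < top"
    and inc: "\<And>s t. s \<in> D \<Longrightarrow> t \<in> D \<Longrightarrow> s \<le> t \<Longrightarrow>
       (if d then F t = F s + (\<integral>\<^sup>+r\<in>{s..t}. X r \<partial>lborel) else F s = F t + (\<integral>\<^sup>+r\<in>{s..t}. X r \<partial>lborel))"
    and bd: "\<And>s t. s \<in> D \<Longrightarrow> t \<in> D \<Longrightarrow> s \<le> t \<Longrightarrow> \<exists>K\<ge>0. \<forall>r\<in>{s..t}. X r \<le> ennreal K"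
  shows "continuous_on D (\<lambda>t. enn2real (F t))"
proof -
  have "isCont (\<lambda>t. enn2real (F t)) t" if t: "t \<in> D" for t
  proof -
    obtain e where e: "e > 0" "cball t e \<subseteq> D" using D(1) t open_contains_cball by blast
    then have se: "{t - e..t + e} \<subseteq> D" by (simp add: cball_eq_atLeastAtMost)
    then have tD: "t - e \<in> D" "t + e \<in> D" using e by auto
    obtain K where K: "K \<ge> 0" "\<And>r. r \<in> {t - e..t + e} \<Longrightarrow> X r \<le> ennreal K"
      using bd[OF tD] e by auto
    have lip: "\<bar>enn2real (F r2) - enn2real (F r1)\<bar> \<le> K * (r2 - r1)"
      if r: "r1 \<le> r2" "t - e \<le> r1" "r2 \<le> t + e" for r1 r2
    proof -
      have I: "(\<integral>\<^sup>+r\<in>{r1..r2}. X r \<partial>lborel) \<le> ennreal (K * (r2 - r1))"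
        using K r by (intro nn_integral_Icc_bound) auto
      have D12: "r1 \<in> D" "r2 \<in> D" using se r by auto
      have K0: "0 \<le> K * (r2 - r1)" using K r by simp
      show ?thesis
      proof (cases d)
        case True
        then show ?thesis using inc[OF D12 r(1)] enn2real_increment[OF fin[OF D12(2)] _ I K0] by simp
      next
        case False
        then show ?thesis using inc[OF D12 r(1)] enn2real_increment[OF fin[OF D12(1)] _ I K0]
          by (simp add: abs_minus_commute)
      qed
    qed
    have "((\<lambda>r. enn2real (F r) - enn2real (F t)) \<longlongrightarrow> 0) (at t)"
    proof (rule Lim_null_comparison)
      have "((\<lambda>r. K * \<bar>r - t\<bar>) \<longlongrightarrow> K * \<bar>t - t\<bar>) (at t)" by (intro tendsto_intros)
      then show "((\<lambda>r. K * \<bar>r - t\<bar>) \<longlongrightarrow> 0) (at t)" by simp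
      have "\<forall>\<^sub>F r in at t. r \<in> {t - e<..<t + e}"
        using e by (intro eventually_at_in_open') auto
      then show "\<forall>\<^sub>F r in at t. norm (enn2real (F r) - enn2real (F t)) \<le> K * \<bar>r - t\<bar>"
      proof eventually_elim
        case (elim r)
        then show ?case using lip[of r t] lip[of t r] e
          by (cases "r \<le> t") (auto simp: abs_minus_commute)
      qed
    qed
    then have "((\<lambda>r. enn2real (F r)) \<longlongrightarrow> enn2real (F t)) (at t)"
      by (rule Lim_null[THEN iffD2])
    then show ?thesis by (simp add: isCont_def)
  qed
  then show ?thesis by (simp add: continuous_at_imp_continuous_on)
qed

lemma increment_deriv:
  fixes F :: "real \<Rightarrow> ennreal" and x :: "real \<Rightarrow> real"
  assumes D: "open D" and fin: "\<And>t. t \<in> D \<Longrightarrow> F t < top"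
    and inc: "\<And>s t. s \<in> D \<Longrightarrow> t \<in> D \<Longrightarrow> s \<le> t \<Longrightarrow>
       (if d then F t = F s + (\<integral>\<^sup>+r\<in>{s..t}. ennreal (x r) \<partial>lborel)
        else F s = F t + (\<integral>\<^sup>+r\<in>{s..t}. ennreal (x r) \<partial>lborel))"
    and x: "continuous_on D x" "\<And>t. t \<in> D \<Longrightarrow> 0 \<le> x t" and t: "t \<in> D"
  shows "((\<lambda>t. enn2real (F t)) has_real_derivative (if d then x t else - x t)) (at t)"
proof -
  obtain e where e: "e > 0" "cball t e \<subseteq> D" using D(1) t open_contains_cball by blast
  define a where "a = t - e" define b where "b = t + e"
  have se: "{a..b} \<subseteq> D" using e by (simp add: cball_eq_atLeastAtMost a_def b_def)
  have ab: "a < t" "t < b" using e by (auto simp: a_def b_def)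
  have cx: "continuous_on {a..b} x" using x(1) se by (rule continuous_on_subset)
  define I where "I = (\<lambda>r. integral {a..r} x)"
  have nI: "(\<integral>\<^sup>+r\<in>{u..v}. ennreal (x r) \<partial>lborel) = ennreal (integral {u..v} x)" if "{u..v} \<subseteq> {a..b}" for u v
  proof (rule nn_integral_Icc_continuous)
    have uv: "{u..v} \<subseteq> D" using that se by blast
    then show "continuous_on {u..v} x" using x(1) by (rule continuous_on_subset[rotated])
    show "0 \<le> x r" if "r \<in> {u..v}" for r using uv that x(2) by blast
  qed
  have comb: "I r + integral {r..b} x = I b" if "a \<le> r" "r \<le> b" for r
    unfolding I_def using that cx
    by (intro Henstock_Kurzweil_Integration.integral_combine integrable_continuous_real) auto
  have Inn: "integral {u..v} x \<ge> 0" if "{u..v} \<subseteq> {a..b}" for u v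
  proof (rule integral_nonneg)
    have uv: "{u..v} \<subseteq> D" using that se by blast
    then show "x integrable_on {u..v}"
      using x(1) by (intro integrable_continuous_real) (rule continuous_on_subset)
    show "0 \<le> x r" if "r \<in> {u..v}" for r using uv that x(2) by blast
  qed
  have "(I has_real_derivative x t) (at t within {a..b})"
    unfolding I_def by (rule integral_has_real_derivative) (use cx ab in auto)
  then have dI: "(I has_real_derivative x t) (at t)"
    using ab by (simp add: at_within_Icc_at)
  show ?thesis
  proof (cases d)
    case True
    have "((\<lambda>r. enn2real (F a) + I r) has_real_derivative (0 + x t)) (at t)"
      by (intro DERIV_add DERIV_const dI)
    moreover have "enn2real (F a) + I r = enn2real (F r)" if "r \<in> {a<..<b}" for r
    proof -
      have rD: "a \<in> D" "r \<in> D" using that ab by (auto intro!: subsetD[OF se])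
      have "F r = F a + ennreal (I r)"
        using rD inc[of a r] True nI[of a r] that by (auto simp: I_def)
      then show ?thesis using rD fin[of a] that Inn[of a r]
        by (auto simp: enn2real_plus I_def)
    qed
    ultimately show ?thesis using True ab
      by (auto intro: has_field_derivative_transform_within_open[where S = "{a<..<b}"])
  next
    case False
    have "((\<lambda>r. enn2real (F b) + (I b - I r)) has_real_derivative (0 + (0 - x t))) (at t)"
      by (intro DERIV_add DERIV_const DERIV_diff dI)
    moreover have "enn2real (F b) + (I b - I r) = enn2real (F r)" if r: "r \<in> {a<..<b}" for r
    proof -
      have rD: "b \<in> D" "r \<in> D" using r ab by (auto intro!: subsetD[OF se])
      have "F r = F b + ennreal (integral {r..b} x)"
        using rD inc[of r b] False nI[of r b] r by auto
      moreover have "integral {r..b} x = I b - I r" using comb[of r] r by auto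
      ultimately show ?thesis using rD fin[of b] r Inn[of r b]
        by (auto simp: enn2real_plus)
    qed
    ultimately show ?thesis using False ab
      by (auto intro: has_field_derivative_transform_within_open[where S = "{a<..<b}"])
  qed
qed

text \<open>
  Half of the system. The second component may be any cumulative integral; its monotonicity bounds the integrand of the
  first component locally.
\<close>
context
  fixes f g :: "real \<Rightarrow> ennreal" and \<Phi> :: "real \<Rightarrow> real" and c0 c1 a b :: real and d1 d2 :: bool and D Y
  assumes \<Phi>: "mono \<Phi>" "continuous_on UNIV \<Phi>" "\<Phi> 0 \<ge> 0"
    and f: "\<And>t. f t = ennreal c0 + cum d1 (\<lambda>s. lift \<Phi> a b s (g s)) t"
    and g: "\<And>t. g t = ennreal c1 + cum d2 Y t"
    and D: "open D" "is_interval D" "d1 \<or> D \<subseteq> {..0}"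
    and fin: "\<And>t. t \<in> D \<Longrightarrow> f t < top" "\<And>t. t \<in> D \<Longrightarrow> g t < top"
begin

lemma volterra_increment:
  assumes "s \<in> D" "t \<in> D" "s \<le> t"
  shows "if d1 then f t = f s + (\<integral>\<^sup>+r\<in>{s..t}. lift \<Phi> a b r (g r) \<partial>lborel)
         else f s = f t + (\<integral>\<^sup>+r\<in>{s..t}. lift \<Phi> a b r (g r) \<partial>lborel)"
proof -
  have [measurable]: "g \<in> borel_measurable borel" by (subst g[abs_def]) measurable
  have m: "(\<lambda>r. lift \<Phi> a b r (g r)) \<in> borel_measurable borel" using \<Phi>(1) by measurable
  have "d1 \<or> t \<le> 0" using D(3) assms by auto
  then show ?thesis using cum_split[OF m, of s t d1] assms unfolding f
    by (cases d1) (auto simp: add.assoc)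
qed

lemma volterra_integrand:
  "r \<in> D \<Longrightarrow> lift \<Phi> a b r (g r) = ennreal (exp (a * r) * \<Phi> (exp (b * r) * enn2real (g r)))"
  using fin(2)[of r] by (auto simp: lift_def)

lemma volterra_nonneg: "x \<ge> 0 \<Longrightarrow> 0 \<le> \<Phi> x"
  using \<Phi>(1,3) by (metis monoD order_trans)

lemma volterra_continuous: "continuous_on D (\<lambda>t. enn2real (f t))"
proof (rule increment_continuous[OF D(1,2) fin(1) volterra_increment])
  fix s t assume st: "s \<in> D" "t \<in> D" "s \<le> (t::real)"
  define U where "U = enn2real (max (g s) (g t))"
  have fU: "max (g s) (g t) < top" using fin(2) st by (auto simp: max_def)
  have eU: "ennreal U = max (g s) (g t)" unfolding U_def by (rule ennreal_enn2real[OF fU])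
  obtain K where K: "K \<ge> 0" "\<And>r X. r \<in> {s..t} \<Longrightarrow> X \<le> ennreal U \<Longrightarrow> lift \<Phi> a b r X \<le> ennreal K"
    using lift_le_Icc[OF \<Phi>(1,3) enn2real_nonneg] unfolding U_def by metis
  have "g r \<le> ennreal U" if "r \<in> {s..t}" for r
  proof -
    have "ennreal c1 + cum d2 Y r \<le> max (ennreal c1 + cum d2 Y s) (ennreal c1 + cum d2 Y t)"
      using cum_le_max[of s r t d2 Y] that unfolding le_max_iff_disj
      by (metis add_left_mono atLeastAtMost_iff)
    then show ?thesis unfolding eU g .
  qed
  then show "\<exists>K\<ge>0. \<forall>r\<in>{s..t}. lift \<Phi> a b r (g r) \<le> ennreal K" using K by blast
qed

lemma volterra_deriv:
  assumes cg: "continuous_on D (\<lambda>t. enn2real (g t))" and t: "t \<in> D"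
  shows "((\<lambda>t. enn2real (f t)) has_real_derivative
           (if d1 then 1 else -1) * (exp (a * t) * \<Phi> (exp (b * t) * enn2real (g t)))) (at t)"
proof -
  have "((\<lambda>t. enn2real (f t)) has_real_derivative
           (if d1 then (exp (a * t) * \<Phi> (exp (b * t) * enn2real (g t))) else - (exp (a * t) * \<Phi> (exp (b * t) * enn2real (g t))))) (at t)"
  proof (rule increment_deriv[OF D(1) fin(1) _ _ _ t])
    fix s t assume st: "s \<in> D" "t \<in> D" "s \<le> (t::real)"
    have "(\<integral>\<^sup>+r\<in>{s..t}. lift \<Phi> a b r (g r) \<partial>lborel) = (\<integral>\<^sup>+r\<in>{s..t}. ennreal (exp (a * r) * \<Phi> (exp (b * r) * enn2real (g r))) \<partial>lborel)"
    proof (rule nn_integral_cong)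
      fix r :: real
      have "r \<in> D" if "r \<in> {s..t}" using mem_is_interval_1_I[OF D(2) st(1,2)] that by simp
      then show "lift \<Phi> a b r (g r) * indicator {s..t} r = ennreal (exp (a * r) * \<Phi> (exp (b * r) * enn2real (g r))) * indicator {s..t} r"
        using volterra_integrand by (auto simp: indicator_def)
    qed
    then show "if d1 then f t = f s + (\<integral>\<^sup>+r\<in>{s..t}. ennreal (exp (a * r) * \<Phi> (exp (b * r) * enn2real (g r))) \<partial>lborel)
       else f s = f t + (\<integral>\<^sup>+r\<in>{s..t}. ennreal (exp (a * r) * \<Phi> (exp (b * r) * enn2real (g r))) \<partial>lborel)"
      using volterra_increment[OF st] by simp
  next
    show "continuous_on D (\<lambda>r. exp (a * r) * \<Phi> (exp (b * r) * enn2real (g r)))"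
      using cg by (intro continuous_intros continuous_on_compose2[OF \<Phi>(2)]) auto
  qed (auto intro!: mult_nonneg_nonneg volterra_nonneg)
  then show ?thesis by (auto split: if_splits)
qed

end

text \<open>
  Regularity of fixed points: finiteness gives local boundedness by monotonicity, this gives continuity of both components, and
  then the integrands are continuous and the integral equations can be differentiated.
\<close>
theorem volterra_solution_deriv:
  fixes f g :: "real \<Rightarrow> ennreal"
  assumes \<Phi>: "mono \<Phi>" "continuous_on UNIV \<Phi>" "\<Phi> 0 \<ge> 0"
    and \<Psi>: "mono \<Psi>" "continuous_on UNIV \<Psi>" "\<Psi> 0 \<ge> 0"
    and f: "\<And>t. f t = ennreal c0 + cum d1 (\<lambda>s. lift \<Phi> a b s (g s)) t"
    and g: "\<And>t. g t = cum d2 (\<lambda>s. lift \<Psi> a' b' s (f s)) t"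
    and D: "open D" "is_interval D" "(d1 \<and> d2) \<or> D \<subseteq> {..0}"
    and fin: "\<And>t. t \<in> D \<Longrightarrow> f t < top" "\<And>t. t \<in> D \<Longrightarrow> g t < top"
    and t: "t \<in> D"
  shows "((\<lambda>t. enn2real (f t)) has_real_derivative
           (if d1 then 1 else -1) * (exp (a * t) * \<Phi> (exp (b * t) * enn2real (g t)))) (at t)"
    and "((\<lambda>t. enn2real (g t)) has_real_derivative
           (if d2 then 1 else -1) * (exp (a' * t) * \<Psi> (exp (b' * t) * enn2real (f t)))) (at t)"
proof -
  have d1: "d1 \<or> D \<subseteq> {..0}" "d2 \<or> D \<subseteq> {..0}" using D(3) by auto
  have g': "\<And>t. g t = ennreal 0 + cum d2 (\<lambda>s. lift \<Psi> a' b' s (f s)) t" using g by simp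
  note cf = volterra_continuous[OF \<Phi> f g' D(1,2) d1(1) fin]
  note cg = volterra_continuous[OF \<Psi> g' f D(1,2) d1(2) fin(2,1)]
  show "((\<lambda>t. enn2real (f t)) has_real_derivative
           (if d1 then 1 else -1) * (exp (a * t) * \<Phi> (exp (b * t) * enn2real (g t)))) (at t)"
    by (rule volterra_deriv[OF \<Phi> f g' D(1,2) d1(1) fin cg t])
  show "((\<lambda>t. enn2real (g t)) has_real_derivative
           (if d2 then 1 else -1) * (exp (a' * t) * \<Psi> (exp (b' * t) * enn2real (f t)))) (at t)"
    by (rule volterra_deriv[OF \<Psi> g' f D(1,2) d1(2) fin(2,1) cf t])
qed

text \<open>
  The least fixed point of \<open>f \<mapsto> sup v (T f)\<close> lies above the lower solution \<open>v\<close> and is a fixed point of \<open>T\<close>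
  itself, since \<open>T f \<ge> T v \<ge> v\<close>. It lies below every upper solution above \<open>v\<close>.
\<close>
lemma knaster_tarski_above:
  fixes T :: "'a::complete_lattice \<Rightarrow> 'a"
  assumes T: "mono T" and v: "v \<le> T v"
  obtains f where "f = T f" "v \<le> f" "\<And>u. v \<le> u \<Longrightarrow> T u \<le> u \<Longrightarrow> f \<le> u"
proof -
  define S where "S = (\<lambda>f. sup v (T f))"
  have "mono S" unfolding S_def using T by (auto simp: mono_def intro: le_supI2)
  then have S: "lfp S = sup v (T (lfp S))" using lfp_unfold[of S] by (simp add: S_def)
  then have le: "v \<le> lfp S" by (metis sup_ge1)
  then have "v \<le> T (lfp S)" using order_trans[OF v monoD[OF T le]] by simp
  then have eq: "lfp S = T (lfp S)" using S by (simp add: sup_absorb2)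
  have "lfp S \<le> u" if "v \<le> u" "T u \<le> u" for u
    by (rule lfp_lowerbound) (use that in \<open>simp add: S_def\<close>)
  with eq le show ?thesis by (rule that[of "lfp S"])
qed

text \<open>
  The integral form of \<open>f' = exp (a t) \<Phi>(exp (b t) g)\<close>, \<open>g' = exp (a' t) \<Psi>(exp (b' t) f)\<close>, up to the signs that the
  directions of integration produce, with the second component eliminated.
\<close>
definition volterra where
  "volterra c0 d1 \<Phi> a b d2 \<Psi> a' b' f t = ennreal c0 +
     cum d1 (\<lambda>s. lift \<Phi> a b s (cum d2 (\<lambda>r. lift \<Psi> a' b' r (f r)) s)) t"

lemma volterra_mono:
  assumes "mono \<Phi>" "mono \<Psi>" shows "mono (volterra c0 d1 \<Phi> a b d2 \<Psi> a' b')"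
  unfolding volterra_def[abs_def]
  by (intro monoI le_funI add_left_mono cum_mono lift_mono assms) (simp add: le_fun_def)

text \<open>
  Beyond \<open>t1\<close> the upper solution takes the value \<open>\<infinity>\<close>, so that bounds near the end where the data are prescribed
  yield a fixed point for all times. The last clause, minimality, is what later shows that the solution cannot stop without blowing up.
\<close>
lemma volterra_fixpoint:
  fixes u1 u2 :: "real \<Rightarrow> real"
  assumes \<Phi>: "mono \<Phi>" and \<Psi>: "mono \<Psi>" and dt: "d1 \<and> d2 \<or> t1 = 0"
    and u1: "\<forall>t\<le>t1. ennreal c0 + cum d1 (\<lambda>s. lift \<Phi> a b s (ennreal (u2 s))) t \<le> ennreal (u1 t)"
    and u2: "\<forall>t\<le>t1. cum d2 (\<lambda>s. lift \<Psi> a' b' s (ennreal (u1 s))) t \<le> ennreal (u2 t)"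
    and v: "v \<le> volterra c0 d1 \<Phi> a b d2 \<Psi> a' b' v"
      "\<forall>t\<le>t1. v t \<le> ennreal (u1 t)"
  shows "\<exists>f g. (\<forall>t. f t = ennreal c0 + cum d1 (\<lambda>s. lift \<Phi> a b s (g s)) t) \<and>
    (\<forall>t. g t = cum d2 (\<lambda>s. lift \<Psi> a' b' s (f s)) t) \<and> v \<le> f \<and>
    (\<forall>t\<le>t1. f t \<le> ennreal (u1 t)) \<and> (\<forall>t\<le>t1. g t \<le> ennreal (u2 t)) \<and>
    (\<forall>u. v \<le> u \<longrightarrow> volterra c0 d1 \<Phi> a b d2 \<Psi> a' b' u \<le> u \<longrightarrow> f \<le> u)"
proof -
  note u1 = u1[rule_format] and u2 = u2[rule_format] and v = v(1) v(2)[rule_format]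
  let ?T = "volterra c0 d1 \<Phi> a b d2 \<Psi> a' b'"
  obtain f where f: "f = ?T f" "v \<le> f" and min: "\<And>u. v \<le> u \<Longrightarrow> ?T u \<le> u \<Longrightarrow> f \<le> u"
    using knaster_tarski_above[OF volterra_mono[OF \<Phi> \<Psi>] v(1)] by metis
  define g where "g = (\<lambda>t. cum d2 (\<lambda>s. lift \<Psi> a' b' s (f s)) t)"
  define u where "u = (\<lambda>t. if t \<le> t1 then ennreal (u1 t) else top)"
  have 2: "cum d2 (\<lambda>r. lift \<Psi> a' b' r (w r)) s \<le> ennreal (u2 s)"
    if "s \<le> t1" "\<And>r. r \<le> t1 \<Longrightarrow> w r \<le> ennreal (u1 r)" for s w
    by (rule order_trans[OF cum_prefix_mono[where ?t1.0 = t1] u2]) (use that \<Psi> dt in \<open>auto intro: lift_mono\<close>)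
  have "?T u t \<le> u t" for t
  proof (cases "t \<le> t1")
    case True
    have "?T u t \<le> ennreal c0 + cum d1 (\<lambda>s. lift \<Phi> a b s (ennreal (u2 s))) t"
      unfolding volterra_def
    proof (intro add_left_mono cum_prefix_mono[where ?t1.0 = t1])
      fix s assume s: "s \<le> t1"
      show "lift \<Phi> a b s (cum d2 (\<lambda>r. lift \<Psi> a' b' r (u r)) s) \<le> lift \<Phi> a b s (ennreal (u2 s))"
        by (intro lift_mono[OF \<Phi>] 2[OF s]) (simp add: u_def)
    qed (use True dt in auto)
    also have "\<dots> \<le> u t" using u1[OF True] True by (simp add: u_def)
    finally show ?thesis .
  qed (simp add: u_def)
  moreover have "v \<le> u" using v(2) by (auto simp: u_def le_fun_def)
  ultimately have "f \<le> u" by (intro min) (simp_all add: le_fun_def)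
  have fu: "f t \<le> ennreal (u1 t)" if "t \<le> t1" for t
    using le_funD[OF \<open>f \<le> u\<close>, of t] that by (simp add: u_def)
  have f_eq: "f t = ennreal c0 + cum d1 (\<lambda>s. lift \<Phi> a b s (g s)) t" for t
    using f(1) unfolding g_def volterra_def[abs_def] by (rule fun_cong)
  have g_eq: "g t = cum d2 (\<lambda>s. lift \<Psi> a' b' s (f s)) t" for t by (simp add: g_def)
  have gu: "g t \<le> ennreal (u2 t)" if "t \<le> t1" for t
    unfolding g_def by (rule 2[OF that fu])
  show ?thesis
    by (intro exI[of _ f] exI[of _ g] conjI allI impI f_eq g_eq f(2) fu gu min)
qed

section \<open>Limits and differential inequalities\<close>

lemma exp_mult_at_bot: "c > 0 \<Longrightarrow> ((\<lambda>s::real. exp (c * s)) \<longlongrightarrow> 0) at_bot"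
  by (rule filterlim_compose[OF exp_at_bot]) (rule filterlim_tendsto_pos_mult_at_bot[OF tendsto_const _ filterlim_ident])

lemma antimono_bounded_at_bot:
  fixes g :: "real \<Rightarrow> real"
  assumes mono: "\<And>s t. s \<le> t \<Longrightarrow> t \<le> t0 \<Longrightarrow> g t \<le> g s" and bd: "\<And>t. t \<le> t0 \<Longrightarrow> g t \<le> K"
  obtains L where "(g \<longlongrightarrow> L) at_bot" "\<And>t. t \<le> t0 \<Longrightarrow> g t \<le> L"
proof -
  define L where "L = Sup (g ` {..t0})"
  have bdd: "bdd_above (g ` {..t0})" using bd by (intro bdd_aboveI[of _ K]) auto
  have le: "g t \<le> L" if "t \<le> t0" for t
    unfolding L_def using that by (intro cSup_upper bdd) auto
  have "(g \<longlongrightarrow> L) at_bot"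
  proof (rule order_tendstoI)
    fix a assume "a < L"
    then obtain s where s: "s \<le> t0" "a < g s"
      using less_cSupD[of "g ` {..t0}" a] unfolding L_def by auto
    show "\<forall>\<^sub>F t in at_bot. a < g t"
      using eventually_le_at_bot[of s]
      by eventually_elim (use s mono in \<open>meson less_le_trans\<close>)
  next
    fix a assume "L < a"
    show "\<forall>\<^sub>F t in at_bot. g t < a"
      using eventually_le_at_bot[of t0]
      by eventually_elim (use \<open>L < a\<close> le in \<open>meson le_less_trans\<close>)
  qed
  then show ?thesis using le that by blast
qed

lemma exp_mult_at_top: "c > 0 \<Longrightarrow> filterlim (\<lambda>s::real. exp (c * s)) at_top at_top"
  by (rule filterlim_compose[OF exp_at_top]) (rule filterlim_tendsto_pos_mult_at_top[OF tendsto_const _ filterlim_ident])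

text \<open>
  L'Hospital's rule at \<open>0\<close> in the variable \<open>exp t\<close>.
\<close>
lemma exp_lhopital_at_bot:
  fixes F F' :: "real \<Rightarrow> real"
  assumes A: "A > 0" and F: "(F \<longlongrightarrow> 0) at_bot"
    and dF: "\<And>t. t < t0 \<Longrightarrow> (F has_real_derivative F' t) (at t)"
    and lim: "((\<lambda>t. exp (- A * t) * F' t) \<longlongrightarrow> L) at_bot"
  shows "((\<lambda>t. exp (- A * t) * F t) \<longlongrightarrow> L / A) at_bot"
proof -
  have ev: "\<forall>\<^sub>F r in at_right (0::real). r > 0 \<and> r < exp t0"
    using eventually_at_right_less[of "0::real"] eventually_at_right_real[of 0 "exp t0"]
    by (auto elim: eventually_elim2)
  have "((\<lambda>r. F (ln r) / r powr A) \<longlongrightarrow> L / A) (at_right 0)"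
  proof (rule lhopital_right_0[where f' = "\<lambda>r. F' (ln r) * inverse r" and g' = "\<lambda>r. A * r powr (A - 1)"])
    show "((\<lambda>r. F (ln r)) \<longlongrightarrow> 0) (at_right 0)" by (rule filterlim_compose[OF F ln_at_0])
    have "((\<lambda>r::real. exp (A * ln r)) \<longlongrightarrow> 0) (at_right 0)"
      by (rule filterlim_compose[OF exp_mult_at_bot[OF A] ln_at_0])
    then show "((\<lambda>r::real. r powr A) \<longlongrightarrow> 0) (at_right 0)"
    proof (rule Lim_transform_eventually)
      show "\<forall>\<^sub>F r in at_right 0. exp (A * ln r) = r powr A"
        using ev by eventually_elim (simp add: powr_def)
    qed
    show "\<forall>\<^sub>F r in at_right 0. r powr A \<noteq> 0" using ev by eventually_elim simp
    show "\<forall>\<^sub>F r in at_right 0. A * r powr (A - 1) \<noteq> 0" by (rule eventually_mono[OF ev]) (use A in simp)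
    show "\<forall>\<^sub>F r in at_right 0. ((\<lambda>r. F (ln r)) has_real_derivative F' (ln r) * inverse r) (at r)"
      using ev
    proof eventually_elim
      case (elim r)
      then have "ln r < t0" by (metis exp_gt_zero ln_exp ln_less_cancel_iff)
      then show ?case using elim by (intro DERIV_chain2[OF dF] DERIV_ln) auto
    qed
    show "\<forall>\<^sub>F r in at_right 0. ((\<lambda>r. r powr A) has_real_derivative A * r powr (A - 1)) (at r)"
      using ev by eventually_elim (rule has_real_derivative_powr, simp)
    have "((\<lambda>r. exp (- A * ln r) * F' (ln r) / A) \<longlongrightarrow> L / A) (at_right 0)"
      using A by (intro tendsto_divide tendsto_const filterlim_compose[OF lim ln_at_0]) simp
    then show "((\<lambda>r. F' (ln r) * inverse r / (A * r powr (A - 1))) \<longlongrightarrow> L / A) (at_right 0)"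
    proof (rule Lim_transform_eventually)
      show "\<forall>\<^sub>F r in at_right 0. exp (- A * ln r) * F' (ln r) / A = F' (ln r) * inverse r / (A * r powr (A - 1))"
        using ev
      proof eventually_elim
        case (elim r)
        have "r powr (A - 1) * r = r powr A" using elim powr_add[of r "A - 1" 1] by simp
        moreover have "exp (- A * ln r) = inverse (r powr A)" using elim by (simp add: powr_def exp_minus)
        ultimately show ?case using elim A by (simp add: field_simps)
      qed
    qed
  qed
  then have "((\<lambda>t. F (ln (exp t)) / exp t powr A) \<longlongrightarrow> L / A) at_bot"
    by (rule filterlim_compose) (auto simp: filterlim_at exp_at_bot)
  then show ?thesis by (simp add: powr_def exp_minus field_simps)
qed

lemma small_power:
  fixes K e :: real assumes "K > 0" "e > 1"
  obtains M where "M > 0" "K * M powr e \<le> M / 2"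
proof -
  define M where "M = (1 / (2 * K)) powr (1 / (e - 1))"
  have M: "M > 0" using assms by (simp add: M_def)
  have "M powr (e - 1) = 1 / (2 * K)" using assms by (simp add: M_def powr_powr)
  moreover have "M powr e = M * M powr (e - 1)" using M powr_add[of M 1 "e - 1"] by simp
  ultimately show ?thesis using that[of M] M assms by (simp add: field_simps)
qed

lemma exp_assoc: "exp a * (exp b * x) = exp (a + b) * (x::real)"
  by (simp add: exp_add)

lemma linear_decrease_false:
  fixes f :: "real \<Rightarrow> real"
  assumes "c > 0" and pos: "\<And>t. t \<ge> t1 \<Longrightarrow> f t > 0"
    and d: "\<And>t. t \<ge> t1 \<Longrightarrow> \<exists>d. (f has_real_derivative d) (at t) \<and> d \<le> - c"
  shows False
proof -
  define t where "t = t1 + f t1 / c"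
  have t: "t \<ge> t1" using pos[of t1] assms(1) by (simp add: t_def)
  have "f t1 + c * t1 \<ge> f t + c * t"
  proof (rule DERIV_nonpos_imp_nonincreasing[OF t])
    fix x assume "t1 \<le> x" "x \<le> t"
    then obtain d where "(f has_real_derivative d) (at x)" "d \<le> - c" using d by blast
    then show "\<exists>y. ((\<lambda>x. f x + c * x) has_real_derivative y) (at x) \<and> y \<le> 0"
      by (intro exI[of _ "d + c"]) (auto intro!: derivative_eq_intros)
  qed
  moreover have "c * t = c * t1 + f t1" using assms(1) by (simp add: t_def field_simps)
  ultimately show False using pos[OF t] by simp
qed

lemma exp_growth_ge:
  fixes f :: "real \<Rightarrow> real"
  assumes "s \<le> t" and d: "\<And>x. s \<le> x \<Longrightarrow> x \<le> t \<Longrightarrow> \<exists>d. (f has_real_derivative d) (at x) \<and> d \<ge> c * f x"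
  shows "f s * exp (c * (t - s)) \<le> f t"
proof -
  have "exp (- c * s) * f s \<le> exp (- c * t) * f t"
  proof (rule DERIV_nonneg_imp_nondecreasing[OF assms(1)])
    fix x assume "s \<le> x" "x \<le> t"
    then obtain d where d: "(f has_real_derivative d) (at x)" "d \<ge> c * f x" using d by blast
    have "((\<lambda>x. exp (- c * x) * f x) has_real_derivative exp (- c * x) * (d - c * f x)) (at x)"
      by (auto intro!: derivative_eq_intros d(1) simp: algebra_simps)
    then show "\<exists>y. ((\<lambda>x. exp (- c * x) * f x) has_real_derivative y) (at x) \<and> y \<ge> 0"
      using d(2) by - (rule exI, rule conjI, assumption, simp)
  qed
  then have "exp (c * t) * (exp (- c * s) * f s) \<le> exp (c * t) * (exp (- c * t) * f t)" by simp
  then show ?thesis unfolding exp_assoc by (simp add: algebra_simps)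
qed

text \<open>
  The function \<open>exp (- c L)\<close> decreases at least linearly, so it would become negative.
\<close>
lemma exponential_blowup_false:
  fixes L :: "real \<Rightarrow> real"
  assumes c: "c > 0" and d: "\<And>t. t \<ge> t1 \<Longrightarrow> \<exists>d. (L has_real_derivative d) (at t) \<and> d \<ge> exp (c * L t) - 1"
    and L1: "L t1 > 0"
  shows False
proof -
  have low: "L t \<ge> L t1" if t: "t \<ge> t1" for t
  proof -
    have "L t1 * exp (c * (t - t1)) \<le> L t"
    proof (rule exp_growth_ge[OF t])
      fix x assume "t1 \<le> x"
      then obtain d where "(L has_real_derivative d) (at x)" "d \<ge> exp (c * L x) - 1" using d by blast
      then show "\<exists>d. (L has_real_derivative d) (at x) \<and> d \<ge> c * L x"
        using exp_ge_add_one_self[of "c * L x"] by (intro exI[of _ d]) linarith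
    qed
    moreover have "L t1 * 1 \<le> L t1 * exp (c * (t - t1))" using L1 c t by (intro mult_left_mono) auto
    ultimately show ?thesis by simp
  qed
  define E1 where "E1 = exp (- c * L t1)"
  have E1: "E1 < 1" using c L1 by (simp add: E1_def)
  show False
  proof (rule linear_decrease_false[of "c * (1 - E1)" t1 "\<lambda>t. exp (- c * L t)"])
    show "c * (1 - E1) > 0" using c E1 by simp
    fix t assume t: "t \<ge> t1"
    then obtain d where d: "(L has_real_derivative d) (at t)" "d \<ge> exp (c * L t) - 1" using d by blast
    have "((\<lambda>t. exp (- c * L t)) has_real_derivative - (c * exp (- c * L t) * d)) (at t)"
      by (auto intro!: derivative_eq_intros d(1) simp: algebra_simps)
    moreover have "c * exp (- c * L t) * d \<ge> c * (1 - E1)"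
    proof -
      have "exp (- c * L t) \<le> E1" unfolding E1_def using low[OF t] c by simp
      moreover have "exp (- c * L t) * d \<ge> exp (- c * L t) * (exp (c * L t) - 1)"
        using d(2) by (intro mult_left_mono) auto
      moreover have "exp (- c * L t) * (exp (c * L t) - 1) = 1 - exp (- c * L t)"
        by (simp add: algebra_simps flip: exp_add)
      ultimately have "1 - E1 \<le> exp (- c * L t) * d" by linarith
      then show ?thesis using c by (simp add: mult.assoc)
    qed
    ultimately show "\<exists>d. ((\<lambda>t. exp (- c * L t)) has_real_derivative d) (at t) \<and> d \<le> - (c * (1 - E1))"
      by - (rule exI, rule conjI, assumption, simp)
  qed simp
qed

text \<open>
  At the first time at which one component vanishes, both have been nondecreasing so far, hence are at least their positive
  initial values.
\<close>
lemma coupled_positivity: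
  fixes f g f' g' :: "real \<Rightarrow> real"
  assumes t: "t1 \<le> t2" and pos: "f t1 > 0" "g t1 > 0"
    and f: "\<And>t. t1 \<le> t \<Longrightarrow> t \<le> t2 \<Longrightarrow> (f has_real_derivative f' t) (at t)"
    and g: "\<And>t. t1 \<le> t \<Longrightarrow> t \<le> t2 \<Longrightarrow> (g has_real_derivative g' t) (at t)"
    and fm: "\<And>t. t1 \<le> t \<Longrightarrow> t \<le> t2 \<Longrightarrow> g t > 0 \<Longrightarrow> f' t \<ge> 0"
    and gm: "\<And>t. t1 \<le> t \<Longrightarrow> t \<le> t2 \<Longrightarrow> f t > 0 \<Longrightarrow> g' t \<ge> 0"
  shows "f t2 > 0 \<and> g t2 > 0"
proof (rule ccontr)
  assume neg: "\<not> ?thesis"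
  define m where "m = (\<lambda>t. min (f t) (g t))"
  have cf: "continuous_on {t1..t2} f" and cg: "continuous_on {t1..t2} g"
    using f g by (auto intro!: continuous_at_imp_continuous_on DERIV_isCont)
  then have "continuous_on {t1..t2} m" unfolding m_def by (intro continuous_intros)
  moreover have "m t1 > 0" "m t2 \<le> 0" using pos neg by (auto simp: m_def)
  ultimately have cl: "closed ({t1..t2} \<inter> m -` {..0})"
    by (intro continuous_closed_preimage) auto
  define S where "S = {t1..t2} \<inter> m -` {..0}"
  have "S \<noteq> {}" using t \<open>m t2 \<le> 0\<close> by (auto simp: S_def)
  moreover have "bdd_below S" by (auto simp: S_def intro: bdd_belowI[of _ t1])
  ultimately have s: "Inf S \<in> S" using cl unfolding S_def by (intro closed_contains_Inf)
  define s where "s = Inf S"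
  have sb: "t1 \<le> s" "s \<le> t2" "m s \<le> 0" using s by (auto simp: s_def S_def)
  have below: "f r > 0 \<and> g r > 0" if "t1 \<le> r" "r < s" for r
  proof -
    have "r \<notin> S" using that(2) cInf_lower[OF _ \<open>bdd_below S\<close>, of r] by (auto simp: s_def)
    then show ?thesis using that sb by (auto simp: S_def m_def)
  qed
  have s1: "t1 < s" using sb(1,3) \<open>m t1 > 0\<close> by (cases "t1 = s") auto
  have lim: "h s \<ge> h t1" if c: "isCont h s" and le: "\<And>r. t1 \<le> r \<Longrightarrow> r < s \<Longrightarrow> h t1 \<le> h r"
    for h :: "real \<Rightarrow> real"
  proof -
    have "(h \<longlongrightarrow> h s) (at_left s)"
      by (rule tendsto_within_subset[OF isContD[OF c] subset_UNIV])
    moreover have "\<forall>\<^sub>F r in at_left s. h t1 \<le> h r"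
      using eventually_at_leftI[of t1 s "\<lambda>r. h t1 \<le> h r"] le s1 by auto
    ultimately show ?thesis by (rule tendsto_lowerbound) simp
  qed
  have "f t1 \<le> f r" "g t1 \<le> g r" if r: "t1 \<le> r" "r < s" for r
  proof -
    show "f t1 \<le> f r"
      by (rule DERIV_nonneg_imp_nondecreasing[OF r(1)]) (use f fm below r sb in \<open>meson order_trans le_less_trans less_imp_le\<close>)
    show "g t1 \<le> g r"
      by (rule DERIV_nonneg_imp_nondecreasing[OF r(1)]) (use g gm below r sb in \<open>meson order_trans le_less_trans less_imp_le\<close>)
  qed
  then have "f s \<ge> f t1" "g s \<ge> g t1" using lim[OF DERIV_isCont[OF f]] lim[OF DERIV_isCont[OF g]] sb by auto
  then show False using sb(3) pos by (auto simp: m_def)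
qed

text \<open>
  The tangent of the exponential function at the mean value lies below its graph.
\<close>
lemma exp_jensen:
  fixes a b x y :: real
  assumes "a \<ge> 0" "b \<ge> 0" "a + b = 1"
  shows "exp (a * x + b * y) \<le> a * exp x + b * exp y"
proof -
  define m where "m = a * x + b * y"
  have tang: "exp m * (1 + (u - m)) \<le> exp u" for u
    using mult_left_mono[OF exp_ge_add_one_self[of "u - m"], of "exp m"] by (simp flip: exp_add)
  have "exp m = a * (exp m * (1 + (x - m))) + b * (exp m * (1 + (y - m)))"
  proof -
    have "a * (1 + (x - m)) + b * (1 + (y - m)) = (a + b) * (1 - m) + m" by (simp add: m_def algebra_simps)
    then have "a * (1 + (x - m)) + b * (1 + (y - m)) = 1" using assms(3) by simp
    then have "exp m * (a * (1 + (x - m)) + b * (1 + (y - m))) = exp m" by simp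
    then show ?thesis by (simp add: algebra_simps)
  qed
  also have "\<dots> \<le> a * exp x + b * exp y" using assms tang by (intro add_mono mult_left_mono) auto
  finally show ?thesis by (simp add: m_def)
qed

section \<open>Branches of solutions that leave an equilibrium\<close>

text \<open>
  Half of the system: bounds \<open>b (x \<plusminus> \<mu> x\<^sup>2)\<close> for one component, with \<open>x = exp (\<rho> t)\<close>, are turned into bounds \<open>a (x \<plusminus> \<mu> x\<^sup>2)\<close>
  for the other one, up to the time \<open>t1\<close> at which \<open>\<mu> x = 1\<close>.
\<close>
context
  fixes \<Phi> :: "real \<Rightarrow> real" and a b c \<rho> \<omega> \<omega>' C \<mu> t1 :: real
  assumes \<Phi>: "mono \<Phi>" "continuous_on UNIV \<Phi>"
    and quad: "\<And>k. 0 \<le> k \<Longrightarrow> k \<le> 1/2 \<Longrightarrow> \<bar>\<Phi> k - c * k\<bar> \<le> C * k\<^sup>2"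
    and pos: "a > 0" "b > 0" "C \<ge> 0" "\<mu> > 0" "\<rho> > 0" "\<rho> - \<omega> > 0"
    and eig: "(\<rho> - \<omega>) * a = c * b"
    and \<mu>: "4 * C * b\<^sup>2 \<le> \<rho> * a * \<mu>" "4 * b \<le> \<mu>" and t1: "exp (\<rho> * t1) = 1 / \<mu>"
begin

lemma branch_scale: "r \<le> t1 \<Longrightarrow> \<mu> * exp (\<rho> * r) \<le> 1"
proof -
  assume "r \<le> t1"
  then have "exp (\<rho> * r) \<le> exp (\<rho> * t1)" using pos by simp
  then show ?thesis unfolding t1 using pos by (simp add: field_simps)
qed

lemma branch_nonneg: "0 \<le> \<Phi> k" if "k \<ge> 0"
proof -
  have "\<Phi> 0 = 0" using quad[of 0] by simp
  then show ?thesis using monoD[OF \<Phi>(1) that] by simp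
qed

text \<open>
  The correction \<open>\<mu> x\<^sup>2\<close> is reproduced with the smaller factor that belongs to the exponent \<open>2 \<rho>\<close>; the difference
  absorbs the quadratic error of \<open>\<Phi>\<close> once \<open>\<mu>\<close> is large.
\<close>
lemma branch_upper:
  assumes t: "t \<le> t1"
  shows "cum True (\<lambda>r. lift \<Phi> (- \<omega>) \<omega>' r (ennreal (exp (- \<omega>' * r) * (b * (exp (\<rho> * r) + \<mu> * (exp (\<rho> * r))\<^sup>2))))) t
         \<le> ennreal (exp (- \<omega> * t) * (a * (exp (\<rho> * t) + \<mu> * (exp (\<rho> * t))\<^sup>2)))"
proof (rule cum_up_le[where x = "\<lambda>r. exp (- \<omega> * r) * \<Phi> (b * (exp (\<rho> * r) + \<mu> * (exp (\<rho> * r))\<^sup>2))"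
      and U = "\<lambda>t. exp (- \<omega> * t) * (a * (exp (\<rho> * t) + \<mu> * (exp (\<rho> * t))\<^sup>2))"
      and U' = "\<lambda>r. exp (- \<omega> * r) * (a * ((\<rho> - \<omega>) * exp (\<rho> * r) + (2 * \<rho> - \<omega>) * (\<mu> * (exp (\<rho> * r))\<^sup>2)))"])
  fix r assume r: "r \<le> t"
  show "lift \<Phi> (- \<omega>) \<omega>' r (ennreal (exp (- \<omega>' * r) * (b * (exp (\<rho> * r) + \<mu> * (exp (\<rho> * r))\<^sup>2))))
     \<le> ennreal (exp (- \<omega> * r) * \<Phi> (b * (exp (\<rho> * r) + \<mu> * (exp (\<rho> * r))\<^sup>2)))"
  proof -
    have nn: "0 \<le> exp (- \<omega>' * r) * (b * (exp (\<rho> * r) + \<mu> * (exp (\<rho> * r))\<^sup>2))" using pos by simp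
    have "exp (\<omega>' * r) * (exp (- \<omega>' * r) * y) = y" for y by (simp add: exp_minus)
    then show ?thesis by (simp only: lift_ennreal[OF nn])
  qed
  show "0 \<le> exp (- \<omega> * r) * \<Phi> (b * (exp (\<rho> * r) + \<mu> * (exp (\<rho> * r))\<^sup>2))"
    using pos by (intro mult_nonneg_nonneg branch_nonneg) auto
  show "((\<lambda>t. exp (- \<omega> * t) * (a * (exp (\<rho> * t) + \<mu> * (exp (\<rho> * t))\<^sup>2))) has_real_derivative
      exp (- \<omega> * r) * (a * ((\<rho> - \<omega>) * exp (\<rho> * r) + (2 * \<rho> - \<omega>) * (\<mu> * (exp (\<rho> * r))\<^sup>2)))) (at r)"
    by (auto intro!: derivative_eq_intros simp: algebra_simps power2_eq_square)
  define x where "x = exp (\<rho> * r)"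
  have x: "x > 0" "\<mu> * x \<le> 1" using branch_scale[of r] r t by (auto simp: x_def)
  have x2: "x + \<mu> * x\<^sup>2 \<le> 2 * x"
    using mult_right_mono[OF x(2), of x] x(1) by (simp add: power2_eq_square)
  have "b * (x + \<mu> * x\<^sup>2) \<le> b * (2 * x)" using x2 pos by simp
  also have "\<dots> \<le> \<mu> * x / 2" using mult_right_mono[OF \<mu>(2), of x] x(1) by simp
  finally have half: "b * (x + \<mu> * x\<^sup>2) \<le> 1/2" using x(2) by simp
  have k0: "0 \<le> b * (x + \<mu> * x\<^sup>2)" using pos x by simp
  have "\<Phi> (b * (x + \<mu> * x\<^sup>2)) \<le> c * (b * (x + \<mu> * x\<^sup>2)) + C * (b * (x + \<mu> * x\<^sup>2))\<^sup>2"
    using quad[OF k0 half] by linarith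
  also have "C * (b * (x + \<mu> * x\<^sup>2))\<^sup>2 \<le> C * (b * (2 * x))\<^sup>2"
    using x2 pos x k0 by (intro mult_left_mono power_mono) auto
  also have "\<dots> = (4 * C * b\<^sup>2) * x\<^sup>2" by (simp add: power2_eq_square)
  also have "\<dots> \<le> (\<rho> * a * \<mu>) * x\<^sup>2" using \<mu>(1) by (intro mult_right_mono) auto
  also have "c * (b * (x + \<mu> * x\<^sup>2)) = (\<rho> - \<omega>) * a * (x + \<mu> * x\<^sup>2)" by (simp add: eig)
  also have "(\<rho> - \<omega>) * a * (x + \<mu> * x\<^sup>2) + \<rho> * a * \<mu> * x\<^sup>2 = a * ((\<rho> - \<omega>) * x + (2 * \<rho> - \<omega>) * (\<mu> * x\<^sup>2))"
    by (simp add: algebra_simps)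
  finally show "exp (- \<omega> * r) * \<Phi> (b * (exp (\<rho> * r) + \<mu> * (exp (\<rho> * r))\<^sup>2))
     \<le> exp (- \<omega> * r) * (a * ((\<rho> - \<omega>) * exp (\<rho> * r) + (2 * \<rho> - \<omega>) * (\<mu> * (exp (\<rho> * r))\<^sup>2)))"
    unfolding x_def[symmetric] by (intro mult_left_mono) auto
  show "0 \<le> exp (- \<omega> * r) * (a * (exp (\<rho> * r) + \<mu> * (exp (\<rho> * r))\<^sup>2))"
    using pos by auto
next
  show "continuous_on {..t} (\<lambda>r. exp (- \<omega> * r) * \<Phi> (b * (exp (\<rho> * r) + \<mu> * (exp (\<rho> * r))\<^sup>2)))"
    by (intro continuous_intros continuous_on_compose2[OF \<Phi>(2)]) auto
qed

lemma branch_lower: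
  assumes t: "t \<le> t1" and X: "\<And>r. r \<le> t \<Longrightarrow>
      ennreal (exp (- \<omega>' * r) * (b * (exp (\<rho> * r) - \<mu> * (exp (\<rho> * r))\<^sup>2))) \<le> X r"
  shows "ennreal (exp (- \<omega> * t) * (a * (exp (\<rho> * t) - \<mu> * (exp (\<rho> * t))\<^sup>2)))
         \<le> cum True (\<lambda>r. lift \<Phi> (- \<omega>) \<omega>' r (X r)) t"
proof (rule cum_up_ge[where x = "\<lambda>r. exp (- \<omega> * r) * \<Phi> (b * (exp (\<rho> * r) - \<mu> * (exp (\<rho> * r))\<^sup>2))"
      and V = "\<lambda>t. exp (- \<omega> * t) * (a * (exp (\<rho> * t) - \<mu> * (exp (\<rho> * t))\<^sup>2))"
      and V' = "\<lambda>r. exp (- \<omega> * r) * (a * ((\<rho> - \<omega>) * exp (\<rho> * r) - (2 * \<rho> - \<omega>) * (\<mu> * (exp (\<rho> * r))\<^sup>2)))"])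
  fix r assume r: "r \<le> t"
  define x where "x = exp (\<rho> * r)"
  have x: "x > 0" "\<mu> * x \<le> 1" using branch_scale[of r] r t by (auto simp: x_def)
  have x2: "0 \<le> x - \<mu> * x\<^sup>2" "x - \<mu> * x\<^sup>2 \<le> x"
    using mult_right_mono[OF x(2), of x] x(1) pos by (auto simp: power2_eq_square)
  have "b * (x - \<mu> * x\<^sup>2) \<le> b * x" using x2 pos by simp
  also have "\<dots> \<le> \<mu> * x / 4" using mult_right_mono[OF \<mu>(2), of x] x(1) by simp
  finally have half: "b * (x - \<mu> * x\<^sup>2) \<le> 1/2" using x(2) by simp
  have k0: "0 \<le> b * (x - \<mu> * x\<^sup>2)" using pos x2 by simp
  have nn: "0 \<le> exp (- \<omega>' * r) * (b * (x - \<mu> * x\<^sup>2))" using k0 by simp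
  have e1: "exp (\<omega>' * r) * (exp (- \<omega>' * r) * (b * (x - \<mu> * x\<^sup>2))) = b * (x - \<mu> * x\<^sup>2)"
    by (simp add: exp_minus field_simps)
  have "ennreal (exp (- \<omega> * r) * \<Phi> (b * (x - \<mu> * x\<^sup>2)))
      = lift \<Phi> (- \<omega>) \<omega>' r (ennreal (exp (- \<omega>' * r) * (b * (x - \<mu> * x\<^sup>2))))"
    by (subst lift_ennreal[OF nn]) (simp only: e1)
  also have "\<dots> \<le> lift \<Phi> (- \<omega>) \<omega>' r (X r)"
    using X[OF r] unfolding x_def by (rule lift_mono[OF \<Phi>(1)])
  finally show "ennreal (exp (- \<omega> * r) * \<Phi> (b * (exp (\<rho> * r) - \<mu> * (exp (\<rho> * r))\<^sup>2))) \<le> lift \<Phi> (- \<omega>) \<omega>' r (X r)"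
    unfolding x_def .
  show "0 \<le> exp (- \<omega> * r) * \<Phi> (b * (exp (\<rho> * r) - \<mu> * (exp (\<rho> * r))\<^sup>2))"
    using branch_nonneg[OF k0] unfolding x_def by simp
  show "((\<lambda>t. exp (- \<omega> * t) * (a * (exp (\<rho> * t) - \<mu> * (exp (\<rho> * t))\<^sup>2))) has_real_derivative
      exp (- \<omega> * r) * (a * ((\<rho> - \<omega>) * exp (\<rho> * r) - (2 * \<rho> - \<omega>) * (\<mu> * (exp (\<rho> * r))\<^sup>2)))) (at r)"
    by (auto intro!: derivative_eq_intros simp: algebra_simps power2_eq_square)
  have "C * (b * (x - \<mu> * x\<^sup>2))\<^sup>2 \<le> C * (b * x)\<^sup>2"
    using x2 pos x k0 by (intro mult_left_mono power_mono) auto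
  also have "\<dots> \<le> (4 * C * b\<^sup>2) * x\<^sup>2" using pos by (simp add: power2_eq_square)
  also have "\<dots> \<le> (\<rho> * a * \<mu>) * x\<^sup>2" using \<mu>(1) by (intro mult_right_mono) auto
  finally have Q: "C * (b * (x - \<mu> * x\<^sup>2))\<^sup>2 \<le> (\<rho> * a * \<mu>) * x\<^sup>2" .
  have "a * ((\<rho> - \<omega>) * x - (2 * \<rho> - \<omega>) * (\<mu> * x\<^sup>2)) = ((\<rho> - \<omega>) * a) * (x - \<mu> * x\<^sup>2) - (\<rho> * a * \<mu>) * x\<^sup>2"
    by (simp add: algebra_simps)
  also have "\<dots> = c * (b * (x - \<mu> * x\<^sup>2)) - (\<rho> * a * \<mu>) * x\<^sup>2" unfolding eig by simp
  also have "\<dots> \<le> \<Phi> (b * (x - \<mu> * x\<^sup>2))" using quad[OF k0 half] Q by linarith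
  finally show "exp (- \<omega> * r) * (a * ((\<rho> - \<omega>) * exp (\<rho> * r) - (2 * \<rho> - \<omega>) * (\<mu> * (exp (\<rho> * r))\<^sup>2)))
     \<le> exp (- \<omega> * r) * \<Phi> (b * (exp (\<rho> * r) - \<mu> * (exp (\<rho> * r))\<^sup>2))"
    unfolding x_def by (intro mult_left_mono) auto
next
  show "continuous_on {..t} (\<lambda>r. exp (- \<omega> * r) * \<Phi> (b * (exp (\<rho> * r) - \<mu> * (exp (\<rho> * r))\<^sup>2)))"
    by (intro continuous_intros continuous_on_compose2[OF \<Phi>(2)]) auto
  have eq: "exp (- \<omega> * t) * (a * (exp (\<rho> * t) - \<mu> * (exp (\<rho> * t))\<^sup>2))
     = a * (exp ((\<rho> - \<omega>) * t) - \<mu> * exp ((2 * \<rho> - \<omega>) * t))" for t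
    by (simp add: algebra_simps power2_eq_square flip: exp_add)
  have "((\<lambda>t. a * (exp ((\<rho> - \<omega>) * t) - \<mu> * exp ((2 * \<rho> - \<omega>) * t))) \<longlongrightarrow> a * (0 - \<mu> * 0)) at_bot"
    using pos by (intro tendsto_intros exp_mult_at_bot) auto
  then show "((\<lambda>t. exp (- \<omega> * t) * (a * (exp (\<rho> * t) - \<mu> * (exp (\<rho> * t))\<^sup>2))) \<longlongrightarrow> 0) at_bot"
    unfolding eq by simp
qed

end

text \<open>
  The components are handled in the integrated form \<open>f = exp (- \<omega> t) h\<close>, \<open>g = exp (- \<omega>' t) k\<close>, in which
  both are nondecreasing. The equation for \<open>\<rho>\<close> says that \<open>\<rho>\<close> is an eigenvalue of the linearized system and
  \<open>(c, \<rho> - \<omega>)\<close> an eigenvector. The bounds between which the solution is constructed are asymptotic to the eigenvector times \<open>exp (\<rho> t)\<close>.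
\<close>
theorem unstable_branch:
  fixes \<Phi> \<Psi> :: "real \<Rightarrow> real" and c d C \<rho> \<omega> \<omega>' :: real
  assumes \<Phi>: "mono \<Phi>" "continuous_on UNIV \<Phi>"
      "\<And>k. 0 \<le> k \<Longrightarrow> k \<le> 1/2 \<Longrightarrow> \<bar>\<Phi> k - c * k\<bar> \<le> C * k\<^sup>2"
    and \<Psi>: "mono \<Psi>" "continuous_on UNIV \<Psi>"
      "\<And>h. 0 \<le> h \<Longrightarrow> h \<le> 1/2 \<Longrightarrow> \<bar>\<Psi> h - d * h\<bar> \<le> C * h\<^sup>2"
    and pos: "c > 0" "d > 0" "C \<ge> 0" "\<rho> > 0" "\<rho> - \<omega> > 0" "\<rho> - \<omega>' > 0"
    and eig: "(\<rho> - \<omega>) * (\<rho> - \<omega>') = c * d"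
  obtains D h k where "D = UNIV \<or> (\<exists>T. D = {..<T} \<and> filterlim h at_top (at_left T))"
    "\<And>t. t \<in> D \<Longrightarrow> h t > 0" "\<And>t. t \<in> D \<Longrightarrow> k t > 0"
    "\<And>t. t \<in> D \<Longrightarrow> (h has_real_derivative \<omega> * h t + \<Phi> (k t)) (at t)"
    "\<And>t. t \<in> D \<Longrightarrow> (k has_real_derivative \<omega>' * k t + \<Psi> (h t)) (at t)"
    "(h \<longlongrightarrow> 0) at_bot" "(k \<longlongrightarrow> 0) at_bot"
proof -
  note result = that
  define a where "a = c" define b where "b = \<rho> - \<omega>"
  have ab: "a > 0" "b > 0" using pos by (auto simp: a_def b_def)
  \<comment> \<open>The four terms meet the requirements of \<open>branch_upper\<close> and \<open>branch_lower\<close> for both equations.\<close>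
  define \<mu> where "\<mu> = 4 * C * b\<^sup>2 / (\<rho> * a) + 4 * C * a\<^sup>2 / (\<rho> * b) + 4 * a + 4 * b"
  have \<mu>0: "\<mu> > 0" unfolding \<mu>_def using ab pos by (intro add_nonneg_pos add_nonneg_nonneg) auto
  have p1: "0 \<le> 4 * C * b\<^sup>2 / (\<rho> * a)" "0 \<le> 4 * C * a\<^sup>2 / (\<rho> * b)" using ab pos by auto
  have "4 * C * b\<^sup>2 / (\<rho> * a) \<le> \<mu>" "4 * C * a\<^sup>2 / (\<rho> * b) \<le> \<mu>" and \<mu>3: "4 * b \<le> \<mu>" "4 * a \<le> \<mu>"
    unfolding \<mu>_def using ab p1 by linarith+
  then have \<mu>1: "4 * C * b\<^sup>2 \<le> \<rho> * a * \<mu>" "4 * C * a\<^sup>2 \<le> \<rho> * b * \<mu>"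
    using ab pos by (simp_all add: field_simps)
  define t1 where "t1 = - ln \<mu> / \<rho>"
  have t1: "exp (\<rho> * t1) = 1 / \<mu>" using pos \<mu>0 by (simp add: t1_def exp_minus field_simps)
  have eig1: "(\<rho> - \<omega>) * a = c * b" by (simp add: a_def b_def)
  have eig2: "(\<rho> - \<omega>') * b = d * a" using eig by (simp add: a_def b_def mult.commute)
  define u1 where "u1 = (\<lambda>t. exp (- \<omega> * t) * (a * (exp (\<rho> * t) + \<mu> * (exp (\<rho> * t))\<^sup>2)))"
  define u2 where "u2 = (\<lambda>t. exp (- \<omega>' * t) * (b * (exp (\<rho> * t) + \<mu> * (exp (\<rho> * t))\<^sup>2)))"
  define v1 where "v1 = (\<lambda>t. exp (- \<omega> * t) * (a * (exp (\<rho> * t) - \<mu> * (exp (\<rho> * t))\<^sup>2)))"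
  define v2 where "v2 = (\<lambda>t. exp (- \<omega>' * t) * (b * (exp (\<rho> * t) - \<mu> * (exp (\<rho> * t))\<^sup>2)))"
  \<comment> \<open>\<open>v1\<close> vanishes at \<open>t1\<close>, the point where \<open>\<mu> x = 1\<close>, and is negative afterwards.\<close>
  define v where "v = (\<lambda>t. if t < t1 then ennreal (v1 t) else 0)"
  have sup1: "cum True (\<lambda>s. lift \<Phi> (- \<omega>) \<omega>' s (ennreal (u2 s))) t \<le> ennreal (u1 t)" if "t \<le> t1" for t
    unfolding u1_def u2_def
    by (rule branch_upper[OF \<Phi> ab(1,2) pos(3) \<mu>0 pos(4,5) eig1 \<mu>1(1) \<mu>3(1) t1 that])
  have sup2: "cum True (\<lambda>s. lift \<Psi> (- \<omega>') \<omega> s (ennreal (u1 s))) t \<le> ennreal (u2 t)" if "t \<le> t1" for t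
    unfolding u1_def u2_def
    by (rule branch_upper[OF \<Psi> ab(2,1) pos(3) \<mu>0 pos(4,6) eig2 \<mu>1(2) \<mu>3(2) t1 that])
  have sub1: "ennreal (v1 t) \<le> cum True (\<lambda>s. lift \<Phi> (- \<omega>) \<omega>' s (X s)) t"
    if "t \<le> t1" "\<And>r. r \<le> t \<Longrightarrow> ennreal (v2 r) \<le> X r" for t X
    unfolding v1_def
    by (rule branch_lower[OF \<Phi> ab(1,2) pos(3) \<mu>0 pos(4,5) eig1 \<mu>1(1) \<mu>3(1) t1 that(1)])
       (assumption | rule that(2)[unfolded v2_def])+
  have sub2: "ennreal (v2 t) \<le> cum True (\<lambda>s. lift \<Psi> (- \<omega>') \<omega> s (X s)) t"
    if "t \<le> t1" "\<And>r. r \<le> t \<Longrightarrow> ennreal (v1 r) \<le> X r" for t X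
    unfolding v2_def
    by (rule branch_lower[OF \<Psi> ab(2,1) pos(3) \<mu>0 pos(4,6) eig2 \<mu>1(2) \<mu>3(2) t1 that(1)])
       (assumption | rule that(2)[unfolded v1_def])+
  let ?T = "volterra 0 True \<Phi> (- \<omega>) \<omega>' True \<Psi> (- \<omega>') \<omega>"
  have vT: "v \<le> ?T v"
  proof (rule le_funI)
    fix t
    show "v t \<le> ?T v t"
    proof (cases "t < t1")
      case True
      have "ennreal (v1 t) \<le> cum True (\<lambda>s. lift \<Phi> (- \<omega>) \<omega>' s (cum True (\<lambda>r. lift \<Psi> (- \<omega>') \<omega> r (v r)) s)) t"
        by (intro sub1 sub2) (use True in \<open>auto simp: v_def\<close>)
      then show ?thesis using True by (simp add: v_def volterra_def)
    qed (simp add: v_def)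
  qed
  have vu: "v t \<le> ennreal (u1 t)" if "t \<le> t1" for t
  proof -
    have "v1 t \<le> u1 t" unfolding v1_def u1_def using ab \<mu>0 by (intro mult_left_mono) auto
    then show ?thesis by (auto simp: v_def ennreal_leI)
  qed
  have bounds: "\<forall>t\<le>t1. ennreal 0 + cum True (\<lambda>s. lift \<Phi> (- \<omega>) \<omega>' s (ennreal (u2 s))) t \<le> ennreal (u1 t)"
      "\<forall>t\<le>t1. cum True (\<lambda>s. lift \<Psi> (- \<omega>') \<omega> s (ennreal (u1 s))) t \<le> ennreal (u2 t)"
      "\<forall>t\<le>t1. v t \<le> ennreal (u1 t)"
    using sup1 sup2 vu by simp_all
  have dt: "True \<and> True \<or> t1 = 0" by simp
  obtain f g where fg: "\<forall>t. f t = ennreal 0 + cum True (\<lambda>s. lift \<Phi> (- \<omega>) \<omega>' s (g s)) t"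
      "\<forall>t. g t = cum True (\<lambda>s. lift \<Psi> (- \<omega>') \<omega> s (f s)) t"
    and vf: "v \<le> f" and fgu: "\<forall>t\<le>t1. f t \<le> ennreal (u1 t)" "\<forall>t\<le>t1. g t \<le> ennreal (u2 t)"
    and minim': "\<forall>u. v \<le> u \<longrightarrow> ?T u \<le> u \<longrightarrow> f \<le> u"
    using volterra_fixpoint[OF \<Phi>(1) \<Psi>(1) dt bounds(1,2) vT bounds(3)] by (elim exE conjE) (rule that)
  note f = fg(1)[rule_format] and g = fg(2)[rule_format]
    and fu = fgu(1)[rule_format] and gu = fgu(2)[rule_format] and minim = minim'[rule_format]
  have fmono: "f s \<le> f t" if "s \<le> t" for s t
    unfolding f using that by (intro add_left_mono cum_up_mono)
  have gmono: "g s \<le> g t" if "s \<le> t" for s t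
    unfolding g using that by (intro cum_up_mono)
  have [measurable]: "g \<in> borel_measurable borel" "f \<in> borel_measurable borel"
    by (subst g[abs_def] f[abs_def], measurable)+
  have \<Phi>0: "\<Phi> 0 \<ge> 0" and \<Psi>0: "\<Psi> 0 \<ge> 0" using \<Phi>(3)[of 0] \<Psi>(3)[of 0] by auto
  have ffin1: "f t < top" if "t \<le> t1" for t using fu[OF that] by (rule order_le_less_trans) simp
  have gfin1: "g t < top" if "t \<le> t1" for t using gu[OF that] by (rule order_le_less_trans) simp
  have gfin: "g t < top" if "f t < top" for t
  proof (cases "t \<le> t1")
    case False
    obtain K where K: "K \<ge> 0" "\<And>r X. r \<in> {t1..t} \<Longrightarrow> X \<le> ennreal (enn2real (f t)) \<Longrightarrow> lift \<Psi> (- \<omega>') \<omega> r X \<le> ennreal K"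
      using lift_le_Icc[OF \<Psi>(1) \<Psi>0 enn2real_nonneg] by metis
    have "g t = g t1 + (\<integral>\<^sup>+r\<in>{t1..t}. lift \<Psi> (- \<omega>') \<omega> r (f r) \<partial>lborel)"
      unfolding g by (rule cum_split_up) (use False \<Psi>(1) in \<open>auto intro!: lift_borel\<close>)
    also have "\<dots> \<le> g t1 + ennreal (K * (t - t1))"
      using False K fmono that by (intro add_left_mono nn_integral_Icc_bound) auto
    also have "\<dots> < top" using gfin1[of t1] by simp
    finally show ?thesis .
  qed (rule gfin1)
  have fpos: "f t > 0" and gpos: "g t > 0" for t
  proof -
    define s where "s = min t (t1 - 1)"
    have s: "s < t1" "s \<le> t" by (auto simp: s_def)
    have "exp (\<rho> * s) < exp (\<rho> * t1)" using s pos by simp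
    then have "\<mu> * exp (\<rho> * s) < 1" unfolding t1 using \<mu>0 by (simp add: field_simps)
    then have "exp (\<rho> * s) - \<mu> * (exp (\<rho> * s))\<^sup>2 > 0"
      using mult_strict_right_mono[of "\<mu> * exp (\<rho> * s)" 1 "exp (\<rho> * s)"] by (simp add: power2_eq_square)
    then have v12: "v1 s > 0" "v2 s > 0" using ab by (auto simp: v1_def v2_def)
    have "0 < ennreal (v1 s)" using v12 by simp
    also have "\<dots> \<le> f s" using le_funD[OF vf, of s] s by (simp add: v_def)
    also have "\<dots> \<le> f t" by (rule fmono[OF s(2)])
    finally show "f t > 0" .
    have "0 < ennreal (v2 s)" using v12 by simp
    also have "\<dots> \<le> g s" unfolding g
    proof (rule sub2)
      fix r assume "r \<le> s" then show "ennreal (v1 r) \<le> f r" using le_funD[OF vf, of r] s by (simp add: v_def)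
    qed (use s in simp)
    also have "\<dots> \<le> g t" by (rule gmono[OF s(2)])
    finally show "g t > 0" .
  qed
  define h where "h = (\<lambda>t. exp (\<omega> * t) * enn2real (f t))"
  define k where "k = (\<lambda>t. exp (\<omega>' * t) * enn2real (g t))"
  have e: "exp (w * t) * exp (- w * t) = 1" for w t :: real by (simp add: exp_minus)
  have lim: "((\<lambda>t. exp (w * t) * enn2real (F t)) \<longlongrightarrow> 0) at_bot"
    if F: "\<And>t. t \<le> t1 \<Longrightarrow> F t \<le> ennreal (exp (- w * t) * (n * (exp (\<rho> * t) + \<mu> * (exp (\<rho> * t))\<^sup>2)))"
      and n: "n > 0" for F w n
  proof (rule Lim_null_comparison)
    show "\<forall>\<^sub>F t in at_bot. norm (exp (w * t) * enn2real (F t)) \<le> n * (exp (\<rho> * t) + \<mu> * (exp (\<rho> * t))\<^sup>2)"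
      using eventually_le_at_bot[of t1]
    proof eventually_elim
      case (elim t)
      have "enn2real (F t) \<le> exp (- w * t) * (n * (exp (\<rho> * t) + \<mu> * (exp (\<rho> * t))\<^sup>2))"
        by (rule enn2real_leI[OF _ F[OF elim]]) (use n \<mu>0 in simp)
      then have "exp (w * t) * enn2real (F t) \<le> exp (w * t) * (exp (- w * t) * (n * (exp (\<rho> * t) + \<mu> * (exp (\<rho> * t))\<^sup>2)))"
        by (rule mult_left_mono) simp
      also have "\<dots> = n * (exp (\<rho> * t) + \<mu> * (exp (\<rho> * t))\<^sup>2)" using e[of w t] by (simp add: mult.assoc[symmetric])
      finally show ?case by simp
    qed
    have "((\<lambda>t. n * (exp (\<rho> * t) + \<mu> * (exp (\<rho> * t))\<^sup>2)) \<longlongrightarrow> n * (0 + \<mu> * 0\<^sup>2)) at_bot"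
      using pos by (intro tendsto_intros exp_mult_at_bot)
    then show "((\<lambda>t. n * (exp (\<rho> * t) + \<mu> * (exp (\<rho> * t))\<^sup>2)) \<longlongrightarrow> 0) at_bot" by simp
  qed
  have h0: "(h \<longlongrightarrow> 0) at_bot" unfolding h_def by (rule lim[OF _ ab(1)]) (use fu in \<open>simp add: u1_def\<close>)
  have k0: "(k \<longlongrightarrow> 0) at_bot" unfolding k_def by (rule lim[OF _ ab(2)]) (use gu in \<open>simp add: u2_def\<close>)
  have main: thesis if D: "open D" "is_interval D" and Df: "\<And>t. t \<in> D \<Longrightarrow> f t < top"
    and DT: "D = UNIV \<or> (\<exists>T. D = {..<T} \<and> filterlim h at_top (at_left T))" for D
  proof (rule result[OF DT _ _ _ _ h0 k0])
    fix t assume t: "t \<in> D"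
    note ff = Df[OF t] note gf = gfin[OF ff]
    show "h t > 0" unfolding h_def using fpos[of t] ff by (simp add: enn2real_positive_iff)
    show "k t > 0" unfolding k_def using gpos[of t] gf by (simp add: enn2real_positive_iff)
    have dt: "(True \<and> True) \<or> D \<subseteq> {..0}" by simp
    note dd = volterra_solution_deriv[OF \<Phi>(1,2) \<Phi>0 \<Psi>(1,2) \<Psi>0 f g D dt Df gfin[OF Df] t]
    show "(h has_real_derivative \<omega> * h t + \<Phi> (k t)) (at t)"
      unfolding h_def k_def
      by (auto intro!: derivative_eq_intros dd(1) simp: exp_minus field_simps)
    show "(k has_real_derivative \<omega>' * k t + \<Psi> (h t)) (at t)"
      unfolding h_def k_def
      by (auto intro!: derivative_eq_intros dd(2) simp: exp_minus field_simps)
  qed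
  show thesis
  proof (cases "\<forall>t. f t < top")
    case True
    then show thesis by (intro main[of UNIV]) auto
  next
    case False
    then obtain t2 where t2: "f t2 = top" by (metis less_top)
    define T where "T = Sup {t. f t < top}"
    have bdd: "bdd_above {t. f t < top}"
    proof (rule bdd_aboveI)
      fix t assume "t \<in> {t. f t < top}"
      then show "t \<le> t2" using fmono[of t2 t] t2 by (cases "t \<le> t2") (auto simp: top_unique)
    qed
    have belowT: "f t < top" if tT: "t < T" for t
    proof -
      obtain s where "f s < top" "t < s"
        using less_cSupD[of "{t. f t < top}" t, folded T_def, OF _ tT] ffin1[of t1] by auto
      then show ?thesis using fmono[of t s] by (simp add: order_le_less_trans)
    qed
    have aboveT: "f t = top" if "t > T" for t
    proof (rule ccontr)
      assume "f t \<noteq> top"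
      then have "t \<le> T" unfolding T_def by (intro cSup_upper bdd) (simp add: less_top)
      then show False using that by simp
    qed
    have t1T: "t1 \<le> T" unfolding T_def using ffin1[of t1] by (intro cSup_upper bdd) auto
    have unb: "\<exists>s<T. ennreal K < f s" if "K \<ge> 0" for K
    proof (rule ccontr)
      assume "\<not> (\<exists>s<T. ennreal K < f s)"
      then have fK: "f s \<le> ennreal K" if "s < T" for s using that by (meson not_less)
      define s0 where "s0 = t1 - 1"
      have K10: "K + 1 \<ge> 0" using that by simp
      obtain K1 where K1: "K1 \<ge> 0" "\<And>r X. r \<in> {s0..T+1} \<Longrightarrow> X \<le> ennreal (K + 1) \<Longrightarrow> lift \<Psi> (- \<omega>') \<omega> r X \<le> ennreal K1"
        using lift_le_Icc[OF \<Psi>(1) \<Psi>0 K10] by metis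
      define G where "G = u2 s0 + K1 * (T + 1 - s0)"
      have u20: "u2 s0 \<ge> 0" unfolding u2_def using ab \<mu>0 by simp
      have G0: "G \<ge> 0" unfolding G_def using u20 K1 t1T by (simp add: s0_def)
      obtain K2 where K2: "K2 \<ge> 0" "\<And>r X. r \<in> {s0..T+1} \<Longrightarrow> X \<le> ennreal G \<Longrightarrow> lift \<Phi> (- \<omega>) \<omega>' r X \<le> ennreal K2"
        using lift_le_Icc[OF \<Phi>(1) \<Phi>0 G0] by metis
      define \<delta> where "\<delta> = 1 / (2 * (K2 + 1))"
      have \<delta>: "\<delta> > 0" "\<delta> \<le> 1/2" "K2 * (2 * \<delta>) \<le> 1" using K2 by (auto simp: \<delta>_def field_simps)
      \<comment> \<open>If \<open>f\<close> were bounded before \<open>T\<close>, then a constant would continue it as an upper solution for a short time, and the least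
        fixed point would still be finite after \<open>T\<close>.\<close>
      define u where "u = (\<lambda>t. if t < T then f t else if t \<le> T + \<delta> then ennreal (K + 1) else top)"
      have [measurable]: "u \<in> borel_measurable borel" unfolding u_def by measurable
      have uK: "u r \<le> ennreal (K + 1)" if "r \<le> T + \<delta>" for r
        using that fK[of r] order_trans[OF _ ennreal_leI[of K "K + 1"]] by (auto simp: u_def)
      have vu: "v \<le> u" using le_funD[OF vf] t1T by (auto simp: le_fun_def u_def v_def)
      define Q where "Q = cum True (\<lambda>r. lift \<Psi> (- \<omega>') \<omega> r (u r))"
      have Tu: "?T u = (\<lambda>t. cum True (\<lambda>s. lift \<Phi> (- \<omega>) \<omega>' s (Q s)) t)"
        by (simp add: Q_def volterra_def[abs_def])
      have [measurable]: "Q \<in> borel_measurable borel" unfolding Q_def by measurable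
      have Qg: "Q s = g s" if "s < T" for s
        unfolding Q_def g using that by (intro cum_cong_up) (simp add: u_def)
      have QG: "Q r \<le> ennreal G" if "r \<in> {s0..T+\<delta>}" for r
      proof -
        have "Q r = Q s0 + (\<integral>\<^sup>+x\<in>{s0..r}. lift \<Psi> (- \<omega>') \<omega> x (u x) \<partial>lborel)"
          unfolding Q_def by (rule cum_split_up) (use that \<Psi>(1) in \<open>auto intro!: lift_borel\<close>)
        also have "\<dots> \<le> ennreal (u2 s0) + ennreal (K1 * (r - s0))"
        proof (rule add_mono)
          show "Q s0 \<le> ennreal (u2 s0)" using Qg[of s0] gu[of s0] t1T by (simp add: s0_def)
          show "(\<integral>\<^sup>+x\<in>{s0..r}. lift \<Psi> (- \<omega>') \<omega> x (u x) \<partial>lborel) \<le> ennreal (K1 * (r - s0))"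
            using that \<delta> K1 uK by (intro nn_integral_Icc_bound) auto
        qed
        also have "\<dots> = ennreal (u2 s0 + K1 * (r - s0))" using u20 K1 that by (simp add: ennreal_plus)
        also have "\<dots> \<le> ennreal G" unfolding G_def using that \<delta> K1 by (intro ennreal_leI add_left_mono mult_left_mono) auto
        finally show ?thesis .
      qed
      have "?T u t \<le> u t" for t
      proof -
        consider "t < T" | "T \<le> t" "t \<le> T + \<delta>" | "t > T + \<delta>" by linarith
        then show ?thesis
        proof cases
          case 1
          have "?T u t = f t" unfolding Tu f using 1 Qg by (auto intro!: cum_cong_up)
          then show ?thesis using 1 by (simp add: u_def)
        next
          case 2
          define s where "s = T - \<delta>"
          have s: "s < T" "s0 \<le> s" "s \<le> t" using 2 \<delta> t1T by (auto simp: s_def s0_def)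
          have "?T u t = ?T u s + (\<integral>\<^sup>+x\<in>{s..t}. lift \<Phi> (- \<omega>) \<omega>' x (Q x) \<partial>lborel)"
            unfolding Tu by (rule cum_split_up) (use s \<Phi>(1) in \<open>auto intro!: lift_borel\<close>)
          also have "\<dots> \<le> ennreal K + ennreal (K2 * (t - s))"
          proof (rule add_mono)
            have "?T u s = f s" unfolding Tu f using s Qg by (auto intro!: cum_cong_up)
            then show "?T u s \<le> ennreal K" using fK s by simp
            show "(\<integral>\<^sup>+x\<in>{s..t}. lift \<Phi> (- \<omega>) \<omega>' x (Q x) \<partial>lborel) \<le> ennreal (K2 * (t - s))"
              using 2 s \<delta> K2 QG by (intro nn_integral_Icc_bound) auto
          qed
          also have "\<dots> = ennreal (K + K2 * (t - s))" using that K2 s by (simp add: ennreal_plus)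
          also have "K2 * (t - s) \<le> K2 * (2 * \<delta>)" using 2 K2 by (intro mult_left_mono) (auto simp: s_def)
          then have "ennreal (K + K2 * (t - s)) \<le> ennreal (K + 1)" using \<delta>(3) by (intro ennreal_leI) linarith
          finally show ?thesis using 2 by (simp add: u_def)
        next
          case 3 then show ?thesis using \<delta> by (simp add: u_def)
        qed
      qed
      then have "f \<le> u" by (intro minim vu) (simp add: le_fun_def)
      from le_funD[OF this, of "T + \<delta>"] have "f (T + \<delta>) \<le> ennreal (K + 1)" using \<delta> by (simp add: u_def)
      then show False using aboveT[of "T + \<delta>"] \<delta> by (simp add: top_unique)
    qed
    have "filterlim h at_top (at_left T)"
      unfolding filterlim_at_top
    proof
      fix Z :: real
      define m where "m = exp (min (\<omega> * (T - 1)) (\<omega> * T))"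
      obtain s where s: "s < T" "ennreal (\<bar>Z\<bar> / m) < f s" using unb[of "\<bar>Z\<bar> / m"] by (auto simp: m_def)
      have "\<forall>\<^sub>F t in at_left T. t \<in> {max s (T - 1)<..<T}"
        using s by (intro eventually_at_leftI[of "max s (T - 1)"]) auto
      then show "\<forall>\<^sub>F t in at_left T. Z \<le> h t"
      proof eventually_elim
        case (elim t)
        have "ennreal (\<bar>Z\<bar> / m) \<le> f t" using s(2) fmono[of s t] elim by (auto intro: order_trans less_imp_le)
        then have "\<bar>Z\<bar> / m \<le> enn2real (f t)"
          using belowT[of t] elim by (metis enn2real_ennreal enn2real_mono abs_ge_zero divide_nonneg_pos exp_gt_zero greaterThanLessThan_iff m_def)
        moreover have "m \<le> exp (\<omega> * t)"
        proof -
          have "min (\<omega> * (T - 1)) (\<omega> * T) \<le> \<omega> * t"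
          proof (cases "\<omega> \<ge> 0")
            case True then have "\<omega> * (T - 1) \<le> \<omega> * t" using elim by (intro mult_left_mono) auto
            then show ?thesis by simp
          next
            case False then have "\<omega> * T \<le> \<omega> * t" using elim by (intro mult_left_mono_neg) auto
            then show ?thesis by simp
          qed
          then show ?thesis by (simp add: m_def)
        qed
        ultimately have "m * (\<bar>Z\<bar> / m) \<le> h t" unfolding h_def by (intro mult_mono) (auto simp: m_def)
        then show ?case by (simp add: m_def)
      qed
    qed
    then show thesis using belowT by (intro main[of "{..<T}"]) (auto simp: is_interval_1)
  qed
qed

section \<open>The autonomous Emden-Fowler system\<close>

text \<open>
  The exponents \<open>A\<close> and \<open>B\<close> appear when the linear terms are removed: \<open>W = exp (- \<gamma> t) y\<close> and \<open>V = exp (- \<kappa> t) z\<close>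
  satisfy \<open>W' = - \<gamma> exp (A t) \<psi>(V)\<close> and \<open>V' = \<epsilon> \<kappa> exp (- B t) W\<^sup>q\<close>. Both exponents are positive, and
  \<open>A - \<alpha> B = \<gamma> (\<alpha> q - 1)\<close> is positive as well.
\<close>
locale emden_fowler =
  fixes \<gamma> \<kappa> \<alpha> q :: real
  assumes gamma: "\<gamma> > 0" and alpha: "\<alpha> > 0" and q: "q > 0"
    and super: "\<alpha> * q > 1" and kappa: "\<gamma> * q < \<kappa>"
begin

definition solves :: "real \<Rightarrow> real set \<Rightarrow> (real \<Rightarrow> real) \<Rightarrow> (real \<Rightarrow> real) \<Rightarrow> bool" where
  "solves \<epsilon> J y z \<longleftrightarrow> (\<forall>t\<in>J. y t > 0 \<and>
     (y has_real_derivative \<gamma> * (y t - spow \<alpha> (z t))) (at t) \<and>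
     (z has_real_derivative \<kappa> * (z t + \<epsilon> * y t powr q)) (at t))"

abbreviation "A \<equiv> \<kappa> * \<alpha> - \<gamma>"
abbreviation "B \<equiv> \<kappa> - \<gamma> * q"

lemma kappa_pos: "\<kappa> > 0" using gamma q kappa by (smt (verit) mult_pos_pos)

lemma A_pos: "A > 0"
proof -
  have "\<gamma> * 1 < \<gamma> * (\<alpha> * q)" using gamma super by (intro mult_strict_left_mono)
  also have "\<dots> = \<gamma> * q * \<alpha>" by simp
  also have "\<dots> < \<kappa> * \<alpha>" using kappa alpha by (intro mult_strict_right_mono)
  finally show ?thesis by simp
qed

lemma B_pos: "B > 0" using kappa by simp

lemma solvesD:
  assumes "solves \<epsilon> J y z" "t \<in> J"
  shows "y t > 0" "(y has_real_derivative \<gamma> * (y t - spow \<alpha> (z t))) (at t)"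
    "(z has_real_derivative \<kappa> * (z t + \<epsilon> * y t powr q)) (at t)"
  using assms by (auto simp: solves_def)

lemma solves_subset: "solves \<epsilon> J y z \<Longrightarrow> J' \<subseteq> J \<Longrightarrow> solves \<epsilon> J' y z"
  by (auto simp: solves_def)

text \<open>
  The system is autonomous; in the original variables this is its invariance under dilations.
\<close>
lemma solves_shift:
  assumes "solves \<epsilon> J y z"
  shows "solves \<epsilon> {t. t + c \<in> J} (\<lambda>t. y (t + c)) (\<lambda>t. z (t + c))"
  unfolding solves_def
proof (intro ballI conjI)
  fix t assume t: "t \<in> {t. t + c \<in> J}"
  then show "y (t + c) > 0" using solvesD(1)[OF assms] by simp
  show "((\<lambda>t. y (t + c)) has_real_derivative \<gamma> * (y (t + c) - spow \<alpha> (z (t + c)))) (at t)"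
    using solvesD(2)[OF assms] t by (subst DERIV_shift[symmetric]) simp
  show "((\<lambda>t. z (t + c)) has_real_derivative \<kappa> * (z (t + c) + \<epsilon> * y (t + c) powr q)) (at t)"
    using solvesD(3)[OF assms] t by (subst DERIV_shift[symmetric]) simp
qed

lemma solves_equilibrium: "solves (-1) UNIV (\<lambda>_. 1) (\<lambda>_. 1)"
  by (auto simp: solves_def)

text \<open>
  Up to a constant, \<open>exp (- \<gamma> t) y\<close> is the value \<open>w\<close> of the solution in the original variables, and \<open>exp (- \<kappa> t) z\<close>
  is \<open>- r\<^sup>N\<^sup>-\<^sup>1\<close> times its flux. They lose the linear terms of the system.
\<close>
lemma value_deriv:
  assumes "solves \<epsilon> J y z" "t \<in> J"
  shows "((\<lambda>t. exp (- \<gamma> * t) * y t) has_real_derivative - \<gamma> * exp (- \<gamma> * t) * spow \<alpha> (z t)) (at t)"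
  by (auto intro!: derivative_eq_intros solvesD(2)[OF assms] simp: algebra_simps)

lemma flux_deriv:
  assumes "solves \<epsilon> J y z" "t \<in> J"
  shows "((\<lambda>t. exp (- \<kappa> * t) * z t) has_real_derivative \<epsilon> * \<kappa> * exp (- \<kappa> * t) * y t powr q) (at t)"
  by (auto intro!: derivative_eq_intros solvesD(3)[OF assms] simp: algebra_simps)

lemma spow_exp: "spow e (exp s * x) = exp (e * s) * spow e x"
  by (subst spow_mult) (simp_all add: powr_def)

text \<open>
  The derivative of \<open>V = exp (- \<kappa> t) z\<close> is asymptotic to a multiple of \<open>exp (- B t)\<close>, which is not integrable at minus
  infinity, so the constant of integration does not influence the limit.
\<close>
lemma flux_limit_of_bounded:
  assumes sol: "solves \<epsilon> {..<t1} y z" and W: "((\<lambda>t. exp (- \<gamma> * t) * y t) \<longlongrightarrow> W0) at_bot" and W0: "W0 > 0"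
  shows "((\<lambda>t. exp (- (\<gamma> * q) * t) * z t) \<longlongrightarrow> - (\<epsilon> * (\<kappa> / B) * W0 powr q)) at_bot"
proof -
  define V where "V = (\<lambda>t. exp (- \<kappa> * t) * z t)"
  have Wq: "((\<lambda>t. (exp (- \<gamma> * t) * y t) powr q) \<longlongrightarrow> W0 powr q) at_bot"
    using W0 by (intro tendsto_powr W tendsto_const) auto
  have dV: "(V has_real_derivative \<epsilon> * \<kappa> * exp (- B * t) * (exp (- \<gamma> * t) * y t) powr q) (at t)" if "t < t1" for t
  proof -
    have "exp (- B * t) * (exp (- \<gamma> * t) * y t) powr q = exp (- B * t) * (exp (- \<gamma> * t * q) * y t powr q)"
      using solvesD(1)[OF sol, of t] that by (simp add: powr_mult) (simp add: powr_def)
    also have "\<dots> = exp (- \<kappa> * t) * y t powr q" by (simp add: exp_assoc algebra_simps flip: exp_add)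
    finally show ?thesis using flux_deriv[OF sol, of t] that by (simp add: V_def mult.assoc)
  qed
  have "((\<lambda>x. V (- x) / exp (B * x)) \<longlongrightarrow> - (\<epsilon> * (\<kappa> / B) * W0 powr q)) at_top"
  proof (rule lhospital_at_top_at_top[where f' = "\<lambda>x. - (\<epsilon> * \<kappa> * exp (- B * (- x)) * (exp (- \<gamma> * (- x)) * y (- x)) powr q)"
        and g' = "\<lambda>x. exp (B * x) * B"])
    show "LIM x at_top. exp (B * x) :> at_top" by (rule exp_mult_at_top[OF B_pos])
    show "\<forall>\<^sub>F x in at_top. exp (B * x) * B \<noteq> 0" using B_pos by auto
    show "\<forall>\<^sub>F x in at_top. ((\<lambda>x. V (- x)) has_real_derivative - (\<epsilon> * \<kappa> * exp (- B * (- x)) * (exp (- \<gamma> * (- x)) * y (- x)) powr q)) (at x)"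
      using eventually_gt_at_top[of "- t1"]
    proof eventually_elim
      case (elim x)
      then have "- x < t1" by simp
      then show ?case by (subst DERIV_mirror[symmetric]) (rule DERIV_cong[OF dV], simp_all)
    qed
    show "\<forall>\<^sub>F x in at_top. ((\<lambda>x. exp (B * x)) has_real_derivative exp (B * x) * B) (at x)"
      by (intro always_eventually allI) (auto intro!: derivative_eq_intros)
    have "((\<lambda>x. - (\<epsilon> * (\<kappa> / B) * (exp (- \<gamma> * (- x)) * y (- x)) powr q)) \<longlongrightarrow> - (\<epsilon> * (\<kappa> / B) * W0 powr q)) at_top"
      by (intro tendsto_mult tendsto_minus tendsto_const Wq[unfolded filterlim_at_bot_mirror])
    then show "((\<lambda>x. - (\<epsilon> * \<kappa> * exp (- B * (- x)) * (exp (- \<gamma> * (- x)) * y (- x)) powr q) / (exp (B * x) * B))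
        \<longlongrightarrow> - (\<epsilon> * (\<kappa> / B) * W0 powr q)) at_top"
    proof (rule Lim_transform_eventually)
      show "\<forall>\<^sub>F x in at_top. - (\<epsilon> * (\<kappa> / B) * (exp (- \<gamma> * (- x)) * y (- x)) powr q) =
          - (\<epsilon> * \<kappa> * exp (- B * (- x)) * (exp (- \<gamma> * (- x)) * y (- x)) powr q) / (exp (B * x) * B)"
      proof (intro always_eventually allI)
        fix x
        have "- (\<epsilon> * \<kappa> * exp (B * x) * Y) / (exp (B * x) * B) = - (\<epsilon> * (\<kappa> / B) * Y)" for Y
          using B_pos by (simp add: divide_simps del: exp_le_cancel_iff)
        then show "- (\<epsilon> * (\<kappa> / B) * (exp (- \<gamma> * (- x)) * y (- x)) powr q) =
          - (\<epsilon> * \<kappa> * exp (- B * (- x)) * (exp (- \<gamma> * (- x)) * y (- x)) powr q) / (exp (B * x) * B)"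
          by (simp only: minus_mult_minus)
      qed
    qed
  qed
  then have "((\<lambda>t. V t / exp (B * (- t))) \<longlongrightarrow> - (\<epsilon> * (\<kappa> / B) * W0 powr q)) at_bot"
    unfolding filterlim_at_bot_mirror by simp
  moreover have "V t / exp (B * (- t)) = exp (- (\<gamma> * q) * t) * z t" for t
  proof -
    have "V t / exp (B * (- t)) = exp (B * t) * (exp (- \<kappa> * t) * z t)"
      by (simp only: V_def mult_minus_right exp_minus divide_inverse inverse_inverse_eq) (rule mult.commute)
    then show ?thesis unfolding exp_assoc by (simp add: algebra_simps)
  qed
  ultimately show ?thesis by simp
qed

text \<open>
  Here the flux \<open>V\<close> has a nonzero limit, and the derivative of \<open>exp (- \<gamma> t) y\<close> is asymptotic to a multiple of the
  integrable function \<open>exp (A t)\<close>.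
\<close>
lemma value_limit_of_flux:
  assumes sol: "solves \<epsilon> {..<t1} y z" and W: "((\<lambda>t. exp (- \<gamma> * t) * y t) \<longlongrightarrow> 0) at_bot"
    and V: "((\<lambda>t. exp (- \<kappa> * t) * z t) \<longlongrightarrow> - V0) at_bot" and V0: "V0 > 0"
  shows "((\<lambda>t. exp (- (\<kappa> * \<alpha>) * t) * y t) \<longlongrightarrow> \<gamma> * V0 powr \<alpha> / A) at_bot"
proof -
  have "((\<lambda>t. exp (- A * t) * (exp (- \<gamma> * t) * y t)) \<longlongrightarrow> \<gamma> * V0 powr \<alpha> / A) at_bot"
  proof (rule exp_lhopital_at_bot[OF A_pos W])
    show "((\<lambda>t. exp (- \<gamma> * t) * y t) has_real_derivative - \<gamma> * exp (- \<gamma> * t) * spow \<alpha> (z t)) (at t)" if "t < t1" for t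
      by (rule value_deriv[OF sol]) (use that in simp)
    have "((\<lambda>t. - \<gamma> * spow \<alpha> (exp (- \<kappa> * t) * z t)) \<longlongrightarrow> - \<gamma> * spow \<alpha> (- V0)) at_bot"
      by (intro tendsto_intros isCont_tendsto_compose[OF isCont_spow[OF alpha] V])
    moreover have "- \<gamma> * spow \<alpha> (exp (- \<kappa> * t) * z t) = exp (- A * t) * (- \<gamma> * exp (- \<gamma> * t) * spow \<alpha> (z t))" for t
      unfolding spow_exp by (simp add: exp_assoc algebra_simps flip: exp_add)
    moreover have "- \<gamma> * spow \<alpha> (- V0) = \<gamma> * V0 powr \<alpha>" using V0 by (simp add: spow_minus spow_pos)
    ultimately show "((\<lambda>t. exp (- A * t) * (- \<gamma> * exp (- \<gamma> * t) * spow \<alpha> (z t))) \<longlongrightarrow> \<gamma> * V0 powr \<alpha>) at_bot"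
      by (simp only:)
  qed
  moreover have "exp (- A * t) * (exp (- \<gamma> * t) * y t) = exp (- (\<kappa> * \<alpha>) * t) * y t" for t
    by (simp add: exp_assoc algebra_simps flip: exp_add)
  ultimately show ?thesis by (simp only:)
qed

lemma value_deriv_flux:
  assumes "solves \<epsilon> J y z" "t \<in> J"
  shows "((\<lambda>t. exp (- \<gamma> * t) * y t) has_real_derivative - \<gamma> * exp (A * t) * spow \<alpha> (exp (- \<kappa> * t) * z t)) (at t)"
proof -
  have "- \<gamma> * exp (A * t) * spow \<alpha> (exp (- \<kappa> * t) * z t) = - \<gamma> * exp (- \<gamma> * t) * spow \<alpha> (z t)"
    unfolding spow_exp by (simp add: exp_assoc algebra_simps flip: exp_add)
  then show ?thesis using value_deriv[OF assms] by (simp only:)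
qed

section \<open>Local solutions as t tends to minus infinity\<close>

text \<open>
  Here \<open>F = exp (- \<gamma> t) y\<close>, and \<open>C + G\<close> is the absolute value of \<open>exp (- \<kappa> t) z\<close>. The flags allow both components to be
  prescribed at minus infinity or at time \<open>0\<close>, independently of each other; the problem with mixed flags is a boundary
  value problem, but its operator is monotone all the same. Upper solutions suffice, as \<open>0\<close> is a lower one.
\<close>
lemma local_system:
  fixes u1 u2 :: "real \<Rightarrow> real"
  assumes C: "C > 0" and c0: "c0 \<ge> 0"
    and u0: "\<And>t. t \<le> 0 \<Longrightarrow> 0 \<le> u1 t" "\<And>t. t \<le> 0 \<Longrightarrow> 0 \<le> u2 t"
    and H1: "\<And>t. t \<le> 0 \<Longrightarrow> ennreal c0 + cum d1 (\<lambda>s. ennreal (exp (A * s) * (\<gamma> * (C + u2 s) powr \<alpha>))) t \<le> ennreal (u1 t)"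
    and H2: "\<And>t. t \<le> 0 \<Longrightarrow> cum d2 (\<lambda>s. ennreal (exp (- B * s) * (\<kappa> * u1 s powr q))) t \<le> ennreal (u2 t)"
  obtains F G where "\<And>t. t < 0 \<Longrightarrow> c0 \<le> F t \<and> F t \<le> u1 t" "\<And>t. t < 0 \<Longrightarrow> 0 \<le> G t \<and> G t \<le> u2 t"
    "\<And>t. t < 0 \<Longrightarrow> (F has_real_derivative (if d1 then 1 else -1) * (exp (A * t) * (\<gamma> * (C + G t) powr \<alpha>))) (at t)"
    "\<And>t. t < 0 \<Longrightarrow> (G has_real_derivative (if d2 then 1 else -1) * (exp (- B * t) * (\<kappa> * F t powr q))) (at t)"
proof -
  define \<Phi> where "\<Phi> = (\<lambda>x. \<gamma> * spow \<alpha> (C + x))"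
  define \<Psi> where "\<Psi> = (\<lambda>x. \<kappa> * spow q x)"
  have \<Phi>: "mono \<Phi>" "continuous_on UNIV \<Phi>" "\<Phi> 0 \<ge> 0"
    unfolding \<Phi>_def using gamma alpha C
    by (auto intro!: monoI spow_le continuous_intros continuous_on_compose2[OF continuous_spow] simp: spow_pos)
  have \<Psi>: "mono \<Psi>" "continuous_on UNIV \<Psi>" "\<Psi> 0 \<ge> 0"
    unfolding \<Psi>_def using kappa_pos q
    by (auto intro!: monoI spow_le continuous_intros continuous_on_compose2[OF continuous_spow])
  have b: "\<forall>t\<le>0. ennreal c0 + cum d1 (\<lambda>s. lift \<Phi> A 0 s (ennreal (u2 s))) t \<le> ennreal (u1 t)"
  proof (intro allI impI)
    fix t :: real assume t: "t \<le> 0"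
    have "cum d1 (\<lambda>s. lift \<Phi> A 0 s (ennreal (u2 s))) t \<le> cum d1 (\<lambda>s. ennreal (exp (A * s) * (\<gamma> * (C + u2 s) powr \<alpha>))) t"
      by (rule cum_prefix_mono[where ?t1.0 = 0]) (use t u0 C in \<open>auto simp: lift_ennreal \<Phi>_def spow_nonneg add_nonneg_nonneg less_imp_le\<close>)
    then show "ennreal c0 + cum d1 (\<lambda>s. lift \<Phi> A 0 s (ennreal (u2 s))) t \<le> ennreal (u1 t)"
      using H1[OF t] by (meson add_left_mono order_trans)
  qed
  have b2: "\<forall>t\<le>0. cum d2 (\<lambda>s. lift \<Psi> (- B) 0 s (ennreal (u1 s))) t \<le> ennreal (u2 t)"
  proof (intro allI impI)
    fix t :: real assume t: "t \<le> 0"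
    have "cum d2 (\<lambda>s. lift \<Psi> (- B) 0 s (ennreal (u1 s))) t \<le> cum d2 (\<lambda>s. ennreal (exp (- B * s) * (\<kappa> * u1 s powr q))) t"
      by (rule cum_prefix_mono[where ?t1.0 = 0]) (use t u0 in \<open>auto simp: lift_ennreal \<Psi>_def spow_nonneg\<close>)
    then show "cum d2 (\<lambda>s. lift \<Psi> (- B) 0 s (ennreal (u1 s))) t \<le> ennreal (u2 t)"
      using H2[OF t] by (rule order_trans)
  qed
  have dt: "d1 \<and> d2 \<or> (0::real) = 0" by simp
  have v: "(\<lambda>_. 0) \<le> volterra c0 d1 \<Phi> A 0 d2 \<Psi> (- B) 0 (\<lambda>_. 0)" "\<forall>t\<le>0. (0::ennreal) \<le> ennreal (u1 t)"
    by (simp_all add: le_fun_def)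
  obtain f g where fg: "\<forall>t. f t = ennreal c0 + cum d1 (\<lambda>s. lift \<Phi> A 0 s (g s)) t"
      "\<forall>t. g t = cum d2 (\<lambda>s. lift \<Psi> (- B) 0 s (f s)) t"
    and fgu: "\<forall>t\<le>0. f t \<le> ennreal (u1 t)" "\<forall>t\<le>0. g t \<le> ennreal (u2 t)"
    using volterra_fixpoint[OF \<Phi>(1) \<Psi>(1) dt b b2 v] by (elim exE conjE) (rule that)
  have D: "open {..<0::real}" "is_interval {..<0::real}" "(d1 \<and> d2) \<or> {..<0::real} \<subseteq> {..0}"
    by (auto simp: is_interval_1)
  have fin: "f t < top" "g t < top" if "t \<in> {..<0}" for t
    using fgu that by (meson ennreal_less_top order_le_less_trans lessThan_iff less_imp_le)+
  show ?thesis
  proof (rule that[of "\<lambda>t. enn2real (f t)" "\<lambda>t. enn2real (g t)"])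
    fix t :: real assume t: "t < 0"
    have t': "t \<in> {..<0}" using t by simp
    have "ennreal c0 \<le> f t" using fg(1) by (metis le_iff_add)
    then have "c0 \<le> enn2real (f t)" using fin(1)[OF t'] c0 enn2real_mono by fastforce
    moreover have "enn2real (f t) \<le> u1 t" using fgu(1) u0(1) t by (intro enn2real_leI) auto
    ultimately show "c0 \<le> enn2real (f t) \<and> enn2real (f t) \<le> u1 t" ..
    show "0 \<le> enn2real (g t) \<and> enn2real (g t) \<le> u2 t" using fgu(2) u0(2) t by (auto intro: enn2real_leI)
    note dd = volterra_solution_deriv[OF \<Phi> \<Psi> fg(1)[rule_format] fg(2)[rule_format] D fin t']
    show "((\<lambda>t. enn2real (f t)) has_real_derivative (if d1 then 1 else -1) * (exp (A * t) * (\<gamma> * (C + enn2real (g t)) powr \<alpha>))) (at t)"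
      using dd(1) C by (simp add: \<Phi>_def spow_pos add_pos_nonneg)
    show "((\<lambda>t. enn2real (g t)) has_real_derivative (if d2 then 1 else -1) * (exp (- B * t) * (\<kappa> * enn2real (f t) powr q))) (at t)"
      using dd(2) by (simp add: \<Psi>_def spow_nonneg)
  qed
qed

lemma solves_of_system:
  assumes C: "C > 0" and s: "s1 \<in> {1, -1}" "s2 \<in> {1, -1::real}"
    and F: "\<And>t. t < 0 \<Longrightarrow> F t > 0" and G: "\<And>t. t < 0 \<Longrightarrow> G t \<ge> 0"
    and dF: "\<And>t. t < 0 \<Longrightarrow> (F has_real_derivative s1 * (exp (A * t) * (\<gamma> * (C + G t) powr \<alpha>))) (at t)"
    and dG: "\<And>t. t < 0 \<Longrightarrow> (G has_real_derivative s2 * (exp (- B * t) * (\<kappa> * F t powr q))) (at t)"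
  shows "solves (- (s1 * s2)) {..<0} (\<lambda>t. exp (\<gamma> * t) * F t) (\<lambda>t. - s1 * (exp (\<kappa> * t) * (C + G t)))"
  unfolding solves_def
proof (intro ballI conjI)
  fix t :: real assume "t \<in> {..<0}"
  then have t: "t < 0" by simp
  show "exp (\<gamma> * t) * F t > 0" using F[OF t] by simp
  have CG: "C + G t > 0" using C G[OF t] by simp
  have e1: "exp (\<gamma> * t) * (exp (A * t) * (C + G t) powr \<alpha>) = spow \<alpha> (exp (\<kappa> * t) * (C + G t))"
    unfolding spow_exp using CG by (simp add: spow_pos exp_assoc algebra_simps flip: exp_add)
  have sp: "spow \<alpha> (- s1 * x) = - s1 * spow \<alpha> x" for x using s(1) by (auto simp: spow_minus)
  have "((\<lambda>t. exp (\<gamma> * t) * F t) has_real_derivative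
      \<gamma> * exp (\<gamma> * t) * F t + s1 * \<gamma> * (exp (\<gamma> * t) * (exp (A * t) * (C + G t) powr \<alpha>))) (at t)"
    by (auto intro!: derivative_eq_intros dF[OF t] simp: algebra_simps)
  then show "((\<lambda>t. exp (\<gamma> * t) * F t) has_real_derivative \<gamma> * (exp (\<gamma> * t) * F t - spow \<alpha> (- s1 * (exp (\<kappa> * t) * (C + G t))))) (at t)"
    unfolding e1 sp by (simp add: algebra_simps)
  have e2: "exp (\<kappa> * t) * (exp (- B * t) * F t powr q) = (exp (\<gamma> * t) * F t) powr q"
    using F[OF t] by (simp add: powr_mult) (simp add: powr_def algebra_simps flip: exp_add)
  have "((\<lambda>t. - s1 * (exp (\<kappa> * t) * (C + G t))) has_real_derivative
      - s1 * \<kappa> * exp (\<kappa> * t) * (C + G t) - s1 * s2 * \<kappa> * (exp (\<kappa> * t) * (exp (- B * t) * F t powr q))) (at t)"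
    by (auto intro!: derivative_eq_intros dG[OF t] simp: algebra_simps)
  then show "((\<lambda>t. - s1 * (exp (\<kappa> * t) * (C + G t))) has_real_derivative
      \<kappa> * (- s1 * (exp (\<kappa> * t) * (C + G t)) + - (s1 * s2) * (exp (\<gamma> * t) * F t) powr q)) (at t)"
    unfolding e2 by (simp add: algebra_simps)
qed

text \<open>
  Because of \<open>\<alpha> q > 1\<close>, the integral operator maps functions bounded by a small constant \<open>M\<close> to functions bounded by
  \<open>M / 2\<close>. The exponent \<open>\<delta> = A - \<alpha> B\<close> is positive, so the outer integral converges at minus infinity although the
  inner one diverges there.
\<close>
lemma bounded_amplitude:
  obtains M E \<delta> where "M > 0" "E > 0" "\<delta> > 0" "B * E = \<kappa> * M powr q"
    "\<And>r. r \<le> 0 \<Longrightarrow> exp (A * r) * (\<gamma> * (E + E * exp (- B * r)) powr \<alpha>) \<le> M / 2 * (\<delta> * exp (\<delta> * r))"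
proof -
  note k0 = kappa_pos
  define \<delta> where "\<delta> = \<gamma> * (\<alpha> * q - 1)"
  have d: "\<delta> > 0" unfolding \<delta>_def using gamma super by simp
  define K where "K = \<gamma> * (2 * \<kappa> / B) powr \<alpha> / \<delta>"
  have "K > 0" unfolding K_def using gamma k0 B_pos d by (intro divide_pos_pos mult_pos_pos) auto
  then obtain M where M: "M > 0" "K * M powr (\<alpha> * q) \<le> M / 2" using small_power[OF _ super] by blast
  define E where "E = \<kappa> / B * M powr q"
  have E: "E > 0" unfolding E_def using k0 B_pos M by (intro mult_pos_pos divide_pos_pos) auto
  have E2: "\<gamma> * (2 * E) powr \<alpha> = \<delta> * (K * M powr (\<alpha> * q))"
  proof -
    have "(2 * E) powr \<alpha> = (2 * \<kappa> / B) powr \<alpha> * (M powr q) powr \<alpha>"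
      unfolding E_def using k0 B_pos M by (subst powr_mult[symmetric]) (auto simp: mult.assoc)
    then show ?thesis using d by (simp add: K_def powr_powr mult.commute)
  qed
  show ?thesis
  proof (rule that[OF M(1) E d])
    show "B * E = \<kappa> * M powr q" unfolding E_def using kappa by simp
    fix r :: real assume r: "r \<le> 0"
    have "0 \<le> - B * r" by (rule mult_nonpos_nonpos) (use B_pos r in simp_all)
    then have "1 \<le> exp (- B * r)" by simp
    then have "E + E * exp (- B * r) \<le> exp (- B * r) * (2 * E)" using E by simp
    then have "(E + E * exp (- B * r)) powr \<alpha> \<le> (exp (- B * r) * (2 * E)) powr \<alpha>"
      using E alpha by (intro powr_mono2) auto
    also have "\<dots> = exp (\<alpha> * (- B * r)) * (2 * E) powr \<alpha>"
      using E by (subst powr_mult) (auto simp: powr_def)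
    finally have "exp (A * r) * (\<gamma> * (E + E * exp (- B * r)) powr \<alpha>) \<le> exp (A * r) * (\<gamma> * (exp (\<alpha> * (- B * r)) * (2 * E) powr \<alpha>))"
      using gamma by (intro mult_left_mono) auto
    also have "\<dots> = exp (A * r) * (exp (\<alpha> * (- B * r)) * (\<gamma> * (2 * E) powr \<alpha>))" by simp
    also have "\<dots> = exp (\<delta> * r) * (\<gamma> * (2 * E) powr \<alpha>)"
      unfolding exp_assoc by (simp add: \<delta>_def algebra_simps)
    also have "\<dots> \<le> exp (\<delta> * r) * (\<delta> * (M / 2))"
      unfolding E2 using M(2) d by (intro mult_left_mono) auto
    finally show "exp (A * r) * (\<gamma> * (E + E * exp (- B * r)) powr \<alpha>) \<le> M / 2 * (\<delta> * exp (\<delta> * r))"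
      by (simp add: mult_ac)
  qed
qed

lemma bounded_flux_estimate:
  assumes "t \<le> 0" "M > 0" "E > 0" "B * E = \<kappa> * M powr q"
    and u: "\<And>s. s \<le> 0 \<Longrightarrow> 0 \<le> u s" "\<And>s. s \<le> 0 \<Longrightarrow> u s \<le> M"
  shows "cum False (\<lambda>s. ennreal (exp (- B * s) * (\<kappa> * u s powr q))) t \<le> ennreal (E * exp (- B * t))"
proof (rule cum_down_le[where x = "\<lambda>s. exp (- B * s) * (B * E)" and U' = "\<lambda>s. E * (exp (- B * s) * - B)"])
  fix r assume r: "t \<le> r" "r \<le> 0"
  show "ennreal (exp (- B * r) * (\<kappa> * u r powr q)) \<le> ennreal (exp (- B * r) * (B * E))"
    unfolding assms(4) using u[OF r(2)] kappa_pos q by (intro ennreal_leI mult_left_mono powr_mono2) auto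
  show "0 \<le> exp (- B * r) * (B * E)" using B_pos assms(3) by (intro mult_nonneg_nonneg) auto
  show "((\<lambda>s. E * exp (- B * s)) has_real_derivative E * (exp (- B * r) * - B)) (at r)"
    by (auto intro!: derivative_eq_intros)
  show "exp (- B * r) * (B * E) \<le> - (E * (exp (- B * r) * - B))"
    by (simp only: mult_minus_right minus_minus mult_ac order_refl)
qed (use assms in \<open>auto intro!: continuous_intros\<close>)

text \<open>
  The value is prescribed at minus infinity and the flux at time \<open>0\<close>.
\<close>
theorem local_bounded_source:
  obtains y z W0 where "W0 > 0" "solves 1 {..<0} y z" "((\<lambda>t. exp (- \<gamma> * t) * y t) \<longlongrightarrow> W0) at_bot"
proof -
  obtain M E \<delta> where M: "M > 0" "E > 0" "\<delta> > 0" "B * E = \<kappa> * M powr q"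
    and est: "\<And>r. r \<le> 0 \<Longrightarrow> exp (A * r) * (\<gamma> * (E + E * exp (- B * r)) powr \<alpha>) \<le> M / 2 * (\<delta> * exp (\<delta> * r))"
    using bounded_amplitude by blast
  define u1 where "u1 = (\<lambda>t. M / 2 + M / 2 * exp (\<delta> * t))"
  have u1: "0 \<le> u1 t" "u1 t \<le> M" if "t \<le> 0" for t
  proof -
    have "exp (\<delta> * t) \<le> 1" using M that by (simp add: mult_nonneg_nonpos)
    then have "M * exp (\<delta> * t) \<le> M * 1" "0 \<le> M * exp (\<delta> * t)" using M by (auto intro: mult_left_mono)
    then show "0 \<le> u1 t" "u1 t \<le> M" unfolding u1_def using M(1) by linarith+
  qed
  have c0: "M / 2 \<ge> 0" using M by simp
  obtain F G where F: "\<And>t. t < 0 \<Longrightarrow> M / 2 \<le> F t \<and> F t \<le> u1 t"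
    and G: "\<And>t. t < 0 \<Longrightarrow> 0 \<le> G t \<and> G t \<le> E * exp (- B * t)"
    and dF: "\<And>t. t < 0 \<Longrightarrow> (F has_real_derivative (if True then 1 else -1) * (exp (A * t) * (\<gamma> * (E + G t) powr \<alpha>))) (at t)"
    and dG: "\<And>t. t < 0 \<Longrightarrow> (G has_real_derivative (if False then 1 else -1) * (exp (- B * t) * (\<kappa> * F t powr q))) (at t)"
  proof (rule local_system[OF M(2) c0, where ?d1.0 = True and ?d2.0 = False and ?u1.0 = u1 and ?u2.0 = "\<lambda>t. E * exp (- B * t)"])
    fix t :: real assume t: "t \<le> 0"
    show "0 \<le> u1 t" using u1 t by simp
    show "0 \<le> E * exp (- B * t)" using M by simp
    show "cum False (\<lambda>s. ennreal (exp (- B * s) * (\<kappa> * u1 s powr q))) t \<le> ennreal (E * exp (- B * t))"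
      by (rule bounded_flux_estimate[OF t M(1,2,4) u1])
    have "cum True (\<lambda>s. ennreal (exp (A * s) * (\<gamma> * (E + E * exp (- B * s)) powr \<alpha>))) t \<le> ennreal (M / 2 * exp (\<delta> * t))"
      by (rule cum_up_le[where x = "\<lambda>r. M / 2 * (\<delta> * exp (\<delta> * r))" and U' = "\<lambda>r. M / 2 * (\<delta> * exp (\<delta> * r))"])
        (use t M est in \<open>auto intro!: ennreal_leI continuous_intros derivative_eq_intros\<close>)
    then show "ennreal (M / 2) + cum True (\<lambda>s. ennreal (exp (A * s) * (\<gamma> * (E + E * exp (- B * s)) powr \<alpha>))) t \<le> ennreal (u1 t)"
      unfolding u1_def using M by (subst ennreal_plus) (auto intro: add_left_mono)
  qed blast
  have Fpos: "F t > 0" if "t < 0" for t using F[OF that] M by auto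
  have "solves (- (1 * - 1)) {..<0} (\<lambda>t. exp (\<gamma> * t) * F t) (\<lambda>t. - 1 * (exp (\<kappa> * t) * (E + G t)))"
    by (rule solves_of_system[OF M(2)]) (use Fpos G dF dG in auto)
  then have sol: "solves 1 {..<0} (\<lambda>t. exp (\<gamma> * t) * F t) (\<lambda>t. - 1 * (exp (\<kappa> * t) * (E + G t)))" by simp
  have "(F \<longlongrightarrow> M / 2) at_bot"
  proof (rule tendsto_sandwich)
    show "\<forall>\<^sub>F t in at_bot. M / 2 \<le> F t" using eventually_gt_at_bot[of 0] by eventually_elim (use F in auto)
    show "\<forall>\<^sub>F t in at_bot. F t \<le> u1 t" using eventually_gt_at_bot[of 0] by eventually_elim (use F in auto)
    have "(u1 \<longlongrightarrow> M / 2 + M / 2 * 0) at_bot" unfolding u1_def by (intro tendsto_intros exp_mult_at_bot M)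
    then show "(u1 \<longlongrightarrow> M / 2) at_bot" by simp
  qed simp
  moreover have "exp (- \<gamma> * t) * (exp (\<gamma> * t) * F t) = F t" for t by (simp add: exp_minus)
  ultimately have "((\<lambda>t. exp (- \<gamma> * t) * (exp (\<gamma> * t) * F t)) \<longlongrightarrow> M / 2) at_bot" by (simp only:)
  then show thesis by (rule that[OF _ sol, rotated]) (use M in simp)
qed

text \<open>
  Both components are prescribed at time \<open>0\<close>, where \<open>y\<close> is to vanish.
\<close>
theorem local_bounded_vanishing:
  obtains y z W0 where "W0 > 0" "solves (-1) {..<0} y z" "((\<lambda>t. exp (- \<gamma> * t) * y t) \<longlongrightarrow> W0) at_bot"
    "(y \<longlongrightarrow> 0) (at_left 0)"
proof -
  obtain M E \<delta> where M: "M > 0" "E > 0" "\<delta> > 0" "B * E = \<kappa> * M powr q"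
    and est: "\<And>r. r \<le> 0 \<Longrightarrow> exp (A * r) * (\<gamma> * (E + E * exp (- B * r)) powr \<alpha>) \<le> M / 2 * (\<delta> * exp (\<delta> * r))"
    using bounded_amplitude by blast
  define u1 where "u1 = (\<lambda>t. M - M * exp (\<delta> * t))"
  have u1: "0 \<le> u1 t" "u1 t \<le> M" if "t \<le> 0" for t
  proof -
    have "exp (\<delta> * t) \<le> 1" using M that by (simp add: mult_nonneg_nonpos)
    then have "M * exp (\<delta> * t) \<le> M * 1" "0 \<le> M * exp (\<delta> * t)" using M by (auto intro: mult_left_mono)
    then show "0 \<le> u1 t" "u1 t \<le> M" unfolding u1_def using M(1) by linarith+
  qed
  obtain F G where F: "\<And>t. t < 0 \<Longrightarrow> 0 \<le> F t \<and> F t \<le> u1 t"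
    and G: "\<And>t. t < 0 \<Longrightarrow> 0 \<le> G t \<and> G t \<le> E * exp (- B * t)"
    and dF: "\<And>t. t < 0 \<Longrightarrow> (F has_real_derivative (if False then 1 else -1) * (exp (A * t) * (\<gamma> * (E + G t) powr \<alpha>))) (at t)"
    and dG: "\<And>t. t < 0 \<Longrightarrow> (G has_real_derivative (if False then 1 else -1) * (exp (- B * t) * (\<kappa> * F t powr q))) (at t)"
  proof (rule local_system[OF M(2) order_refl, where ?d1.0 = False and ?d2.0 = False and ?u1.0 = u1 and ?u2.0 = "\<lambda>t. E * exp (- B * t)"])
    fix t :: real assume t: "t \<le> 0"
    show "0 \<le> u1 t" using u1 t by simp
    show "0 \<le> E * exp (- B * t)" using M by simp
    show "cum False (\<lambda>s. ennreal (exp (- B * s) * (\<kappa> * u1 s powr q))) t \<le> ennreal (E * exp (- B * t))"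
      by (rule bounded_flux_estimate[OF t M(1,2,4) u1])
    have "cum False (\<lambda>s. ennreal (exp (A * s) * (\<gamma> * (E + E * exp (- B * s)) powr \<alpha>))) t \<le> ennreal (u1 t)"
      unfolding u1_def
      by (rule cum_down_le[OF t, where x = "\<lambda>r. M / 2 * (\<delta> * exp (\<delta> * r))" and U' = "\<lambda>r. - (M * (\<delta> * exp (\<delta> * r)))"])
        (use t M est in \<open>auto intro!: ennreal_leI continuous_intros derivative_eq_intros\<close>)
    then show "ennreal 0 + cum False (\<lambda>s. ennreal (exp (A * s) * (\<gamma> * (E + E * exp (- B * s)) powr \<alpha>))) t \<le> ennreal (u1 t)"
      by simp
  qed blast
  have dec: "F s > F t" if "s < t" "t < 0" for s t
  proof (rule DERIV_neg_imp_decreasing[OF that(1)])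
    fix x assume "s \<le> x" "x \<le> t"
    then have x: "x < 0" using that by simp
    have "exp (A * x) * (\<gamma> * (E + G x) powr \<alpha>) > 0" using G[OF x] M gamma by (intro mult_pos_pos) auto
    then show "\<exists>d. (F has_real_derivative d) (at x) \<and> d < 0" using dF[OF x] by - (rule exI, rule conjI, assumption, auto)
  qed
  have Fpos: "F t > 0" if "t < 0" for t using dec[of t "t / 2"] F[of "t / 2"] that by auto
  have "solves (- (- 1 * - 1)) {..<0} (\<lambda>t. exp (\<gamma> * t) * F t) (\<lambda>t. - (- 1) * (exp (\<kappa> * t) * (E + G t)))"
    by (rule solves_of_system[OF M(2)]) (use Fpos G dF dG in auto)
  then have sol: "solves (-1) {..<0} (\<lambda>t. exp (\<gamma> * t) * F t) (\<lambda>t. - (- 1) * (exp (\<kappa> * t) * (E + G t)))" by simp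
  obtain W0 where W0: "(F \<longlongrightarrow> W0) at_bot" "\<And>t. t \<le> -1 \<Longrightarrow> F t \<le> W0"
  proof (rule antimono_bounded_at_bot[of "-1" F M])
    show "F t \<le> F s" if "s \<le> t" "t \<le> -1" for s t using dec[of s t] that by (cases "s = t") auto
    show "F t \<le> M" if "t \<le> -1" for t using F[of t] u1(2)[of t] that by auto
  qed blast
  have e: "exp (- \<gamma> * t) * (exp (\<gamma> * t) * F t) = F t" for t by (simp add: exp_minus)
  have lim0: "((\<lambda>t. exp (\<gamma> * t) * F t) \<longlongrightarrow> 0) (at_left 0)"
  proof (rule tendsto_sandwich)
    have ev: "\<forall>\<^sub>F t in at_left (0::real). t < 0" by (simp add: eventually_at_filter)
    show "\<forall>\<^sub>F t in at_left 0. 0 \<le> exp (\<gamma> * t) * F t" using ev by eventually_elim (use Fpos in \<open>auto simp: less_imp_le\<close>)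
    show "\<forall>\<^sub>F t in at_left 0. exp (\<gamma> * t) * F t \<le> exp (\<gamma> * t) * u1 t" using ev by eventually_elim (use F in auto)
    have "((\<lambda>t. exp (\<gamma> * t) * (M - M * exp (\<delta> * t))) \<longlongrightarrow> exp (\<gamma> * 0) * (M - M * exp (\<delta> * 0))) (at_left 0)"
      by (intro tendsto_intros)
    then show "((\<lambda>t. exp (\<gamma> * t) * u1 t) \<longlongrightarrow> 0) (at_left 0)" by (simp add: u1_def)
  qed simp
  show thesis
  proof (rule that[OF _ sol _ lim0])
    show "W0 > 0" using W0(2)[of "-1"] Fpos[of "-1"] by simp
    show "((\<lambda>t. exp (- \<gamma> * t) * (exp (\<gamma> * t) * F t)) \<longlongrightarrow> W0) at_bot" unfolding e by (rule W0(1))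
  qed
qed

text \<open>
  The value vanishes at minus infinity and is bounded by a multiple of \<open>exp (A t)\<close>; then the flux changes by an integrable amount
  \<open>exp (b t)\<close>, so that its integral may start at either end. For \<open>\<epsilon> = -1\<close> it starts at minus infinity, for \<open>\<epsilon> = 1\<close> at
  time \<open>0\<close>, since these choices make the operator monotone.
\<close>
theorem local_increasing:
  assumes \<epsilon>: "\<epsilon> \<in> {1, -1::real}"
  obtains y z V0 where "V0 > 0" "solves \<epsilon> {..<0} y z" "\<forall>t<0. z t < 0"
    "((\<lambda>t. exp (- \<gamma> * t) * y t) \<longlongrightarrow> 0) at_bot" "((\<lambda>t. exp (- \<kappa> * t) * z t) \<longlongrightarrow> - V0) at_bot"
proof -
  note k0 = kappa_pos
  define b where "b = \<kappa> * (\<alpha> * q - 1)"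
  have b: "b > 0" unfolding b_def using k0 super by simp
  define K where "K = \<gamma> * (2 * \<kappa> / b) powr \<alpha> / A"
  have "K > 0" unfolding K_def using gamma k0 b A_pos by (intro divide_pos_pos mult_pos_pos) auto
  then obtain M where M: "M > 0" "K * M powr (\<alpha> * q) \<le> M / 2" using small_power[OF _ super] by blast
  define E where "E = \<kappa> / b * M powr q"
  have E: "E > 0" unfolding E_def using k0 b M by (intro mult_pos_pos divide_pos_pos) auto
  have bE: "b * E = \<kappa> * M powr q" using b by (simp add: E_def)
  have E2: "\<gamma> * (2 * E) powr \<alpha> \<le> A * M"
  proof -
    have "(2 * E) powr \<alpha> = (2 * \<kappa> / b) powr \<alpha> * (M powr q) powr \<alpha>"
      unfolding E_def using k0 b M by (subst powr_mult[symmetric]) (auto simp: mult.assoc)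
    then have "\<gamma> * (2 * E) powr \<alpha> = A * (K * M powr (\<alpha> * q))" using A_pos by (simp add: K_def powr_powr mult.commute)
    also have "\<dots> \<le> A * (M / 2)" using M(2) A_pos by (intro mult_left_mono) auto
    also have "\<dots> \<le> A * M" using M(1) A_pos by (intro mult_left_mono) auto
    finally show ?thesis .
  qed
  define d2 where "d2 = (\<epsilon> = -1)"
  define u1 where "u1 = (\<lambda>t. M * exp (A * t))"
  define u2 where "u2 = (\<lambda>t. if d2 then E * exp (b * t) else E - E * exp (b * t))"
  have u2: "0 \<le> u2 t" "u2 t \<le> E" if "t \<le> 0" for t
    using E that mult_nonneg_nonpos[of b t] b by (auto simp: u2_def)
  have Xeq: "exp (- B * s) * (\<kappa> * u1 s powr q) = E * (b * exp (b * s))" for s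
  proof -
    have "u1 s powr q = M powr q * exp (A * s * q)" unfolding u1_def using M by (simp add: powr_mult) (simp add: powr_def)
    then have "exp (- B * s) * (\<kappa> * u1 s powr q) = (b * E) * (exp (- B * s) * exp (A * s * q))" unfolding bE by simp
    also have "exp (- B * s) * exp (A * s * q) = exp (b * s)" unfolding b_def by (simp add: algebra_simps flip: exp_add)
    finally show ?thesis by simp
  qed
  obtain F G where F: "\<And>t. t < 0 \<Longrightarrow> 0 \<le> F t \<and> F t \<le> u1 t"
    and G: "\<And>t. t < 0 \<Longrightarrow> 0 \<le> G t \<and> G t \<le> u2 t"
    and dF: "\<And>t. t < 0 \<Longrightarrow> (F has_real_derivative (if True then 1 else -1) * (exp (A * t) * (\<gamma> * (E + G t) powr \<alpha>))) (at t)"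
    and dG: "\<And>t. t < 0 \<Longrightarrow> (G has_real_derivative (if d2 then 1 else -1) * (exp (- B * t) * (\<kappa> * F t powr q))) (at t)"
  proof (rule local_system[OF E order_refl, where ?d1.0 = True and ?d2.0 = d2 and ?u1.0 = u1 and ?u2.0 = u2])
    fix t :: real assume t: "t \<le> 0"
    show "0 \<le> u1 t" using M by (simp add: u1_def)
    show "0 \<le> u2 t" using u2 t by simp
    show "cum d2 (\<lambda>s. ennreal (exp (- B * s) * (\<kappa> * u1 s powr q))) t \<le> ennreal (u2 t)"
    proof (cases d2)
      case True
      then have u2': "u2 = (\<lambda>t. E * exp (b * t))" by (simp add: u2_def)
      show ?thesis unfolding Xeq u2' using True
        by (simp only:, intro cum_up_le[where x = "\<lambda>s. E * (b * exp (b * s))" and U' = "\<lambda>s. E * (b * exp (b * s))"])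
          (use E b in \<open>auto intro!: continuous_intros derivative_eq_intros\<close>)
    next
      case False
      then have u2': "u2 = (\<lambda>t. E - E * exp (b * t))" by (simp add: u2_def)
      show ?thesis unfolding Xeq u2' using False
        by (simp only:, intro cum_down_le[OF t, where x = "\<lambda>s. E * (b * exp (b * s))" and U' = "\<lambda>s. - (E * (b * exp (b * s)))"])
          (use E b in \<open>auto intro!: continuous_intros derivative_eq_intros\<close>)
    qed
    have "cum True (\<lambda>s. ennreal (exp (A * s) * (\<gamma> * (E + u2 s) powr \<alpha>))) t \<le> ennreal (u1 t)"
      unfolding u1_def
    proof (rule cum_up_le[where x = "\<lambda>s. exp (A * s) * (A * M)" and U' = "\<lambda>s. exp (A * s) * (A * M)"])
      fix r assume "r \<le> t"
      then have r: "r \<le> 0" using t by simp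
      have "(E + u2 r) powr \<alpha> \<le> (2 * E) powr \<alpha>" using u2[OF r] E alpha by (intro powr_mono2) auto
      then have "\<gamma> * (E + u2 r) powr \<alpha> \<le> \<gamma> * (2 * E) powr \<alpha>" using gamma by simp
      then show "ennreal (exp (A * r) * (\<gamma> * (E + u2 r) powr \<alpha>)) \<le> ennreal (exp (A * r) * (A * M))"
        using E2 by (intro ennreal_leI mult_left_mono) auto
      show "((\<lambda>s. M * exp (A * s)) has_real_derivative exp (A * r) * (A * M)) (at r)"
        by (auto intro!: derivative_eq_intros simp: algebra_simps)
      show "0 \<le> exp (A * r) * (A * M)" using A_pos M by (intro mult_nonneg_nonneg) auto
    qed (use M in \<open>auto intro!: continuous_intros\<close>)
    then show "ennreal 0 + cum True (\<lambda>s. ennreal (exp (A * s) * (\<gamma> * (E + u2 s) powr \<alpha>))) t \<le> ennreal (u1 t)" by simp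
  qed blast
  have inc: "F s < F t" if "s < t" "t < 0" for s t
  proof (rule DERIV_pos_imp_increasing[OF that(1)])
    fix x assume "s \<le> x" "x \<le> t"
    then have x: "x < 0" using that by simp
    have "exp (A * x) * (\<gamma> * (E + G x) powr \<alpha>) > 0" using G[OF x] E gamma by (intro mult_pos_pos) auto
    then show "\<exists>d. (F has_real_derivative d) (at x) \<and> d > 0" using dF[OF x] by - (rule exI, rule conjI, assumption, auto)
  qed
  have Fpos: "F t > 0" if "t < 0" for t using inc[of "t - 1" t] F[of "t - 1"] that by auto
  have "solves (- (1 * (if d2 then 1 else - 1))) {..<0} (\<lambda>t. exp (\<gamma> * t) * F t) (\<lambda>t. - 1 * (exp (\<kappa> * t) * (E + G t)))"
    by (rule solves_of_system[OF E]) (use Fpos G dF dG in auto)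
  moreover have "- (1 * (if d2 then 1 else - 1)) = \<epsilon>" using \<epsilon> by (auto simp: d2_def)
  ultimately have sol: "solves \<epsilon> {..<0} (\<lambda>t. exp (\<gamma> * t) * F t) (\<lambda>t. - 1 * (exp (\<kappa> * t) * (E + G t)))" by simp
  have F0: "(F \<longlongrightarrow> 0) at_bot"
  proof (rule tendsto_sandwich)
    show "\<forall>\<^sub>F t in at_bot. 0 \<le> F t" using eventually_gt_at_bot[of 0] by eventually_elim (use F in auto)
    show "\<forall>\<^sub>F t in at_bot. F t \<le> u1 t" using eventually_gt_at_bot[of 0] by eventually_elim (use F in auto)
    have "(u1 \<longlongrightarrow> M * 0) at_bot" unfolding u1_def by (intro tendsto_intros exp_mult_at_bot A_pos)
    then show "(u1 \<longlongrightarrow> 0) at_bot" by simp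
  qed simp
  obtain L where L: "(G \<longlongrightarrow> L) at_bot" "L \<ge> 0"
  proof (cases d2)
    case True
    have "(G \<longlongrightarrow> 0) at_bot"
    proof (rule tendsto_sandwich)
      show "\<forall>\<^sub>F t in at_bot. 0 \<le> G t" using eventually_gt_at_bot[of 0] by eventually_elim (use G in auto)
      show "\<forall>\<^sub>F t in at_bot. G t \<le> u2 t" using eventually_gt_at_bot[of 0] by eventually_elim (use G in auto)
      have "((\<lambda>t. E * exp (b * t)) \<longlongrightarrow> E * 0) at_bot" by (intro tendsto_intros exp_mult_at_bot b)
      then show "(u2 \<longlongrightarrow> 0) at_bot" using True by (simp add: u2_def)
    qed simp
    then show thesis using that by simp
  next
    case False
    show thesis
    proof (rule antimono_bounded_at_bot[of "-1" G E])
      fix s t :: real assume st: "s \<le> t" "t \<le> -1"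
      show "G t \<le> G s"
      proof (rule DERIV_nonpos_imp_nonincreasing[OF st(1)])
        fix x assume "s \<le> x" "x \<le> t"
        then have x: "x < 0" using st by simp
        have "exp (- B * x) * (\<kappa> * F x powr q) \<ge> 0" using k0 by simp
        then show "\<exists>d. (G has_real_derivative d) (at x) \<and> d \<le> 0" using dG[OF x] False by - (rule exI, rule conjI, assumption, auto)
      qed
    next
      show "G t \<le> E" if "t \<le> -1" for t using G[of t] u2(2)[of t] that by auto
    next
      fix L assume "(G \<longlongrightarrow> L) at_bot" "\<And>t. t \<le> -1 \<Longrightarrow> G t \<le> L"
      then show thesis using that[of L] G[of "-1"] by force
    qed
  qed
  show thesis
  proof (rule that[OF _ sol])
    show "E + L > 0" using E L by simp
    show "\<forall>t<0. - 1 * (exp (\<kappa> * t) * (E + G t)) < 0"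
    proof (intro allI impI)
      fix t :: real assume "t < 0"
      then show "- 1 * (exp (\<kappa> * t) * (E + G t)) < 0" using G[of t] E by simp
    qed
    have "exp (- \<gamma> * t) * (exp (\<gamma> * t) * F t) = F t" for t by (simp add: exp_minus)
    then show "((\<lambda>t. exp (- \<gamma> * t) * (exp (\<gamma> * t) * F t)) \<longlongrightarrow> 0) at_bot" using F0 by (simp only:)
    have e: "exp (- \<kappa> * t) * (- 1 * (exp (\<kappa> * t) * (E + G t))) = - (E + G t)" for t
    proof -
      have "exp (- \<kappa> * t) * (exp (\<kappa> * t) * x) = x" for x by (simp add: exp_minus)
      then show ?thesis by (simp only: mult_minus1 mult_minus_right)
    qed
    have "((\<lambda>t. - (E + G t)) \<longlongrightarrow> - (E + L)) at_bot" by (intro tendsto_intros L)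
    then show "((\<lambda>t. exp (- \<kappa> * t) * (- 1 * (exp (\<kappa> * t) * (E + G t)))) \<longlongrightarrow> - (E + L)) at_bot" unfolding e .
  qed
qed

section \<open>Nonexistence and blow-up\<close>

text \<open>
  Once the flux \<open>- V\<close> is negative it stays so, and as \<open>exp (A t)\<close> is not integrable at infinity the value would become negative. So the
  value increases forever, the flux is at least the integral of its loss from \<open>t\<close> to infinity, and this turns the first
  equation into \<open>y' \<ge> c y\<^sup>\<alpha>\<^sup>q\<close>, which has no positive solution on a half-line.
\<close>
theorem no_source_solution_at_infinity: "\<not> solves 1 {t0<..} y z"
proof
  assume sol: "solves 1 {t0<..} y z"
  define W where "W = (\<lambda>t. exp (- \<gamma> * t) * y t)"
  define V where "V = (\<lambda>t. exp (- \<kappa> * t) * z t)"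
  have Wpos: "W t > 0" if "t > t0" for t using solvesD(1)[OF sol] that by (simp add: W_def)
  have dW: "(W has_real_derivative - \<gamma> * exp (A * t) * spow \<alpha> (V t)) (at t)" if "t > t0" for t
    unfolding W_def V_def by (rule value_deriv_flux[OF sol]) (use that in simp)
  have dV: "(V has_real_derivative \<kappa> * exp (- \<kappa> * t) * y t powr q) (at t)" if "t > t0" for t
    using flux_deriv[OF sol, of t] that by (simp add: V_def)
  have Vmono: "V s \<le> V t" if "t0 < s" "s \<le> t" for s t
  proof (rule DERIV_nonneg_imp_nondecreasing[OF that(2)])
    fix x assume "s \<le> x"
    then show "\<exists>d. (V has_real_derivative d) (at x) \<and> d \<ge> 0"
      using dV[of x] that kappa_pos by (intro exI conjI) auto
  qed
  have V0: "V t1 \<le> 0" if t1: "t1 > t0" for t1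
  proof (rule ccontr)
    assume V1: "\<not> V t1 \<le> 0"
    show False
    proof (rule linear_decrease_false[of "\<gamma> * exp (A * t1) * V t1 powr \<alpha>" t1 W])
      show "0 < \<gamma> * exp (A * t1) * V t1 powr \<alpha>" using gamma V1 by simp
      fix t assume t: "t1 \<le> t"
      show "W t > 0" using Wpos t t1 by simp
      have Vt: "V t1 \<le> V t" using Vmono[OF t1 t] .
      have "A * t1 \<le> A * t" using A_pos t by (intro mult_left_mono) auto
      then have "exp (A * t1) * V t1 powr \<alpha> \<le> exp (A * t) * V t powr \<alpha>"
        using Vt V1 alpha by (intro mult_mono powr_mono2) auto
      then have "\<gamma> * (exp (A * t1) * V t1 powr \<alpha>) \<le> \<gamma> * (exp (A * t) * V t powr \<alpha>)" using gamma by simp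
      then show "\<exists>d. (W has_real_derivative d) (at t) \<and> d \<le> - (\<gamma> * exp (A * t1) * V t1 powr \<alpha>)"
        using dW[OF order_less_le_trans[OF t1 t]] V1 Vt by - (rule exI, rule conjI, assumption, auto simp: spow_pos mult.assoc)
    qed
  qed
  have zneg: "z t \<le> 0" if "t > t0" for t
    using V0[OF that] by (simp add: V_def mult_le_0_iff)
  have Wmono: "W s \<le> W t" if "t0 < s" "s \<le> t" for s t
  proof (rule DERIV_nonneg_imp_nondecreasing[OF that(2)])
    fix x assume x: "s \<le> x"
    then have "spow \<alpha> (V x) \<le> 0" using spow_le[OF alpha V0[of x]] that by simp
    then show "\<exists>d. (W has_real_derivative d) (at x) \<and> d \<ge> 0"
      using dW[OF order_less_le_trans[OF that(1) x]] gamma by - (rule exI, rule conjI, assumption, auto simp: mult_nonneg_nonpos)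
  qed
  have flux: "\<kappa> / B * y t powr q \<le> - z t" if t: "t > t0" for t
  proof -
    \<comment> \<open>The second term is the flux that a solution with the constant value \<open>W t\<close> would lose from time \<open>s\<close> on.\<close>
    define H where "H = (\<lambda>s. - V s - \<kappa> / B * W t powr q * exp (- B * s))"
    have Hs: "H s \<le> H t" if s: "t \<le> s" for s
    proof (rule DERIV_nonpos_imp_nonincreasing[OF s])
      fix x assume x: "t \<le> x"
      have xt0: "x > t0" using t x by simp
      have "(H has_real_derivative - (\<kappa> * exp (- \<kappa> * x) * y x powr q) - \<kappa> / B * W t powr q * (exp (- B * x) * - B)) (at x)"
        unfolding H_def using kappa by (auto intro!: derivative_eq_intros dV[OF xt0])
      moreover have "\<kappa> / B * W t powr q * (exp (- B * x) * - B) = - (\<kappa> * (exp (- B * x) * W t powr q))"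
      proof -
        have "\<kappa> / b * w * (e * - b) = - (\<kappa> * (e * w))" if "b \<noteq> 0" for b w e :: real
          using that by simp
        moreover have "B \<noteq> 0" using B_pos by linarith
        ultimately show ?thesis by metis
      qed
      moreover have "exp (- \<kappa> * x) * y x powr q = exp (- B * x) * W x powr q"
      proof -
        have "W x powr q = exp (- \<gamma> * x * q) * y x powr q"
          unfolding W_def using solvesD(1)[OF sol, of x] xt0 by (simp add: powr_mult) (simp add: powr_def)
        then show ?thesis by (simp add: exp_assoc algebra_simps flip: exp_add)
      qed
      moreover have "\<kappa> * (exp (- B * x) * W t powr q) \<le> \<kappa> * (exp (- B * x) * W x powr q)"
        using Wmono[OF t x] Wpos[OF t] kappa_pos q by (intro mult_left_mono powr_mono2) auto
      ultimately show "\<exists>d. (H has_real_derivative d) (at x) \<and> d \<le> 0"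
        by - (rule exI, rule conjI, assumption, simp add: mult.assoc)
    qed
    have "((\<lambda>s. - (\<kappa> / B * W t powr q) * exp (B * (- s))) \<longlongrightarrow> - (\<kappa> / B * W t powr q) * 0) at_top"
      using exp_mult_at_bot[OF B_pos] unfolding filterlim_at_bot_mirror by (intro tendsto_mult tendsto_const)
    then have "((\<lambda>s. - (\<kappa> / B * W t powr q) * exp (B * (- s))) \<longlongrightarrow> 0) at_top" by (simp only: mult_zero_right)
    moreover have "\<forall>\<^sub>F s in at_top. - (\<kappa> / B * W t powr q) * exp (B * (- s)) \<le> H t"
      using eventually_ge_at_top[of t]
    proof eventually_elim
      case (elim s)
      have "- (\<kappa> / B * W t powr q) * exp (B * (- s)) = H s + V s" by (simp add: H_def algebra_simps)
      then show ?case using V0[of s] Hs[OF elim] t elim by linarith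
    qed
    ultimately have "0 \<le> H t" by (rule tendsto_upperbound) simp
    then have "\<kappa> / B * (W t powr q * exp (- B * t)) \<le> - (exp (- \<kappa> * t) * z t)" by (simp add: H_def V_def mult.assoc)
    then have "exp (\<kappa> * t) * (\<kappa> / B * (W t powr q * exp (- B * t))) \<le> exp (\<kappa> * t) * - (exp (- \<kappa> * t) * z t)"
      by (intro mult_left_mono) auto
    moreover have "exp (\<kappa> * t) * - (exp (- \<kappa> * t) * z t) = - z t" by (simp add: exp_minus)
    moreover have "exp (\<kappa> * t) * (\<kappa> / B * (W t powr q * exp (- B * t))) = \<kappa> / B * y t powr q"
    proof -
      have "W t powr q = exp (- \<gamma> * t * q) * y t powr q"
        unfolding W_def using solvesD(1)[OF sol, of t] t by (simp add: powr_mult) (simp add: powr_def)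
      then have "exp (\<kappa> * t) * (W t powr q * exp (- B * t)) = y t powr q"
        by (simp add: exp_assoc algebra_simps flip: exp_add)
      then show ?thesis by (simp add: mult.left_commute)
    qed
    ultimately show ?thesis by linarith
  qed
  define c where "c = (\<kappa> / B) powr \<alpha>"
  have c: "c > 0" using kappa_pos B_pos by (simp add: c_def)
  show False
  proof (rule linear_decrease_false[of "(\<alpha> * q - 1) * (\<gamma> * c)" "t0 + 1" "\<lambda>t. y t powr (- (\<alpha> * q - 1))"])
    show "(\<alpha> * q - 1) * (\<gamma> * c) > 0" using super gamma c by simp
    fix t assume "t0 + 1 \<le> t"
    then have t: "t > t0" by simp
    have y: "y t > 0" using solvesD(1)[OF sol] t by simp
    show "y t powr (- (\<alpha> * q - 1)) > 0" using y by simp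
    have "(\<kappa> / B * y t powr q) powr \<alpha> \<le> (- z t) powr \<alpha>"
      using flux[OF t] kappa_pos B_pos alpha by (intro powr_mono2) auto
    moreover have "(\<kappa> / B * y t powr q) powr \<alpha> = c * y t powr (\<alpha> * q)"
      using kappa_pos B_pos unfolding c_def by (subst powr_mult) (auto simp: powr_powr mult.commute)
    moreover have "(- z t) powr \<alpha> = - spow \<alpha> (z t)" using zneg[OF t] spow_nonneg[of "- z t" \<alpha>] by (simp add: spow_minus)
    ultimately have "c * y t powr (\<alpha> * q) \<le> y t - spow \<alpha> (z t)" using y by linarith
    then have dle: "\<gamma> * (c * y t powr (\<alpha> * q)) \<le> \<gamma> * (y t - spow \<alpha> (z t))" using gamma by simp
    have dy: "(y has_real_derivative \<gamma> * (y t - spow \<alpha> (z t))) (at t)" using solvesD(2)[OF sol] t by simp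
    have "((\<lambda>t. y t powr (- (\<alpha> * q - 1))) has_real_derivative
        - (\<alpha> * q - 1) * y t powr (- (\<alpha> * q - 1) - 1) * (\<gamma> * (y t - spow \<alpha> (z t)))) (at t)"
      using y by (intro DERIV_chain2[OF has_real_derivative_powr dy])
    moreover have "y t powr (- (\<alpha> * q - 1) - 1) = y t powr (- (\<alpha> * q))" by simp
    moreover have "(\<alpha> * q - 1) * (\<gamma> * c) \<le> (\<alpha> * q - 1) * (y t powr (- (\<alpha> * q)) * (\<gamma> * (y t - spow \<alpha> (z t))))"
    proof (rule mult_left_mono)
      have "\<gamma> * c = y t powr (- (\<alpha> * q)) * (\<gamma> * (c * y t powr (\<alpha> * q)))"
        using y by (simp add: powr_minus)
      also have "\<dots> \<le> y t powr (- (\<alpha> * q)) * (\<gamma> * (y t - spow \<alpha> (z t)))"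
        by (rule mult_left_mono[OF dle]) simp
      finally show "\<gamma> * c \<le> y t powr (- (\<alpha> * q)) * (\<gamma> * (y t - spow \<alpha> (z t)))" .
    qed (use super in simp)
    ultimately show "\<exists>d. ((\<lambda>t. y t powr (- (\<alpha> * q - 1))) has_real_derivative d) (at t) \<and> d \<le> - ((\<alpha> * q - 1) * (\<gamma> * c))"
      by - (rule exI, rule conjI, assumption, simp only: mult_minus_left mult.assoc neg_le_iff_le)
  qed
qed

text \<open>
  In the direction of time given by \<open>e\<close>, \<open>\<rho>\<close> is the eigenvalue of the linearization at the equilibrium that has an
  eigenvector in the positive quadrant of the deviations.
\<close>
lemma saddle_eigenvalue:
  assumes e: "e \<in> {1, -1}"
  obtains \<rho> where "\<rho> > 0" "\<rho> - e * \<gamma> > 0" "\<rho> - e * \<kappa> > 0"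
    "(\<rho> - e * \<gamma>) * (\<rho> - e * \<kappa>) = \<alpha> * q * \<gamma> * \<kappa>"
proof -
  note k0 = kappa_pos
  define m where "m = max 0 (max (e * \<gamma>) (e * \<kappa>))"
  define P where "P = \<alpha> * q * \<gamma> * \<kappa>"
  have P: "P > \<gamma> * \<kappa>"
    using mult_strict_right_mono[OF super, of "\<gamma> * \<kappa>"] gamma k0 by (simp add: P_def mult.assoc)
  have P0: "P > 0" using P gamma k0 by (smt (verit) mult_pos_pos)
  define F where "F = (\<lambda>x. (x - e * \<gamma>) * (x - e * \<kappa>))"
  have Fm: "F m < P"
  proof (cases "e = 1")
    case True
    then have "F m = 0" using gamma k0 by (auto simp: F_def m_def max_def)
    then show ?thesis using P0 by simp
  next
    case False
    then have e1: "e = -1" using e by simp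
    then have "m = 0" using gamma k0 by (simp add: m_def)
    then have "F m = \<gamma> * \<kappa>" using e1 by (simp add: F_def)
    then show ?thesis using P by simp
  qed
  have "P \<le> F (m + (1 + P))"
  proof -
    have "1 + P \<le> m + (1 + P) - e * \<gamma>" "1 + P \<le> m + (1 + P) - e * \<kappa>" by (auto simp: m_def)
    then have "(1 + P) * (1 + P) \<le> F (m + (1 + P))" unfolding F_def using P0 by (intro mult_mono) auto
    moreover have "P \<le> (1 + P) * (1 + P)" using P0 by (simp add: algebra_simps)
    ultimately show ?thesis by simp
  qed
  moreover have "continuous_on {m..m + (1 + P)} F" unfolding F_def by (intro continuous_intros)
  ultimately obtain \<rho> where \<rho>: "m \<le> \<rho>" "\<rho> \<le> m + (1 + P)" "F \<rho> = P"
    using IVT'[of F m P "m + (1 + P)"] Fm P0 by auto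
  then have "m < \<rho>" using Fm by (cases "m = \<rho>") auto
  then show ?thesis using \<rho>(3) that[of \<rho>] by (auto simp: m_def F_def P_def)
qed

text \<open>
  Divided by the rates \<open>\<gamma>\<close> and \<open>\<kappa>\<close>, the weights form a positive left eigenvector, with eigenvalue \<open>c\<close>, of the
  linearization in the variables \<open>ln y\<close>, \<open>ln z\<close> and in reversed time.
\<close>
lemma growth_weights:
  obtains c \<theta>1 \<theta>2 where "c > 0" "\<theta>1 > 0" "\<theta>2 > 0" "\<theta>1 + \<theta>2 = 1"
    "q * \<theta>2 - \<theta>1 = c * \<theta>1 / \<gamma>" "\<alpha> * \<theta>1 - \<theta>2 = c * \<theta>2 / \<kappa>"
proof -
  obtain c where c: "c > 0" "(c + \<gamma>) * (c + \<kappa>) = \<alpha> * q * \<gamma> * \<kappa>"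
    using saddle_eigenvalue[of "-1"] by auto
  note k0 = kappa_pos
  \<comment> \<open>the ratio of the weights\<close>
  define r where "r = (1 + c / \<gamma>) / q"
  have r: "r > 0" using c gamma q by (simp add: r_def add_pos_pos)
  have r1: "q * r - 1 = c / \<gamma>" using q by (simp add: r_def)
  have r2: "\<alpha> - r = c * r / \<kappa>"
  proof -
    have "r * (1 + c / \<kappa>) = (c + \<gamma>) * (c + \<kappa>) / (q * \<gamma> * \<kappa>)"
      using gamma q k0 by (simp add: r_def field_simps)
    also have "\<dots> = \<alpha>" using c(2) gamma q k0 by simp
    finally show ?thesis using k0 by (simp add: field_simps)
  qed
  define \<theta>1 where "\<theta>1 = 1 / (1 + r)"
  have t: "\<theta>1 > 0" "\<theta>1 + r * \<theta>1 = 1" using r by (auto simp: \<theta>1_def field_simps)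
  show ?thesis
  proof (rule that[of c \<theta>1 "r * \<theta>1"])
    show "q * (r * \<theta>1) - \<theta>1 = c * \<theta>1 / \<gamma>" using arg_cong[OF r1, of "\<lambda>x. x * \<theta>1"] by (simp add: algebra_simps)
    show "\<alpha> * \<theta>1 - r * \<theta>1 = c * (r * \<theta>1) / \<kappa>" using arg_cong[OF r2, of "\<lambda>x. x * \<theta>1"] by (simp add: algebra_simps)
  qed (use c t r in auto)
qed

text \<open>
  Let \<open>L\<close> be the sum of \<open>ln y\<close> and \<open>ln z\<close> with the weights of \<open>growth_weights\<close>, divided by the rates. Its derivative is
  \<open>e\<close> plus a convex combination of two exponentials, and the mean of their exponents is exactly \<open>c L\<close>. For \<open>e = 1\<close> the
  derivative is at least \<open>1\<close>, so \<open>L\<close> eventually becomes positive by itself.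
\<close>
lemma blowup_coupled:
  fixes y z :: "real \<Rightarrow> real" and e :: real
  assumes pos: "\<And>t. t \<ge> t1 \<Longrightarrow> y t > 0" "\<And>t. t \<ge> t1 \<Longrightarrow> z t > 0"
    and dy: "\<And>t. t \<ge> t1 \<Longrightarrow> (y has_real_derivative \<gamma> * (z t powr \<alpha> + e * y t)) (at t)"
    and dz: "\<And>t. t \<ge> t1 \<Longrightarrow> (z has_real_derivative \<kappa> * (y t powr q + e * z t)) (at t)"
    and e: "e = 1 \<or> e = -1 \<and> y t1 > 1 \<and> z t1 > 1"
  shows False
proof -
  obtain c \<theta>1 \<theta>2 where c: "c > 0" and th: "\<theta>1 > 0" "\<theta>2 > 0" "\<theta>1 + \<theta>2 = 1"
    and w: "q * \<theta>2 - \<theta>1 = c * \<theta>1 / \<gamma>" "\<alpha> * \<theta>1 - \<theta>2 = c * \<theta>2 / \<kappa>"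
    using growth_weights by blast
  note k0 = kappa_pos
  define L where "L = (\<lambda>t. \<theta>1 / \<gamma> * ln (y t) + \<theta>2 / \<kappa> * ln (z t))"
  have dL: "\<exists>d. (L has_real_derivative d) (at t) \<and> d \<ge> exp (c * L t) + e" if t: "t \<ge> t1" for t
  proof -
    define a where "a = ln (y t)" define b where "b = ln (z t)"
    have yz: "y t = exp a" "z t = exp b" using pos[OF t] by (auto simp: a_def b_def)
    have "(L has_real_derivative \<theta>1 / \<gamma> * (\<gamma> * (z t powr \<alpha> + e * y t) / y t) + \<theta>2 / \<kappa> * (\<kappa> * (y t powr q + e * z t) / z t)) (at t)"
      unfolding L_def using pos[OF t]
      by (auto intro!: derivative_eq_intros dy[OF t] dz[OF t] simp: mult_ac)
    moreover have "\<theta>1 / \<gamma> * (\<gamma> * (z t powr \<alpha> + e * y t) / y t) = \<theta>1 * (exp (\<alpha> * b - a) + e)"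
      using gamma by (simp add: yz powr_def exp_diff field_simps)
    moreover have "\<theta>2 / \<kappa> * (\<kappa> * (y t powr q + e * z t) / z t) = \<theta>2 * (exp (q * a - b) + e)"
      using k0 by (simp add: yz powr_def exp_diff field_simps)
    ultimately have d: "(L has_real_derivative \<theta>1 * (exp (\<alpha> * b - a) + e) + \<theta>2 * (exp (q * a - b) + e)) (at t)"
      by (simp only:)
    have "c * L t = (c * \<theta>1 / \<gamma>) * a + (c * \<theta>2 / \<kappa>) * b" by (simp add: L_def a_def b_def algebra_simps)
    also have "\<dots> = \<theta>1 * (\<alpha> * b - a) + \<theta>2 * (q * a - b)" unfolding w[symmetric] by (simp add: algebra_simps)
    finally have "exp (c * L t) \<le> \<theta>1 * exp (\<alpha> * b - a) + \<theta>2 * exp (q * a - b)"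
      using exp_jensen[of \<theta>1 \<theta>2] th by simp
    moreover have "\<theta>1 * e + \<theta>2 * e = e" using th(3) by (metis distrib_right mult_1)
    ultimately have "exp (c * L t) + e \<le> \<theta>1 * (exp (\<alpha> * b - a) + e) + \<theta>2 * (exp (q * a - b) + e)"
      by (simp add: algebra_simps)
    with d show ?thesis by blast
  qed
  obtain t2 where t2: "t2 \<ge> t1" "L t2 > 0"
  proof (cases "e = 1")
    case False
    then have "L t1 > 0" using e th gamma k0 by (auto simp: L_def intro!: add_pos_pos)
    then show thesis using that[of t1] by simp
  next
    case True
    define t2 where "t2 = t1 + \<bar>L t1\<bar> + 1"
    have t12: "t1 \<le> t2" by (simp add: t2_def)
    have "L t1 - t1 \<le> L t2 - t2"
    proof (rule DERIV_nonneg_imp_nondecreasing[OF t12])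
      fix x assume "t1 \<le> x"
      then obtain d where d: "(L has_real_derivative d) (at x)" "d \<ge> exp (c * L x) + e" using dL by blast
      have "((\<lambda>x. L x - x) has_real_derivative d - 1) (at x)" by (intro derivative_intros d)
      moreover have "d - 1 \<ge> 0" using d(2) True by (smt (verit) exp_gt_zero)
      ultimately show "\<exists>d. ((\<lambda>x. L x - x) has_real_derivative d) (at x) \<and> 0 \<le> d" by blast
    qed
    then show thesis using that[OF t12] by (simp add: t2_def)
  qed
  show False
  proof (rule exponential_blowup_false[where ?t1.0 = t2 and L = L, OF c _ t2(2)])
    fix t assume "t2 \<le> t"
    then obtain d where "(L has_real_derivative d) (at t)" "d \<ge> exp (c * L t) + e" using dL[of t] t2 by auto
    then show "\<exists>d. (L has_real_derivative d) (at t) \<and> exp (c * L t) - 1 \<le> d"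
      using e by (intro exI[of _ d]) auto
  qed
qed

text \<open>
  As \<open>exp (- \<kappa> t) z\<close> is nonincreasing, \<open>z\<close> stays negative, and with \<open>- z\<close> in its place the system has the
  form of \<open>blowup_coupled\<close>.
\<close>
theorem no_absorption_solution_increasing:
  assumes sol: "solves (-1) {t0<..} y z" and t1: "t1 > t0" "z t1 < 0"
  shows False
proof -
  have neg: "z t < 0" if t: "t \<ge> t1" for t
  proof -
    have "exp (- \<kappa> * t1) * z t1 \<ge> exp (- \<kappa> * t) * z t"
    proof (rule DERIV_nonpos_imp_nonincreasing[OF t])
      fix x assume "t1 \<le> x"
      then have "x \<in> {t0<..}" using t1 by simp
      from flux_deriv[OF sol this] show "\<exists>d. ((\<lambda>t. exp (- \<kappa> * t) * z t) has_real_derivative d) (at x) \<and> d \<le> 0"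
        by (intro exI conjI, assumption) (use kappa_pos in simp)
    qed
    moreover have "exp (- \<kappa> * t1) * z t1 < 0" using t1 by (simp add: mult_pos_neg)
    ultimately have "exp (- \<kappa> * t) * z t < 0" by linarith
    then show ?thesis by (simp add: mult_less_0_iff)
  qed
  show False
  proof (rule blowup_coupled[of t1 y "\<lambda>t. - z t" 1])
    fix t assume t: "t1 \<le> t"
    then have tt: "t \<in> {t0<..}" using t1 by simp
    show "y t > 0" by (rule solvesD(1)[OF sol tt])
    show "- z t > 0" using neg[OF t] by simp
    have "spow \<alpha> (z t) = - ((- z t) powr \<alpha>)" using neg[OF t] spow_minus[of \<alpha> "- z t"] by (simp add: spow_pos)
    then show "(y has_real_derivative \<gamma> * ((- z t) powr \<alpha> + 1 * y t)) (at t)"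
      using solvesD(2)[OF sol tt] by (simp add: algebra_simps)
    have "((\<lambda>t. - z t) has_real_derivative - (\<kappa> * (z t + -1 * y t powr q))) (at t)"
      by (intro derivative_intros solvesD(3)[OF sol tt])
    then show "((\<lambda>t. - z t) has_real_derivative \<kappa> * (y t powr q + 1 * - z t)) (at t)" by (simp add: algebra_simps)
  qed simp
qed

section \<open>The four branches at the equilibrium\<close>

text \<open>
  The sign \<open>s\<close> is the side to which \<open>y\<close> deviates from \<open>1\<close>, and \<open>e\<close> the direction of time, which always points away
  from the equilibrium. For \<open>e = -1\<close> both components deviate to the same side, for \<open>e = 1\<close> to opposite sides.
\<close>
lemma equilibrium_branch:
  assumes e: "e \<in> {1, -1}" and s: "s \<in> {1, -1::real}"
  obtains D h k where "D = UNIV \<or> (\<exists>T. D = {..<T} \<and> filterlim h at_top (at_left T))"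
    "\<And>t. t \<in> D \<Longrightarrow> h t > 0" "\<And>t. t \<in> D \<Longrightarrow> k t > 0"
    "\<And>t. t \<in> D \<Longrightarrow> (h has_real_derivative e * \<gamma> * h t + \<gamma> * dev \<alpha> (- e * s) (k t)) (at t)"
    "\<And>t. t \<in> D \<Longrightarrow> (k has_real_derivative e * \<kappa> * k t + \<kappa> * dev q s (h t)) (at t)"
    "(h \<longlongrightarrow> 0) at_bot" "(k \<longlongrightarrow> 0) at_bot"
proof -
  note result = that
  note k0 = kappa_pos
  obtain \<rho> where \<rho>: "\<rho> > 0" "\<rho> - e * \<gamma> > 0" "\<rho> - e * \<kappa> > 0"
    "(\<rho> - e * \<gamma>) * (\<rho> - e * \<kappa>) = \<alpha> * q * \<gamma> * \<kappa>" using saddle_eigenvalue[OF e] by blast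
  obtain C1 where C1: "C1 \<ge> 0"
    "\<And>s k. s \<in> {1, -1} \<Longrightarrow> 0 \<le> k \<Longrightarrow> k \<le> 1/2 \<Longrightarrow> \<bar>dev \<alpha> s k - \<alpha> * k\<bar> \<le> C1 * k\<^sup>2"
    using dev_quadratic[of \<alpha>] by blast
  obtain C2 where C2: "C2 \<ge> 0"
    "\<And>s k. s \<in> {1, -1} \<Longrightarrow> 0 \<le> k \<Longrightarrow> k \<le> 1/2 \<Longrightarrow> \<bar>dev q s k - q * k\<bar> \<le> C2 * k\<^sup>2"
    using dev_quadratic[of q] by blast
  have es: "- e * s \<in> {1, -1}" using e s by auto
  have scale: "\<bar>g * x - g * w * k\<bar> \<le> C * k\<^sup>2" if "g > 0" "\<bar>x - w * k\<bar> \<le> C' * k\<^sup>2" "g * C' \<le> C" for g x w k C C' :: real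
  proof -
    have "\<bar>g * x - g * w * k\<bar> = g * \<bar>x - w * k\<bar>" using that(1) by (simp add: abs_mult mult.assoc flip: right_diff_distrib)
    also have "\<dots> \<le> g * (C' * k\<^sup>2)" using that by (intro mult_left_mono) auto
    also have "\<dots> = (g * C') * k\<^sup>2" by simp
    also have "\<dots> \<le> C * k\<^sup>2" using that(3) by (intro mult_right_mono) auto
    finally show ?thesis .
  qed
  show thesis
  proof (rule unstable_branch[where \<Phi> = "\<lambda>x. \<gamma> * dev \<alpha> (- e * s) x" and \<Psi> = "\<lambda>x. \<kappa> * dev q s x"
       and c = "\<gamma> * \<alpha>" and d = "\<kappa> * q" and C = "\<gamma> * C1 + \<kappa> * C2" and \<rho> = \<rho> and \<omega> = "e * \<gamma>" and \<omega>' = "e * \<kappa>"])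
    show "mono (\<lambda>x. \<gamma> * dev \<alpha> (- e * s) x)" using monoD[OF dev_mono[OF alpha es]] gamma by (auto simp: mono_def)
    show "mono (\<lambda>x. \<kappa> * dev q s x)" using monoD[OF dev_mono[OF q s]] k0 by (auto simp: mono_def)
    show "continuous_on UNIV (\<lambda>x. \<gamma> * dev \<alpha> (- e * s) x)" by (intro continuous_intros dev_continuous alpha)
    show "continuous_on UNIV (\<lambda>x. \<kappa> * dev q s x)" by (intro continuous_intros dev_continuous q)
    show "\<bar>\<gamma> * dev \<alpha> (- e * s) k - \<gamma> * \<alpha> * k\<bar> \<le> (\<gamma> * C1 + \<kappa> * C2) * k\<^sup>2" if "0 \<le> k" "k \<le> 1/2" for k
      by (rule scale[OF gamma C1(2)[OF es that]]) (use k0 C2(1) in simp)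
    show "\<bar>\<kappa> * dev q s k - \<kappa> * q * k\<bar> \<le> (\<gamma> * C1 + \<kappa> * C2) * k\<^sup>2" if "0 \<le> k" "k \<le> 1/2" for k
      by (rule scale[OF k0 C2(2)[OF s that]]) (use gamma C1(1) in simp)
    show "\<gamma> * \<alpha> > 0" "\<kappa> * q > 0" "\<gamma> * C1 + \<kappa> * C2 \<ge> 0" using gamma k0 alpha q C1(1) C2(1) by auto
    show "(\<rho> - e * \<gamma>) * (\<rho> - e * \<kappa>) = \<gamma> * \<alpha> * (\<kappa> * q)" using \<rho>(4) by (simp add: mult_ac)
    show thesis if "D = UNIV \<or> (\<exists>T. D = {..<T} \<and> filterlim h at_top (at_left T))"
      "\<And>t. t \<in> D \<Longrightarrow> h t > 0" "\<And>t. t \<in> D \<Longrightarrow> k t > 0"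
      "\<And>t. t \<in> D \<Longrightarrow> (h has_real_derivative e * \<gamma> * h t + \<gamma> * dev \<alpha> (- e * s) (k t)) (at t)"
      "\<And>t. t \<in> D \<Longrightarrow> (k has_real_derivative e * \<kappa> * k t + \<kappa> * dev q s (h t)) (at t)"
      "(h \<longlongrightarrow> 0) at_bot" "(k \<longlongrightarrow> 0) at_bot" for D h k
      by (rule result[OF that])
  qed (use \<rho> in auto)
qed

lemma solves_branch:
  assumes e: "e \<in> {1, -1::real}" and s: "s \<in> {1, -1::real}"
    and J: "\<And>t. t \<in> J \<Longrightarrow> e * t \<in> D" "\<And>t. t \<in> J \<Longrightarrow> 1 + s * h (e * t) > 0"
    and dh: "\<And>t. t \<in> D \<Longrightarrow> (h has_real_derivative e * \<gamma> * h t + \<gamma> * dev \<alpha> (- e * s) (k t)) (at t)"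
    and dk: "\<And>t. t \<in> D \<Longrightarrow> (k has_real_derivative e * \<kappa> * k t + \<kappa> * dev q s (h t)) (at t)"
  shows "solves (-1) J (\<lambda>t. 1 + s * h (e * t)) (\<lambda>t. 1 - e * s * k (e * t))"
  unfolding solves_def
proof (intro ballI conjI)
  fix t assume t: "t \<in> J"
  note D = J(1)[OF t] and y = J(2)[OF t]
  show "1 + s * h (e * t) > 0" by (rule y)
  have ee: "e * e = 1" "s * s = 1" using e s by auto
  have de: "((\<lambda>t. e * t) has_real_derivative e) (at t)" by (auto intro!: derivative_eq_intros)
  have "((\<lambda>t. 1 + s * h (e * t)) has_real_derivative s * ((e * \<gamma> * h (e * t) + \<gamma> * dev \<alpha> (- e * s) (k (e * t))) * e)) (at t)"
    by (auto intro!: derivative_eq_intros DERIV_chain2[OF dh[OF D] de])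
  moreover have "s * ((e * \<gamma> * h (e * t) + \<gamma> * dev \<alpha> (- e * s) (k (e * t))) * e)
      = \<gamma> * (1 + s * h (e * t) - spow \<alpha> (1 - e * s * k (e * t)))"
    using e s by (auto simp: dev_def algebra_simps)
  ultimately show "((\<lambda>t. 1 + s * h (e * t)) has_real_derivative \<gamma> * (1 + s * h (e * t) - spow \<alpha> (1 - e * s * k (e * t)))) (at t)"
    by (simp only:)
  have "((\<lambda>t. 1 - e * s * k (e * t)) has_real_derivative - (e * s * ((e * \<kappa> * k (e * t) + \<kappa> * dev q s (h (e * t))) * e))) (at t)"
    by (auto intro!: derivative_eq_intros DERIV_chain2[OF dk[OF D] de])
  moreover have "- (e * s * ((e * \<kappa> * k (e * t) + \<kappa> * dev q s (h (e * t))) * e))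
      = \<kappa> * (1 - e * s * k (e * t) + -1 * (1 + s * h (e * t)) powr q)"
    using e s y by (auto simp: dev_def spow_pos algebra_simps)
  ultimately show "((\<lambda>t. 1 - e * s * k (e * t)) has_real_derivative \<kappa> * (1 - e * s * k (e * t) + -1 * (1 + s * h (e * t)) powr q)) (at t)"
    by (simp only:)
qed

text \<open>
  Backward in time both components exceed \<open>1\<close>, which forces blow-up.
\<close>
theorem exterior_blowup_branch:
  obtains t0 y z where "solves (-1) {t0<..} y z" "(y \<longlongrightarrow> 1) at_top" "filterlim y at_top (at_right t0)"
proof -
  have e: "(-1::real) \<in> {1, -1}" "(1::real) \<in> {1, -1}" by auto
  obtain D h k where D: "D = UNIV \<or> (\<exists>T. D = {..<T} \<and> filterlim h at_top (at_left T))"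
    and pos: "\<And>t. t \<in> D \<Longrightarrow> h t > 0" "\<And>t. t \<in> D \<Longrightarrow> k t > 0"
    and dh: "\<And>t. t \<in> D \<Longrightarrow> (h has_real_derivative -1 * \<gamma> * h t + \<gamma> * dev \<alpha> (- (-1) * 1) (k t)) (at t)"
    and dk: "\<And>t. t \<in> D \<Longrightarrow> (k has_real_derivative -1 * \<kappa> * k t + \<kappa> * dev q 1 (h t)) (at t)"
    and lim: "(h \<longlongrightarrow> 0) at_bot" "(k \<longlongrightarrow> 0) at_bot"
    using equilibrium_branch[OF e] by blast
  have "D \<noteq> UNIV"
  proof
    assume DU: "D = UNIV"
    show False
    proof (rule blowup_coupled[of 0 "\<lambda>t. 1 + h t" "\<lambda>t. 1 + k t" "-1"])
      fix t :: real
      have tD: "t \<in> D" using DU by simp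
      show "1 + h t > 0" "1 + k t > 0" using pos[OF tD] by auto
      show "((\<lambda>t. 1 + h t) has_real_derivative \<gamma> * ((1 + k t) powr \<alpha> + - 1 * (1 + h t))) (at t)"
        using DERIV_add[OF DERIV_const[of 1] dh[OF tD]] pos[OF tD] by (simp add: dev_def spow_pos algebra_simps)
      show "((\<lambda>t. 1 + k t) has_real_derivative \<kappa> * ((1 + h t) powr q + - 1 * (1 + k t))) (at t)"
        using DERIV_add[OF DERIV_const[of 1] dk[OF tD]] pos[OF tD] by (simp add: dev_def spow_pos algebra_simps)
    qed (use pos[of 0] DU in auto)
  qed
  then obtain T where T: "D = {..<T}" "filterlim h at_top (at_left T)" using D by blast
  show thesis
  proof (rule that)
    show "solves (-1) {- T<..} (\<lambda>t. 1 + 1 * h (-1 * t)) (\<lambda>t. 1 - (-1) * 1 * k (-1 * t))"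
    proof (rule solves_branch[where D = D, OF e])
      fix t assume "t \<in> {- T<..}"
      then show "-1 * t \<in> D" "1 + 1 * h (-1 * t) > 0" using T pos(1)[of "- t"] by (auto simp: add_pos_pos)
    qed (fact dh dk)+
    have "((\<lambda>t. 1 + 1 * h (-1 * t)) \<longlongrightarrow> 1 + 1 * 0) at_top"
      using lim(1) unfolding filterlim_at_bot_mirror by (intro tendsto_intros) simp
    then show "((\<lambda>t. 1 + 1 * h (-1 * t)) \<longlongrightarrow> 1) at_top" by simp
    have "filterlim (\<lambda>t. h (- t)) at_top (at_right (- T))"
      using T(2) unfolding filterlim_at_left_to_right by simp
    then have "filterlim (\<lambda>t. 1 + h (- t)) at_top (at_right (- T))"
      by (rule filterlim_tendsto_add_at_top[OF tendsto_const])
    then show "filterlim (\<lambda>t. 1 + 1 * h (-1 * t)) at_top (at_right (- T))" by simp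
  qed
qed

text \<open>
  If the branch existed for all times, then \<open>k = 1 - z\<close> would grow exponentially, so \<open>z\<close> would become negative.
\<close>
theorem singular_blowup_branch:
  obtains t0 y z where "solves (-1) {..<t0} y z" "(y \<longlongrightarrow> 1) at_bot" "filterlim y at_top (at_left t0)"
proof -
  have e: "(1::real) \<in> {1, -1}" "(1::real) \<in> {1, -1}" by auto
  obtain D h k where D: "D = UNIV \<or> (\<exists>T. D = {..<T} \<and> filterlim h at_top (at_left T))"
    and pos: "\<And>t. t \<in> D \<Longrightarrow> h t > 0" "\<And>t. t \<in> D \<Longrightarrow> k t > 0"
    and dh: "\<And>t. t \<in> D \<Longrightarrow> (h has_real_derivative 1 * \<gamma> * h t + \<gamma> * dev \<alpha> (- 1 * 1) (k t)) (at t)"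
    and dk: "\<And>t. t \<in> D \<Longrightarrow> (k has_real_derivative 1 * \<kappa> * k t + \<kappa> * dev q 1 (h t)) (at t)"
    and lim: "(h \<longlongrightarrow> 0) at_bot" "(k \<longlongrightarrow> 0) at_bot"
    using equilibrium_branch[OF e] by blast
  have sol: "solves (-1) D (\<lambda>t. 1 + 1 * h (1 * t)) (\<lambda>t. 1 - 1 * 1 * k (1 * t))"
    by (rule solves_branch[OF e _ _ dh dk]) (use pos(1) in \<open>auto simp: add_pos_pos\<close>)
  have "D \<noteq> UNIV"
  proof
    assume DU: "D = UNIV"
    have kg: "k 0 * exp (\<kappa> * (t - 0)) \<le> k t" if t: "0 \<le> t" for t
    proof (rule exp_growth_ge[OF t])
      fix x
      have "dev q 1 (h x) \<ge> 0" using pos(1)[of x] DU q by (intro dev_nonneg) auto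
      then show "\<exists>d. (k has_real_derivative d) (at x) \<and> \<kappa> * k x \<le> d"
        using dk[of x] DU kappa_pos by (intro exI[of _ "1 * \<kappa> * k x + \<kappa> * dev q 1 (h x)"]) auto
    qed
    define t where "t = 1 / (\<kappa> * k 0)"
    have k0: "k 0 > 0" using pos DU by simp
    have t: "t > 0" using k0 kappa_pos by (simp add: t_def)
    have "k 0 * (1 + \<kappa> * t) \<le> k 0 * exp (\<kappa> * (t - 0))" using k0 exp_ge_add_one_self[of "\<kappa> * t"] by simp
    also have "\<dots> \<le> k t" using kg t by simp
    finally have "k t > 1" using k0 kappa_pos by (simp add: t_def algebra_simps)
    then have "1 - 1 * 1 * k (1 * t) < 0" by simp
    moreover have "solves (-1) {t - 1<..} (\<lambda>t. 1 + 1 * h (1 * t)) (\<lambda>t. 1 - 1 * 1 * k (1 * t))"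
      using sol by (rule solves_subset) (simp add: DU)
    ultimately show False by (rule no_absorption_solution_increasing[where ?t1.0 = t, rotated 2]) simp
  qed
  then obtain T where T: "D = {..<T}" "filterlim h at_top (at_left T)" using D by blast
  show thesis
  proof (rule that)
    show "solves (-1) {..<T} (\<lambda>t. 1 + 1 * h (1 * t)) (\<lambda>t. 1 - 1 * 1 * k (1 * t))" using sol T by simp
    have "((\<lambda>t. 1 + 1 * h (1 * t)) \<longlongrightarrow> 1 + 1 * 0) at_bot"
      using lim(1) by (intro tendsto_intros) simp
    then show "((\<lambda>t. 1 + 1 * h (1 * t)) \<longlongrightarrow> 1) at_bot" by simp
    have "filterlim (\<lambda>t. 1 + h t) at_top (at_left T)"
      by (rule filterlim_tendsto_add_at_top[OF tendsto_const T(2)])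
    then show "filterlim (\<lambda>t. 1 + 1 * h (1 * t)) at_top (at_left T)" by simp
  qed
qed

text \<open>
  The deviation \<open>h = 1 - y\<close> grows exponentially, or blows up; in either case it reaches \<open>1\<close>.
\<close>
theorem singular_vanishing_branch:
  obtains t0 y z where "solves (-1) {..<t0} y z" "(y \<longlongrightarrow> 1) at_bot" "y t0 = 0" "(y \<longlongrightarrow> 0) (at_left t0)"
proof -
  have e: "(1::real) \<in> {1, -1}" "(-1::real) \<in> {1, -1}" by auto
  obtain D h k where D: "D = UNIV \<or> (\<exists>T. D = {..<T} \<and> filterlim h at_top (at_left T))"
    and pos: "\<And>t. t \<in> D \<Longrightarrow> h t > 0" "\<And>t. t \<in> D \<Longrightarrow> k t > 0"
    and dh: "\<And>t. t \<in> D \<Longrightarrow> (h has_real_derivative 1 * \<gamma> * h t + \<gamma> * dev \<alpha> (- 1 * - 1) (k t)) (at t)"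
    and dk: "\<And>t. t \<in> D \<Longrightarrow> (k has_real_derivative 1 * \<kappa> * k t + \<kappa> * dev q (- 1) (h t)) (at t)"
    and lim: "(h \<longlongrightarrow> 0) at_bot" "(k \<longlongrightarrow> 0) at_bot"
    using equilibrium_branch[OF e] by blast
  have down: "s \<in> D" if "t \<in> D" "s \<le> t" for s t using D that by auto
  have dh': "\<exists>d. (h has_real_derivative d) (at x) \<and> \<gamma> * h x \<le> d" if x: "x \<in> D" for x
  proof -
    have "dev \<alpha> (- 1 * - 1) (k x) \<ge> 0" using pos(2)[OF x] alpha by (intro dev_nonneg) auto
    then show ?thesis using dh[OF x] gamma by (intro exI[of _ "1 * \<gamma> * h x + \<gamma> * dev \<alpha> (- 1 * - 1) (k x)"]) auto
  qed
  obtain t2 where t2: "t2 \<in> D" "h t2 \<ge> 1"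
  proof (cases "D = UNIV")
    case True
    define t where "t = 1 / (\<gamma> * h 0)"
    have h0: "h 0 > 0" using pos True by simp
    have t: "t > 0" using h0 gamma by (simp add: t_def)
    have "h 0 * exp (\<gamma> * (t - 0)) \<le> h t"
      by (rule exp_growth_ge) (use t dh' True in auto)
    moreover have "h 0 * (1 + \<gamma> * t) \<le> h 0 * exp (\<gamma> * (t - 0))" using h0 exp_ge_add_one_self[of "\<gamma> * t"] by simp
    moreover have "h 0 * (1 + \<gamma> * t) = h 0 + 1" using h0 gamma by (simp add: t_def field_simps)
    ultimately have "h t \<ge> 1" using h0 by linarith
    then show thesis using that[of t] True by simp
  next
    case False
    then obtain T where T: "D = {..<T}" "filterlim h at_top (at_left T)" using D by blast
    then have "\<forall>\<^sub>F t in at_left T. 1 \<le> h t" by (simp add: filterlim_at_top)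
    moreover have "\<forall>\<^sub>F t in at_left T. t < T" by (simp add: eventually_at_filter)
    ultimately have "\<forall>\<^sub>F t in at_left T. 1 \<le> h t \<and> t < T" by eventually_elim simp
    then obtain t where "1 \<le> h t" "t < T" using eventually_happens'[OF trivial_limit_at_left_real] by blast
    then show thesis using that T by auto
  qed
  have hmono: "h s < h t" if "s < t" "t \<in> D" for s t
  proof (rule DERIV_pos_imp_increasing[OF that(1)])
    fix x assume "s \<le> x" "x \<le> t"
    then have x: "x \<in> D" using down that by blast
    then obtain d where "(h has_real_derivative d) (at x)" "\<gamma> * h x \<le> d" using dh' by blast
    moreover have "\<gamma> * h x > 0" using gamma pos(1)[OF x] by simp
    ultimately show "\<exists>d. (h has_real_derivative d) (at x) \<and> d > 0" by (intro exI[of _ d]) auto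
  qed
  have "\<forall>\<^sub>F t in at_bot. h t < 1" using lim(1) by (rule order_tendstoD) simp
  moreover have "\<forall>\<^sub>F t in at_bot. t \<le> t2" by (rule eventually_le_at_bot)
  ultimately have "\<forall>\<^sub>F t in at_bot. h t < 1 \<and> t \<le> t2" by eventually_elim simp
  then obtain t1 where t1: "h t1 < 1" "t1 \<le> t2" using eventually_happens[of _ "at_bot::real filter"] by auto
  have "continuous_on {t1..t2} h"
    by (intro continuous_at_imp_continuous_on ballI DERIV_isCont[OF dh] down[OF t2(1)]) simp
  then obtain t0 where t0: "t1 \<le> t0" "t0 \<le> t2" "h t0 = 1" using IVT'[of h t1 1 t2] t1 t2 by auto
  have t0D: "t0 \<in> D" using down t2 t0 by blast
  show thesis
  proof (rule that)
    show "solves (-1) {..<t0} (\<lambda>t. 1 + -1 * h (1 * t)) (\<lambda>t. 1 - 1 * -1 * k (1 * t))"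
    proof (rule solves_branch[OF e _ _ dh dk])
      fix t assume "t \<in> {..<t0}"
      then show "1 * t \<in> D" "1 + -1 * h (1 * t) > 0" using down[OF t0D] hmono[of t t0] t0D t0 by auto
    qed
    have "((\<lambda>t. 1 + -1 * h (1 * t)) \<longlongrightarrow> 1 + -1 * 0) at_bot"
      using lim(1) by (intro tendsto_intros) simp
    then show "((\<lambda>t. 1 + -1 * h (1 * t)) \<longlongrightarrow> 1) at_bot" by simp
    show "1 + -1 * h (1 * t0) = 0" using t0 by simp
    have "isCont h t0" using dh[OF t0D] by (rule DERIV_isCont)
    then have "(h \<longlongrightarrow> 1) (at_left t0)" using t0(3) tendsto_within_subset[OF isContD subset_UNIV] by metis
    then have "((\<lambda>t. 1 + -1 * h t) \<longlongrightarrow> 1 + -1 * 1) (at_left t0)" by (intro tendsto_intros)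
    then show "((\<lambda>t. 1 + -1 * h (1 * t)) \<longlongrightarrow> 0) (at_left t0)" by simp
  qed
qed

text \<open>
  In reversed time the functions \<open>yb = (1 + X) powr (- \<gamma> / \<theta>)\<close> and \<open>zb\<close>, with \<open>X = c exp (\<theta> t)\<close>, satisfy the first equation
  exactly and the second one as an inequality, provided that \<open>\<theta>\<close> is small. For small \<open>c\<close> they start above the solution
  and then remain above it because the system is cooperative. In the original variables \<open>yb\<close> is a multiple of
  \<open>(c + r\<^sup>\<theta>)\<^sup>-\<^sup>\<gamma>\<^sup>/\<^sup>\<theta>\<close>.
\<close>
lemma bounded_barrier:
  fixes y z :: "real \<Rightarrow> real"
  assumes pos: "\<And>t. t \<ge> 0 \<Longrightarrow> y t > 0" "\<And>t. t \<ge> 0 \<Longrightarrow> z t > 0"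
    and less1: "y 0 < 1" "z 0 < 1"
    and dy: "\<And>t. t \<ge> 0 \<Longrightarrow> (y has_real_derivative \<gamma> * (z t powr \<alpha> - y t)) (at t)"
    and dz: "\<And>t. t \<ge> 0 \<Longrightarrow> (z has_real_derivative \<kappa> * (y t powr q - z t)) (at t)"
  obtains K where "\<And>t. t \<ge> 0 \<Longrightarrow> exp (\<gamma> * t) * y t \<le> K"
proof -
  note k0 = kappa_pos
  \<comment> \<open>The first bound makes the coefficient of \<open>X\<close> in the second inequality nonnegative, the second one orders the exponents.\<close>
  define \<theta> where "\<theta> = min A (\<gamma> * (\<alpha> * q - 1) / (1 + \<alpha>))"
  have th: "\<theta> > 0" unfolding \<theta>_def using A_pos gamma super alpha by simp
  have thA: "\<gamma> + \<theta> \<le> \<kappa> * \<alpha>" by (simp add: \<theta>_def)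
  have "\<theta> \<le> \<gamma> * (\<alpha> * q - 1) / (1 + \<alpha>)" by (simp add: \<theta>_def)
  then have thB: "\<theta> * (1 + \<alpha>) \<le> \<gamma> * (\<alpha> * q - 1)" using alpha by (simp add: field_simps)
  define m where "m = (\<gamma> + \<theta>) / (\<theta> * \<alpha>)"
  have mq: "m + 1 \<le> q * \<gamma> / \<theta>"
  proof -
    have "m + 1 = (\<gamma> + \<theta> * (1 + \<alpha>)) / (\<theta> * \<alpha>)" unfolding m_def using th alpha by (simp add: field_simps)
    also have "\<dots> \<le> (\<gamma> * \<alpha> * q) / (\<theta> * \<alpha>)" using thB th alpha by (intro divide_right_mono) (auto simp: algebra_simps)
    also have "\<dots> = q * \<gamma> / \<theta>" using alpha by simp
    finally show ?thesis .
  qed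
  have ex: "\<exists>c>0. y 0 < (1 + c) powr (- \<gamma> / \<theta>) \<and> z 0 < (1 + c) powr (- m)"
  proof -
    have l: "((\<lambda>c. (1 + c) powr w) \<longlongrightarrow> (1 + 0) powr w) (at_right (0::real))" for w
      by (intro tendsto_intros) auto
    have "\<forall>\<^sub>F c in at_right 0. y 0 < (1 + c) powr (- \<gamma> / \<theta>)"
      by (rule order_tendstoD(1)[OF l]) (use less1 in simp)
    moreover have "\<forall>\<^sub>F c in at_right 0. z 0 < (1 + c) powr (- m)"
      by (rule order_tendstoD(1)[OF l]) (use less1 in simp)
    moreover have "\<forall>\<^sub>F c in at_right (0::real). c > 0" by (rule eventually_at_right_less)
    ultimately have "\<forall>\<^sub>F c in at_right 0. c > 0 \<and> y 0 < (1 + c) powr (- \<gamma> / \<theta>) \<and> z 0 < (1 + c) powr (- m)"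
      by eventually_elim simp
    then show ?thesis using eventually_happens'[OF trivial_limit_at_right_real] by blast
  qed
  then obtain c where c: "c > 0" "y 0 < (1 + c) powr (- \<gamma> / \<theta>)" "z 0 < (1 + c) powr (- m)" by blast
  define X where "X = (\<lambda>t. c * exp (\<theta> * t))"
  define yb where "yb = (\<lambda>t. (1 + X t) powr (- \<gamma> / \<theta>))"
  define zb where "zb = (\<lambda>t. (1 + X t) powr (- m))"
  have X: "X t > 0" for t using c by (simp add: X_def)
  have dX: "(X has_real_derivative \<theta> * X t) (at t)" for t
    unfolding X_def by (auto intro!: derivative_eq_intros)
  have dpow: "((\<lambda>t. (1 + X t) powr w) has_real_derivative w * (1 + X t) powr (w - 1) * (\<theta> * X t)) (at t)" for w t
  proof -
    have "((\<lambda>t. 1 + X t) has_real_derivative \<theta> * X t) (at t)" using DERIV_add[OF DERIV_const[of 1] dX] by simp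
    then show ?thesis using X[of t] by (intro DERIV_chain2[OF has_real_derivative_powr]) auto
  qed
  have pm1: "(1 + X t) powr w = (1 + X t) powr (w - 1) * (1 + X t)" for w t
    using X[of t] powr_add[of "1 + X t" "w - 1" 1] by simp
  have "0 < exp (\<gamma> * t) * (yb t - y t) \<and> 0 < exp (\<kappa> * t) * (zb t - z t)" if t: "t \<ge> 0" for t
  proof (rule coupled_positivity[OF t])
    show "0 < exp (\<gamma> * 0) * (yb 0 - y 0)" "0 < exp (\<kappa> * 0) * (zb 0 - z 0)"
      using c by (auto simp: yb_def zb_def X_def)
    fix t :: real assume t: "0 \<le> t"
    have dyb: "(yb has_real_derivative (- \<gamma> / \<theta>) * (1 + X t) powr (- \<gamma> / \<theta> - 1) * (\<theta> * X t)) (at t)"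
      unfolding yb_def by (rule dpow)
    have e1: "\<gamma> * yb t + (- \<gamma> / \<theta>) * (1 + X t) powr (- \<gamma> / \<theta> - 1) * (\<theta> * X t) = \<gamma> * zb t powr \<alpha>"
    proof -
      have "zb t powr \<alpha> = (1 + X t) powr (- m * \<alpha>)" by (simp add: zb_def powr_powr)
      also have "- m * \<alpha> = - \<gamma> / \<theta> - 1" using th alpha by (simp add: m_def field_simps)
      finally have z: "zb t powr \<alpha> = (1 + X t) powr (- \<gamma> / \<theta> - 1)" .
      show ?thesis unfolding z yb_def pm1[of t "- \<gamma> / \<theta>"] using th by (simp add: algebra_simps)
    qed
    show "((\<lambda>t. exp (\<gamma> * t) * (yb t - y t)) has_real_derivative exp (\<gamma> * t) * (\<gamma> * (zb t powr \<alpha> - z t powr \<alpha>))) (at t)"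
    proof (rule DERIV_cong)
      show "((\<lambda>t. exp (\<gamma> * t) * (yb t - y t)) has_real_derivative
        exp (\<gamma> * t) * \<gamma> * (yb t - y t) + ((- \<gamma> / \<theta>) * (1 + X t) powr (- \<gamma> / \<theta> - 1) * (\<theta> * X t) - \<gamma> * (z t powr \<alpha> - y t)) * exp (\<gamma> * t)) (at t)"
        by (rule DERIV_mult, rule derivative_eq_intros refl)+ (auto intro!: derivative_eq_intros dyb dy[OF t])
      have "exp (\<gamma> * t) * \<gamma> * (yb t - y t) + (P - \<gamma> * (z t powr \<alpha> - y t)) * exp (\<gamma> * t)
        = exp (\<gamma> * t) * ((\<gamma> * yb t + P) - \<gamma> * z t powr \<alpha>)" for P by (simp add: algebra_simps)
      note eq = this
      show "exp (\<gamma> * t) * \<gamma> * (yb t - y t) + ((- \<gamma> / \<theta>) * (1 + X t) powr (- \<gamma> / \<theta> - 1) * (\<theta> * X t) - \<gamma> * (z t powr \<alpha> - y t)) * exp (\<gamma> * t)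
        = exp (\<gamma> * t) * (\<gamma> * (zb t powr \<alpha> - z t powr \<alpha>))"
        unfolding eq e1 by (simp add: algebra_simps)
    qed
    define P where "P = - m * (1 + X t) powr (- m - 1) * (\<theta> * X t)"
    have dzb: "(zb has_real_derivative P) (at t)"
      unfolding zb_def P_def by (rule dpow)
    show "((\<lambda>t. exp (\<kappa> * t) * (zb t - z t)) has_real_derivative exp (\<kappa> * t) * (\<kappa> * zb t + - m * (1 + X t) powr (- m - 1) * (\<theta> * X t) - \<kappa> * y t powr q)) (at t)"
      unfolding P_def[symmetric]
      by (auto intro!: derivative_eq_intros dzb dz[OF t] simp: algebra_simps)
    show "0 \<le> exp (\<gamma> * t) * (\<gamma> * (zb t powr \<alpha> - z t powr \<alpha>))" if "0 < exp (\<kappa> * t) * (zb t - z t)"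
    proof -
      have "z t \<le> zb t" using that by (simp add: zero_less_mult_iff)
      then have "z t powr \<alpha> \<le> zb t powr \<alpha>" using pos(2)[OF t] alpha by (intro powr_mono2) auto
      then show ?thesis using gamma by simp
    qed
    show "0 \<le> exp (\<kappa> * t) * (\<kappa> * zb t + - m * (1 + X t) powr (- m - 1) * (\<theta> * X t) - \<kappa> * y t powr q)" if "0 < exp (\<gamma> * t) * (yb t - y t)"
    proof -
      have "y t \<le> yb t" using that by (simp add: zero_less_mult_iff)
      then have "y t powr q \<le> yb t powr q" using pos(1)[OF t] q by (intro powr_mono2) auto
      also have "\<dots> = (1 + X t) powr (- (q * \<gamma> / \<theta>))" by (simp add: yb_def powr_powr mult.commute)
      also have "\<dots> \<le> (1 + X t) powr (- m - 1)" using X[of t] mq by (intro powr_mono) auto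
      finally have "\<kappa> * y t powr q \<le> \<kappa> * (1 + X t) powr (- m - 1)" using k0 by simp
      also have "\<dots> \<le> (1 + X t) powr (- m - 1) * (\<kappa> * (1 + X t) - m * \<theta> * X t)"
      proof -
        have "m * \<theta> = (\<gamma> + \<theta>) / \<alpha>" using th by (simp add: m_def)
        then have "m * \<theta> \<le> \<kappa>" using thA alpha by (simp add: pos_divide_le_eq)
        then have "m * \<theta> * X t \<le> \<kappa> * X t" using X[of t] by (intro mult_right_mono) auto
        then have "\<kappa> \<le> \<kappa> * (1 + X t) - m * \<theta> * X t" by (simp add: algebra_simps)
        then have "(1 + X t) powr (- m - 1) * \<kappa> \<le> (1 + X t) powr (- m - 1) * (\<kappa> * (1 + X t) - m * \<theta> * X t)"
          by (rule mult_left_mono) simp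
        then show ?thesis by (simp add: mult.commute)
      qed
      also have "\<dots> = \<kappa> * zb t + - m * (1 + X t) powr (- m - 1) * (\<theta> * X t)"
        unfolding zb_def pm1[of t "- m"] by (simp add: algebra_simps)
      finally show ?thesis by simp
    qed
  qed
  then have yyb: "y t < yb t" if "t \<ge> 0" for t using that by (simp add: zero_less_mult_iff)
  show ?thesis
  proof (rule that)
    fix t :: real assume t: "t \<ge> 0"
    have "yb t \<le> X t powr (- \<gamma> / \<theta>)" unfolding yb_def using X[of t] gamma th by (intro powr_mono2') auto
    also have "\<dots> = c powr (- \<gamma> / \<theta>) * exp (- \<gamma> * t)"
      unfolding X_def using c th by (simp add: powr_mult) (simp add: powr_def)
    finally have "y t \<le> c powr (- \<gamma> / \<theta>) * exp (- \<gamma> * t)" using yyb[OF t] by simp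
    then have "exp (\<gamma> * t) * y t \<le> exp (\<gamma> * t) * (c powr (- \<gamma> / \<theta>) * exp (- \<gamma> * t))" by (intro mult_left_mono) auto
    also have "\<dots> = c powr (- \<gamma> / \<theta>)" by (simp add: exp_minus)
    finally show "exp (\<gamma> * t) * y t \<le> c powr (- \<gamma> / \<theta>)" .
  qed
qed

text \<open>
  Backward in time both components stay between \<open>0\<close> and \<open>1\<close>, so the branch is global. The value \<open>exp (- \<gamma> t) y\<close>
  is decreasing in \<open>t\<close> and bounded by \<open>bounded_barrier\<close>.
\<close>
theorem connecting_branch:
  obtains y z W0 where "solves (-1) UNIV y z" "(y \<longlongrightarrow> 1) at_top" "W0 > 0"
    "((\<lambda>t. exp (- \<gamma> * t) * y t) \<longlongrightarrow> W0) at_bot"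
proof -
  have e: "(-1::real) \<in> {1, -1}" "(-1::real) \<in> {1, -1}" by auto
  obtain D h k where D: "D = UNIV \<or> (\<exists>T. D = {..<T} \<and> filterlim h at_top (at_left T))"
    and pos: "\<And>t. t \<in> D \<Longrightarrow> h t > 0" "\<And>t. t \<in> D \<Longrightarrow> k t > 0"
    and dh: "\<And>t. t \<in> D \<Longrightarrow> (h has_real_derivative -1 * \<gamma> * h t + \<gamma> * dev \<alpha> (- (-1) * - 1) (k t)) (at t)"
    and dk: "\<And>t. t \<in> D \<Longrightarrow> (k has_real_derivative -1 * \<kappa> * k t + \<kappa> * dev q (- 1) (h t)) (at t)"
    and lim: "(h \<longlongrightarrow> 0) at_bot" "(k \<longlongrightarrow> 0) at_bot"
    using equilibrium_branch[OF e] by blast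
  have down: "s \<in> D" if "t \<in> D" "s \<le> t" for s t using D that by auto
  have less: "h t < 1 \<and> k t < 1" if t: "t \<in> D" for t
  proof -
    have "\<forall>\<^sub>F t in at_bot. h t < 1" using lim(1) by (rule order_tendstoD) simp
    moreover have "\<forall>\<^sub>F t in at_bot. k t < 1" using lim(2) by (rule order_tendstoD) simp
    moreover have "\<forall>\<^sub>F s in at_bot. s \<le> t" by (rule eventually_le_at_bot)
    ultimately have "\<forall>\<^sub>F s in at_bot. h s < 1 \<and> k s < 1 \<and> s \<le> t" by eventually_elim simp
    then obtain s where s: "h s < 1" "k s < 1" "s \<le> t" using eventually_happens[of _ "at_bot::real filter"] by auto
    have "exp (\<gamma> * t) * (1 - h t) > 0 \<and> exp (\<kappa> * t) * (1 - k t) > 0"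
    proof (rule coupled_positivity[OF s(3)])
      show "exp (\<gamma> * s) * (1 - h s) > 0" "exp (\<kappa> * s) * (1 - k s) > 0" using s by auto
      fix r assume r: "s \<le> r" "r \<le> t"
      have rD: "r \<in> D" using down[OF t] r by simp
      show "((\<lambda>t. exp (\<gamma> * t) * (1 - h t)) has_real_derivative exp (\<gamma> * r) * (\<gamma> * spow \<alpha> (1 - k r))) (at r)"
        by (auto intro!: derivative_eq_intros dh[OF rD] simp: dev_def algebra_simps)
      show "((\<lambda>t. exp (\<kappa> * t) * (1 - k t)) has_real_derivative exp (\<kappa> * r) * (\<kappa> * spow q (1 - h r))) (at r)"
        by (auto intro!: derivative_eq_intros dk[OF rD] simp: dev_def algebra_simps)
      show "0 \<le> exp (\<gamma> * r) * (\<gamma> * spow \<alpha> (1 - k r))" if "exp (\<kappa> * r) * (1 - k r) > 0"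
        using that gamma by (simp add: zero_less_mult_iff spow_pos)
      show "0 \<le> exp (\<kappa> * r) * (\<kappa> * spow q (1 - h r))" if "exp (\<gamma> * r) * (1 - h r) > 0"
        using that kappa_pos by (simp add: zero_less_mult_iff spow_pos)
    qed
    then show ?thesis by (simp add: zero_less_mult_iff)
  qed
  have DU: "D = UNIV"
  proof (rule ccontr)
    assume "D \<noteq> UNIV"
    then obtain T where T: "D = {..<T}" "filterlim h at_top (at_left T)" using D by blast
    then have "\<forall>\<^sub>F t in at_left T. 1 \<le> h t" by (simp add: filterlim_at_top)
    moreover have "\<forall>\<^sub>F t in at_left T. t < T" by (simp add: eventually_at_filter)
    ultimately have "\<forall>\<^sub>F t in at_left T. 1 \<le> h t \<and> t < T" by eventually_elim simp
    then obtain t where "1 \<le> h t" "t < T" using eventually_happens'[OF trivial_limit_at_left_real] by blast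
    then show False using less[of t] T by simp
  qed
  define y where "y = (\<lambda>t. 1 + -1 * h (-1 * t))"
  define z where "z = (\<lambda>t. 1 - -1 * -1 * k (-1 * t))"
  have sol: "solves (-1) UNIV y z"
    unfolding y_def z_def
  proof (rule solves_branch[where D = D, OF e])
    fix t show "-1 * t \<in> D" "1 + -1 * h (-1 * t) > 0" using DU less[of "- t"] by auto
  qed (fact dh dk)+
  have z01: "0 < z t" "z t < 1" "y t < 1" for t using less[of "- t"] pos[of "- t"] DU by (auto simp: z_def y_def)
  obtain K where K: "\<And>t. t \<ge> 0 \<Longrightarrow> exp (\<gamma> * t) * y (- t) \<le> K"
  proof (rule bounded_barrier[of "\<lambda>t. y (- t)" "\<lambda>t. z (- t)"])
    fix t :: real
    show "y (- t) > 0" "z (- t) > 0" using solvesD(1)[OF sol] z01 by auto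
    have m: "((\<lambda>t. f (- t)) has_real_derivative d) (at t)" if "(f has_real_derivative - d) (at (- t))" for f :: "real \<Rightarrow> real" and d
      using that DERIV_mirror[of f "- d" t] by simp
    show "((\<lambda>t. y (- t)) has_real_derivative \<gamma> * (z (- t) powr \<alpha> - y (- t))) (at t)"
      by (rule m, rule DERIV_cong[OF solvesD(2)[OF sol]]) (use z01 in \<open>auto simp: spow_pos algebra_simps\<close>)
    show "((\<lambda>t. z (- t)) has_real_derivative \<kappa> * (y (- t) powr q - z (- t))) (at t)"
      by (rule m, rule DERIV_cong[OF solvesD(3)[OF sol]]) (auto simp: algebra_simps)
  qed (use z01 in auto)
  define W where "W = (\<lambda>t. exp (- \<gamma> * t) * y t)"
  have Wpos: "W t > 0" for t using solvesD(1)[OF sol] by (simp add: W_def)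
  have "W t \<le> W s" if "s \<le> t" for s t
  proof (rule DERIV_nonpos_imp_nonincreasing[OF that])
    fix x
    have "- \<gamma> * exp (- \<gamma> * x) * spow \<alpha> (z x) \<le> 0" using gamma z01[of x] by (simp add: spow_pos)
    then show "\<exists>d. (W has_real_derivative d) (at x) \<and> d \<le> 0"
      unfolding W_def using value_deriv[OF sol, of x] by blast
  qed
  moreover have "W t \<le> K" if "t \<le> 0" for t using K[of "- t"] that by (simp add: W_def)
  ultimately obtain W0 where W0: "(W \<longlongrightarrow> W0) at_bot" "\<And>t. t \<le> 0 \<Longrightarrow> W t \<le> W0"
    using antimono_bounded_at_bot[of 0 W K] by blast
  show thesis
  proof (rule that[OF sol])
    have "((\<lambda>t. 1 + -1 * h (-1 * t)) \<longlongrightarrow> 1 + -1 * 0) at_top"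
      using lim(1) unfolding filterlim_at_bot_mirror by (intro tendsto_intros) simp
    then show "(y \<longlongrightarrow> 1) at_top" by (simp add: y_def)
    show "W0 > 0" using W0(2)[of 0] Wpos[of 0] by simp
    show "((\<lambda>t. exp (- \<gamma> * t) * y t) \<longlongrightarrow> W0) at_bot" using W0(1) by (simp add: W_def)
  qed
qed

end

section \<open>The radial equation in logarithmic variables\<close>

lemma filterlim_shift_at_bot: "filterlim (\<lambda>t::real. t + c) at_bot at_bot"
  unfolding filterlim_at_bot eventually_at_bot_linorder
  by (metis add.commute add_le_cancel_left diff_add_cancel)

lemma filterlim_ln_at_left: "filterlim ln (at_left (t0::real)) (at_left (exp t0))"
proof -
  have "isCont ln (exp t0)" by (rule DERIV_isCont[OF DERIV_ln]) simp
  then have "(ln \<longlongrightarrow> ln (exp t0)) (at_left (exp t0))"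
    by (rule tendsto_within_subset[OF isContD subset_UNIV])
  then have l: "(ln \<longlongrightarrow> t0) (at_left (exp t0))" by simp
  have "\<forall>\<^sub>F r in at_left (exp t0). r \<in> {0<..<exp t0}"
    by (rule eventually_at_leftI[of 0]) auto
  then have "\<forall>\<^sub>F r in at_left (exp t0). ln r \<in> {..<t0} \<and> ln r \<noteq> t0"
  proof eventually_elim
    case (elim r)
    then have "ln r < ln (exp t0)" by (subst ln_less_cancel_iff) auto
    then show ?case by simp
  qed
  with l show ?thesis by (simp add: filterlim_at)
qed

lemma filterlim_ln_at_right: "filterlim ln (at_right (t0::real)) (at_right (exp t0))"
proof -
  have "isCont ln (exp t0)" by (rule DERIV_isCont[OF DERIV_ln]) simp
  then have "(ln \<longlongrightarrow> ln (exp t0)) (at_right (exp t0))"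
    by (rule tendsto_within_subset[OF isContD subset_UNIV])
  then have l: "(ln \<longlongrightarrow> t0) (at_right (exp t0))" by simp
  have "\<forall>\<^sub>F r in at_right (exp t0). r > exp t0" by (rule eventually_at_right_less)
  then have "\<forall>\<^sub>F r in at_right (exp t0). ln r \<in> {t0<..} \<and> ln r \<noteq> t0"
  proof eventually_elim
    case (elim r)
    then have "ln (exp t0) < ln r" using exp_gt_zero[of t0] by (subst ln_less_cancel_iff) (auto simp del: exp_gt_zero)
    then show ?case by simp
  qed
  with l show ?thesis by (simp add: filterlim_at)
qed

lemma spow_one: "spow 1 x = x"
  by (simp add: spow_def mult.commute abs_mult_sgn sgn_if)

lemma filterlim_shift_at_left: "filterlim (\<lambda>t. t + c) (at_left (0::real)) (at_left (- c))"
proof -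
  have "((\<lambda>t. t + c) \<longlongrightarrow> - c + c) (at_left (- c))" by (intro tendsto_intros)
  moreover have "\<forall>\<^sub>F t in at_left (- c). t < - c" by (simp add: eventually_at_filter)
  then have "\<forall>\<^sub>F t in at_left (- c). t + c \<in> {..<0} \<and> t + c \<noteq> 0" by eventually_elim auto
  ultimately show ?thesis by (simp add: filterlim_at)
qed

lemma eventually_at_left_pos: "r0 > 0 \<Longrightarrow> \<forall>\<^sub>F r in at_left (r0::real). 0 < r \<and> r < r0"
  using eventually_at_leftI[of 0 r0 "\<lambda>r. 0 < r \<and> r < r0"] by auto

lemma eventually_at_right_0: "r0 > 0 \<Longrightarrow> \<forall>\<^sub>F r in at_right (0::real). 0 < r \<and> r < r0"
  using eventually_at_rightI[of 0 r0 "\<lambda>r. 0 < r \<and> r < r0"] by auto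

lemma mult_reassoc: "P * (- (g * Q) * S) = - g * ((P * Q) * (S::real))"
  by simp

lemma less_exp_imp_ln_less: "0 < r \<Longrightarrow> r < exp t \<Longrightarrow> ln r < (t::real)"
  by (metis exp_gt_zero ln_exp ln_less_cancel_iff)

lemma exp_less_imp_less_ln: "exp t < r \<Longrightarrow> t < ln (r::real)"
  by (metis exp_gt_zero ln_exp ln_less_cancel_iff less_trans)

locale weighted_p_laplace =
  fixes N p q \<sigma> :: real
  assumes qp: "q > p - 1" and p1: "p - 1 > 0" and ps: "p > - \<sigma>" and sN: "- \<sigma> > N"
begin

abbreviation "\<gamma> \<equiv> gam p q \<sigma>"
abbreviation "\<kappa> \<equiv> (p - 1) * gam p q \<sigma> + p - N"
abbreviation "\<alpha> \<equiv> 1 / (p - 1)"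
abbreviation "a \<equiv> astar N p q \<sigma>"

lemma gam_eq: "\<gamma> * (q + 1 - p) = p + \<sigma>"
  using qp by (simp add: gam_def)

lemma gam_pos: "\<gamma> > 0" using qp ps by (simp add: gam_def)

sublocale emden_fowler \<gamma> \<kappa> \<alpha> q
proof
  show "\<gamma> > 0" by (rule gam_pos)
  show "\<alpha> > 0" "q > 0" using p1 qp by auto
  show "\<alpha> * q > 1" using p1 qp by simp
  have "\<kappa> - \<gamma> * q = p - N - \<gamma> * (q + 1 - p)" by (simp add: algebra_simps)
  then show "\<gamma> * q < \<kappa>" using gam_eq sN by simp
qed

lemma astar: "a > 0" "a powr (q - p + 1) = \<gamma> powr (p - 1) * \<kappa>"
proof -
  have "\<exists>!a. a > 0 \<and> a powr (q - p + 1) =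
       (-1) * \<bar>\<gamma>\<bar> powr (p - 2) * \<gamma> * (N - p - (p - 1) * \<gamma>)"
    by (rule astar_well_defined[OF qp p1 ps sN])
  from theI'[OF this] have a: "a > 0 \<and> a powr (q - p + 1) = (-1) * \<bar>\<gamma>\<bar> powr (p - 2) * \<gamma> * (N - p - (p - 1) * \<gamma>)"
    unfolding astar_def .
  have "\<gamma> powr (p - 1) = \<gamma> powr (p - 2) * \<gamma>" using gam_pos powr_add[of \<gamma> "p - 2" 1] by simp
  then show "a > 0" "a powr (q - p + 1) = \<gamma> powr (p - 1) * \<kappa>" using a gam_pos by (auto simp: algebra_simps)
qed

text \<open>
  The flux of \<open>w\<^sup>*\<close> is a multiple of \<open>r powr (- m)\<close>.
\<close>
abbreviation "m \<equiv> (\<gamma> + 1) * (p - 1)"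

lemma m_eq: "m + 1 + \<sigma> = \<gamma> * q" using gam_eq by (simp add: algebra_simps)
lemma m_kappa: "m - (N - 1) = \<kappa>" by (simp add: algebra_simps)
lemma alpha_m: "\<alpha> * m = \<gamma> + 1" using p1 by simp

lemma astar_q: "(\<gamma> * a) powr (p - 1) * \<kappa> = a powr q"
proof -
  have "a powr q = a powr (p - 1) * a powr (q - p + 1)" using powr_add[of a "p - 1" "q - p + 1"] by simp
  then show ?thesis unfolding astar(2) using astar(1) gam_pos by (simp add: powr_mult)
qed

text \<open>
  The normalization by \<open>a\<close> moves the equilibrium to \<open>(1, 1)\<close>; the profile of the constant \<open>1\<close> is \<open>w\<^sup>*\<close>.
\<close>
definition profile :: "(real \<Rightarrow> real) \<Rightarrow> real \<Rightarrow> real" where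
  "profile y r = a * r powr (- \<gamma>) * y (ln r)"

lemma profile_solution:
  assumes sol: "solves \<epsilon> J y z" and I: "open I" "\<And>r. r \<in> I \<Longrightarrow> r > 0" "\<And>r. r \<in> I \<Longrightarrow> ln r \<in> J"
  shows "positive_solution N p q \<sigma> \<epsilon> I (profile y)"
    and "\<And>r. r \<in> I \<Longrightarrow> deriv (profile y) r = - (\<gamma> * a * r powr (- \<gamma> - 1)) * spow \<alpha> (z (ln r))"
proof -
  have dw: "(profile y has_real_derivative - (\<gamma> * a * r powr (- \<gamma> - 1)) * spow \<alpha> (z (ln r))) (at r)" if r: "r \<in> I" for r
  proof -
    note r0 = I(2)[OF r]
    have dy: "((\<lambda>r. y (ln r)) has_real_derivative \<gamma> * (y (ln r) - spow \<alpha> (z (ln r))) * inverse r) (at r)"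
      by (rule DERIV_chain2[OF solvesD(2)[OF sol I(3)[OF r]] DERIV_ln[OF r0]])
    have rr: "r powr (- \<gamma>) * inverse r = r powr (- \<gamma> - 1)" using r0 powr_diff[of r "- \<gamma>" 1] by (simp add: divide_inverse)
    have "(profile y has_real_derivative a * (- \<gamma> * r powr (- \<gamma> - 1)) * y (ln r)
        + \<gamma> * (y (ln r) - spow \<alpha> (z (ln r))) * inverse r * (a * r powr (- \<gamma>))) (at r)"
      unfolding profile_def[abs_def]
      by (intro DERIV_mult dy DERIV_cmult has_real_derivative_powr r0)
    moreover have "a * (- \<gamma> * r powr (- \<gamma> - 1)) * y (ln r)
        + \<gamma> * (y (ln r) - spow \<alpha> (z (ln r))) * inverse r * (a * r powr (- \<gamma>))
        = - (\<gamma> * a * (r powr (- \<gamma>) * inverse r)) * spow \<alpha> (z (ln r))"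
      unfolding rr[symmetric] by (simp add: algebra_simps)
    ultimately show ?thesis unfolding rr by (simp only:)
  qed
  show dw': "deriv (profile y) r = - (\<gamma> * a * r powr (- \<gamma> - 1)) * spow \<alpha> (z (ln r))" if "r \<in> I" for r
    by (rule DERIV_imp_deriv[OF dw[OF that]])
  define K where "K = (\<gamma> * a) powr (p - 1)"
  have fl: "flux p (deriv (profile y) r) = - K * r powr (- m) * z (ln r)" if r: "r \<in> I" for r
  proof -
    have "flux p (deriv (profile y) r) = spow (p - 1) (- (\<gamma> * a * r powr (- \<gamma> - 1) * spow \<alpha> (z (ln r))))"
      unfolding flux_spow dw'[OF r] by simp
    also have "\<dots> = - ((\<gamma> * a * r powr (- \<gamma> - 1)) powr (p - 1) * spow (p - 1) (spow \<alpha> (z (ln r))))"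
      using gam_pos astar(1) I(2)[OF r] by (subst spow_minus, subst spow_mult) auto
    also have "spow (p - 1) (spow \<alpha> (z (ln r))) = z (ln r)"
      using p1 by (simp add: spow_spow spow_one)
    also have "(\<gamma> * a * r powr (- \<gamma> - 1)) powr (p - 1) = K * r powr (- m)"
      unfolding K_def using gam_pos astar(1) I(2)[OF r] by (subst powr_mult) (auto simp: powr_powr algebra_simps)
    finally show ?thesis by simp
  qed
  have dfl: "((\<lambda>s. flux p (deriv (profile y) s)) has_real_derivative
      - K * r powr (- m - 1) * (\<kappa> * (z (ln r) + \<epsilon> * y (ln r) powr q) - m * z (ln r))) (at r)" if r: "r \<in> I" for r
  proof -
    note r0 = I(2)[OF r]
    have dz: "((\<lambda>r. z (ln r)) has_real_derivative \<kappa> * (z (ln r) + \<epsilon> * y (ln r) powr q) * inverse r) (at r)"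
      by (rule DERIV_chain2[OF solvesD(3)[OF sol I(3)[OF r]] DERIV_ln[OF r0]])
    have rr: "r powr (- m) * inverse r = r powr (- m - 1)" using r0 powr_diff[of r "- m" 1] by (simp add: divide_inverse)
    have "((\<lambda>r. - K * r powr (- m) * z (ln r)) has_real_derivative - K * (- m * r powr (- m - 1)) * z (ln r)
        + \<kappa> * (z (ln r) + \<epsilon> * y (ln r) powr q) * inverse r * (- K * r powr (- m))) (at r)"
      by (intro DERIV_mult dz DERIV_cmult has_real_derivative_powr r0)
    moreover have "- K * (- m * r powr (- m - 1)) * z (ln r)
        + Z * inverse r * (- K * r powr (- m)) = - K * r powr (- m - 1) * (Z - m * z (ln r))" for Z
      unfolding rr[symmetric] by (simp add: algebra_simps)
    ultimately have "((\<lambda>r. - K * r powr (- m) * z (ln r)) has_real_derivative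
        - K * r powr (- m - 1) * (\<kappa> * (z (ln r) + \<epsilon> * y (ln r) powr q) - m * z (ln r))) (at r)"
      by (simp only:)
    then show ?thesis
      by (rule has_field_derivative_transform_within_open[OF _ I(1) r]) (simp add: fl)
  qed
  show "positive_solution N p q \<sigma> \<epsilon> I (profile y)"
    unfolding positive_solution_def
  proof (intro ballI conjI)
    fix r assume r: "r \<in> I"
    note r0 = I(2)[OF r]
    note y0 = solvesD(1)[OF sol I(3)[OF r]]
    show "profile y r > 0" using astar(1) r0 y0 by (simp add: profile_def)
    show "profile y differentiable at r" using dw[OF r] by (auto simp: real_differentiable_def)
    show "(\<lambda>s. flux p (deriv (profile y) s)) differentiable at r" using dfl[OF r] by (auto simp: real_differentiable_def)
    have rr: "r powr (- m) / r = r powr (- m - 1)" using r0 powr_diff[of r "- m" 1] by simp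
    have "- deriv (\<lambda>s. flux p (deriv (profile y) s)) r - (N - 1) / r * flux p (deriv (profile y) r)
        = K * r powr (- m - 1) * (\<kappa> * (z (ln r) + \<epsilon> * y (ln r) powr q) - m * z (ln r))
          + (N - 1) * K * (r powr (- m) / r) * z (ln r)"
      unfolding DERIV_imp_deriv[OF dfl[OF r]] fl[OF r] by simp
    also have "\<dots> = K * r powr (- m - 1) * (\<kappa> * (z (ln r) + \<epsilon> * y (ln r) powr q) - (m - (N - 1)) * z (ln r))"
      unfolding rr by (simp add: algebra_simps)
    also have "\<dots> = \<epsilon> * (K * \<kappa>) * (r powr (- m - 1) * y (ln r) powr q)"
      unfolding m_kappa by (simp add: algebra_simps)
    also have "K * \<kappa> = a powr q" unfolding K_def by (rule astar_q)
    also have "- m - 1 = \<sigma> + - \<gamma> * q" using m_eq by simp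
    also have "\<epsilon> * a powr q * (r powr (\<sigma> + - \<gamma> * q) * y (ln r) powr q) = \<epsilon> * r powr \<sigma> * profile y r powr q"
      unfolding profile_def powr_add using astar(1) r0 y0 by (simp add: powr_mult powr_powr)
    finally show "- deriv (\<lambda>s. flux p (deriv (profile y) s)) r - (N - 1) / r * flux p (deriv (profile y) r)
        = \<epsilon> * r powr \<sigma> * profile y r powr q" .
  qed
qed

text \<open>
  The converse transformation is needed only to show that certain solutions do not exist.
\<close>
lemma solves_of_solution:
  assumes sol: "positive_solution N p q \<sigma> \<epsilon> I v" and I: "open I"
  shows "solves \<epsilon> {t. exp t \<in> I} (\<lambda>t. exp (\<gamma> * t) * v (exp t) / a)
    (\<lambda>t. - (exp (m * t) * flux p (deriv v (exp t)) / (\<gamma> * a) powr (p - 1)))"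
  unfolding solves_def
proof (intro ballI conjI)
  fix t assume "t \<in> {t. exp t \<in> I}"
  then have t: "exp t \<in> I" by simp
  define r where "r = exp t"
  define v' where "v' = deriv v r"
  define f where "f = (\<lambda>s. flux p (deriv v s))"
  define K where "K = (\<gamma> * a) powr (p - 1)"
  have K: "K > 0" unfolding K_def using gam_pos astar(1) by simp
  have v: "v r > 0" "v differentiable at r" "f differentiable at r"
    and eq: "- deriv f r - (N - 1) / r * f r = \<epsilon> * r powr \<sigma> * v r powr q"
    using sol t by (auto simp: positive_solution_def r_def f_def)
  have dv: "(v has_real_derivative v') (at r)" unfolding v'_def using v(2) by (simp add: DERIV_deriv_iff_real_differentiable)
  have df: "(f has_real_derivative deriv f r) (at r)" using v(3) by (simp add: DERIV_deriv_iff_real_differentiable)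
  have dv2: "((\<lambda>t. v (exp t)) has_real_derivative v' * exp t) (at t)"
    by (rule DERIV_chain2[OF dv[unfolded r_def] DERIV_exp])
  have df2: "((\<lambda>t. f (exp t)) has_real_derivative deriv f r * exp t) (at t)"
    using DERIV_chain2[OF df[unfolded r_def] DERIV_exp] by (simp add: r_def)
  show "0 < exp (\<gamma> * t) * v (exp t) / a" using v(1) astar(1) by (simp add: r_def)
  have z: "spow \<alpha> (- (exp (m * t) * flux p (deriv v (exp t)) / (\<gamma> * a) powr (p - 1))) = - (exp ((\<gamma> + 1) * t) * v' / (\<gamma> * a))"
  proof -
    have c: "0 < exp (m * t) * inverse K" using K by simp
    have "(exp (m * t) * inverse K) powr \<alpha> = exp (\<alpha> * m * t) * (inverse K) powr \<alpha>"
      using K by (subst powr_mult) (auto simp: powr_def)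
    also have "(inverse K) powr \<alpha> = inverse (\<gamma> * a)"
      unfolding K_def using gam_pos astar(1) p1 by (simp add: powr_powr inverse_powr[symmetric] powr_minus[symmetric] powr_minus)
    finally have cp: "(exp (m * t) * inverse K) powr \<alpha> = exp ((\<gamma> + 1) * t) * inverse (\<gamma> * a)" unfolding alpha_m .
    have "spow \<alpha> (flux p (deriv v (exp t))) = v'"
      unfolding flux_spow spow_spow using p1 by (simp add: spow_one v'_def r_def)
    then have "spow \<alpha> ((exp (m * t) * inverse K) * flux p (deriv v (exp t))) = exp ((\<gamma> + 1) * t) * inverse (\<gamma> * a) * v'"
      unfolding spow_mult[OF c] cp by simp
    then show ?thesis unfolding spow_minus K_def by (simp add: divide_inverse mult_ac)
  qed
  have e1: "exp ((\<gamma> + 1) * t) = exp (\<gamma> * t) * exp t" by (simp add: algebra_simps flip: exp_add)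
  have "((\<lambda>t. exp (\<gamma> * t) * v (exp t) / a) has_real_derivative
      (exp (\<gamma> * t) * \<gamma> * v (exp t) + v' * exp t * exp (\<gamma> * t)) / a) (at t)"
    by (intro DERIV_cdivide DERIV_mult dv2) (auto intro!: derivative_eq_intros)
  then show "((\<lambda>t. exp (\<gamma> * t) * v (exp t) / a) has_real_derivative
      \<gamma> * (exp (\<gamma> * t) * v (exp t) / a - spow \<alpha> (- (exp (m * t) * flux p (deriv v (exp t)) / (\<gamma> * a) powr (p - 1))))) (at t)"
    unfolding z e1 by (rule DERIV_cong) (use gam_pos astar(1) in \<open>simp add: field_simps\<close>)
  have "deriv f r * r = - (N - 1) * f r - \<epsilon> * (r * r powr \<sigma>) * v r powr q"
  proof -
    have "r > 0" by (simp add: r_def)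
    then show ?thesis using eq by (simp add: field_simps)
  qed
  moreover have "r * r powr \<sigma> = exp ((1 + \<sigma>) * t)" by (simp add: r_def powr_def algebra_simps flip: exp_add)
  ultimately have dfr: "deriv f r * exp t = - (N - 1) * f r - \<epsilon> * exp ((1 + \<sigma>) * t) * v r powr q"
    by (simp add: r_def)
  have yq: "\<kappa> * (exp (\<gamma> * t) * v (exp t) / a) powr q = exp (m * t) * exp ((1 + \<sigma>) * t) * v r powr q / K"
  proof -
    have "(exp (\<gamma> * t) * v (exp t) / a) powr q = exp (\<gamma> * q * t) * v r powr q / a powr q"
      using v(1) astar(1) by (simp add: powr_divide powr_mult r_def) (simp add: powr_def mult_ac)
    moreover have "exp (\<gamma> * q * t) = exp (m * t) * exp ((1 + \<sigma>) * t)"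
      unfolding m_eq[symmetric] by (simp add: algebra_simps flip: exp_add)
    moreover have "a powr q = K * \<kappa>" unfolding K_def astar_q ..
    ultimately show ?thesis using kappa_pos K by simp
  qed
  have "((\<lambda>t. - (exp (m * t) * f (exp t) / K)) has_real_derivative
      - ((exp (m * t) * m * f (exp t) + deriv f r * exp t * exp (m * t)) / K)) (at t)"
    by (intro DERIV_minus DERIV_cdivide DERIV_mult df2) (auto intro!: derivative_eq_intros)
  moreover have "- ((exp (m * t) * m * f (exp t) + deriv f r * exp t * exp (m * t)) / K)
     = \<kappa> * (- (exp (m * t) * f (exp t) / K) + \<epsilon> * (exp (\<gamma> * t) * v (exp t) / a) powr q)"
  proof -
    have "- ((exp (m * t) * m * f (exp t) + deriv f r * exp t * exp (m * t)) / K)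
      = - ((m - (N - 1)) * (exp (m * t) * f (exp t) / K)) + \<epsilon> * (exp (m * t) * exp ((1 + \<sigma>) * t) * v r powr q / K)"
      unfolding dfr by (simp add: r_def algebra_simps add_divide_distrib diff_divide_distrib)
    also have "\<dots> = \<kappa> * - (exp (m * t) * f (exp t) / K) + \<epsilon> * (\<kappa> * (exp (\<gamma> * t) * v (exp t) / a) powr q)"
      unfolding m_kappa yq by simp
    finally show ?thesis by (simp only: distrib_left mult.left_commute)
  qed
  ultimately show "((\<lambda>t. - (exp (m * t) * flux p (deriv v (exp t)) / (\<gamma> * a) powr (p - 1))) has_real_derivative
      \<kappa> * (- (exp (m * t) * flux p (deriv v (exp t)) / (\<gamma> * a) powr (p - 1)) + \<epsilon> * (exp (\<gamma> * t) * v (exp t) / a) powr q)) (at t)"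
    unfolding f_def K_def by (simp only:)
qed

lemma profile_exp: "r > 0 \<Longrightarrow> profile y r = a * (exp (- \<gamma> * ln r) * y (ln r))"
  by (simp add: profile_def powr_def)

lemma profile_asymp:
  assumes y: "(y \<longlongrightarrow> 1) G" and l: "filterlim ln G F" and pos: "\<forall>\<^sub>F r in F. r > 0"
  shows "profile y \<sim>[F] wstar N p q \<sigma>"
proof (rule asymp_equivI')
  have "((\<lambda>r. y (ln r)) \<longlongrightarrow> 1) F" by (rule filterlim_compose[OF y l])
  then show "((\<lambda>r. profile y r / wstar N p q \<sigma> r) \<longlongrightarrow> 1) F"
    by (rule Lim_transform_eventually) (use pos in eventually_elim, use astar(1) in \<open>simp add: profile_def wstar_def\<close>)
qed

lemma wstar_solution: "positive_solution N p q \<sigma> (-1) {0<..} (wstar N p q \<sigma>)"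
proof -
  have "profile (\<lambda>_. 1) = wstar N p q \<sigma>" by (simp add: fun_eq_iff profile_def wstar_def)
  then show ?thesis using profile_solution(1)[OF solves_equilibrium, of "{0<..}"] by simp
qed

text \<open>
  The translation \<open>c\<close> adjusts the limit of the value to \<open>w0\<close>.
\<close>
lemma bounded_profile:
  assumes sol: "solves \<epsilon> J y z" and J: "{..<t1} \<subseteq> J" and \<epsilon>: "\<epsilon> \<in> {1, -1}"
    and W: "((\<lambda>t. exp (- \<gamma> * t) * y t) \<longlongrightarrow> W0) at_bot" "W0 > 0" and w0: "w0 > 0"
  obtains c D where "D > 0" "solves \<epsilon> {t. t + c \<in> J} (\<lambda>t. y (t + c)) (\<lambda>t. z (t + c))"
    "(profile (\<lambda>t. y (t + c)) \<longlongrightarrow> w0) (at_right 0)"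
    "((\<lambda>r. r powr (- ((\<sigma> + 1) / (p - 1))) * deriv (profile (\<lambda>t. y (t + c))) r) \<longlongrightarrow> \<epsilon> * D) (at_right 0)"
proof -
  define c where "c = ln (w0 / (a * W0)) / \<gamma>"
  have ec: "exp (\<gamma> * c) = w0 / (a * W0)" using gam_pos w0 W(2) astar(1) by (simp add: c_def)
  define yc where "yc = (\<lambda>t. y (t + c))"
  define zc where "zc = (\<lambda>t. z (t + c))"
  have solc: "solves \<epsilon> {t. t + c \<in> J} yc zc" unfolding yc_def zc_def by (rule solves_shift[OF sol])
  have solc1: "solves \<epsilon> {..<t1 - c} yc zc" by (rule solves_subset[OF solc]) (use J in auto)
  have "((\<lambda>t. exp (\<gamma> * c) * (exp (- \<gamma> * (t + c)) * y (t + c))) \<longlongrightarrow> exp (\<gamma> * c) * W0) at_bot"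
    by (intro tendsto_mult tendsto_const filterlim_compose[OF W(1) filterlim_shift_at_bot])
  moreover have "exp (\<gamma> * c) * (exp (- \<gamma> * (t + c)) * y (t + c)) = exp (- \<gamma> * t) * yc t" for t
    unfolding exp_assoc yc_def by (simp add: algebra_simps)
  ultimately have Wc: "((\<lambda>t. exp (- \<gamma> * t) * yc t) \<longlongrightarrow> exp (\<gamma> * c) * W0) at_bot" by (simp only:)
  define W1 where "W1 = exp (\<gamma> * c) * W0"
  have W1: "W1 > 0" "a * W1 = w0" using W(2) ec astar(1) w0 by (auto simp: W1_def)
  have ev: "\<forall>\<^sub>F r in at_right 0. 0 < r \<and> r < exp (t1 - c)" by (rule eventually_at_right_0) simp
  have lim1: "(profile yc \<longlongrightarrow> w0) (at_right 0)"
  proof (rule Lim_transform_eventually)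
    show "((\<lambda>r. a * (exp (- \<gamma> * ln r) * yc (ln r))) \<longlongrightarrow> w0) (at_right 0)"
      unfolding W1(2)[symmetric]
      by (intro tendsto_mult tendsto_const) (rule filterlim_compose[OF Wc[folded W1_def] ln_at_0])
    show "\<forall>\<^sub>F r in at_right 0. a * (exp (- \<gamma> * ln r) * yc (ln r)) = profile yc r"
      using ev by eventually_elim (simp add: profile_exp)
  qed
  define P where "P = \<kappa> / (\<kappa> - \<gamma> * q) * W1 powr q"
  have P: "P > 0" unfolding P_def using kappa_pos B_pos W1 by (intro mult_pos_pos divide_pos_pos) auto
  have fl: "((\<lambda>t. exp (- (\<gamma> * q) * t) * zc t) \<longlongrightarrow> - (\<epsilon> * P)) at_bot"
    using flux_limit_of_bounded[OF solc1 Wc[folded W1_def] W1(1)] unfolding P_def by (simp only: mult.assoc)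
  have sp: "spow \<alpha> (- (\<epsilon> * P)) = - (\<epsilon> * P powr \<alpha>)" using \<epsilon> P by (auto simp: spow_minus spow_pos)
  have lim2: "((\<lambda>r. r powr (- ((\<sigma> + 1) / (p - 1))) * deriv (profile yc) r) \<longlongrightarrow> \<epsilon> * (\<gamma> * a * P powr \<alpha>)) (at_right 0)"
  proof (rule Lim_transform_eventually)
    have "((\<lambda>r. - (\<gamma> * a) * spow \<alpha> (exp (- (\<gamma> * q) * ln r) * zc (ln r))) \<longlongrightarrow> - (\<gamma> * a) * spow \<alpha> (- (\<epsilon> * P))) (at_right 0)"
      by (intro tendsto_mult tendsto_const isCont_tendsto_compose[OF isCont_spow[OF alpha]])
        (rule filterlim_compose[OF fl ln_at_0])
    moreover have "- (\<gamma> * a) * spow \<alpha> (- (\<epsilon> * P)) = \<epsilon> * (\<gamma> * a * P powr \<alpha>)" unfolding sp by simp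
    ultimately show "((\<lambda>r. - (\<gamma> * a) * spow \<alpha> (exp (- (\<gamma> * q) * ln r) * zc (ln r))) \<longlongrightarrow> \<epsilon> * (\<gamma> * a * P powr \<alpha>)) (at_right 0)"
      by (simp only:)
    show "\<forall>\<^sub>F r in at_right 0. - (\<gamma> * a) * spow \<alpha> (exp (- (\<gamma> * q) * ln r) * zc (ln r))
        = r powr (- ((\<sigma> + 1) / (p - 1))) * deriv (profile yc) r"
      using ev
    proof eventually_elim
      case (elim r)
      have lr: "ln r \<in> {..<t1 - c}" using elim by (metis exp_gt_zero lessThan_iff ln_exp ln_less_cancel_iff)
      have d: "deriv (profile yc) r = - (\<gamma> * a * r powr (- \<gamma> - 1)) * spow \<alpha> (zc (ln r))"
        by (rule profile_solution(2)[OF solc1, of "{0<..<exp (t1 - c)}"])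
          (use elim in \<open>auto, metis exp_gt_zero ln_exp ln_less_cancel_iff\<close>)
      have "\<alpha> * (\<gamma> * q) = \<alpha> * m + \<alpha> * (1 + \<sigma>)" unfolding m_eq[symmetric] by (simp only: distrib_left add.assoc)
      then have ex: "\<alpha> * (\<gamma> * q) = (\<sigma> + 1) / (p - 1) + (\<gamma> + 1)" unfolding alpha_m by (simp add: algebra_simps)
      have e: "r powr (- ((\<sigma> + 1) / (p - 1))) * r powr (- \<gamma> - 1) = exp (\<alpha> * (- (\<gamma> * q) * ln r))"
      proof -
        have "- ((\<sigma> + 1) / (p - 1)) + (- \<gamma> - 1) = - (\<alpha> * (\<gamma> * q))" using ex by linarith
        then have "r powr (- ((\<sigma> + 1) / (p - 1))) * r powr (- \<gamma> - 1) = r powr (- (\<alpha> * (\<gamma> * q)))"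
          by (simp only: powr_add[symmetric])
        then show ?thesis using elim by (simp add: powr_def)
      qed
      have "r powr (- ((\<sigma> + 1) / (p - 1))) * deriv (profile yc) r
          = - (\<gamma> * a) * (exp (\<alpha> * (- (\<gamma> * q) * ln r)) * spow \<alpha> (zc (ln r)))"
        unfolding d mult_reassoc e ..
      then show ?case unfolding spow_exp by (rule sym)
    qed
  qed
  show thesis
    by (rule that[of "\<gamma> * a * P powr \<alpha>" c]) (use gam_pos astar(1) P solc lim1 lim2 in \<open>auto simp: yc_def zc_def\<close>)
qed

text \<open>
  The translation \<open>c\<close> multiplies the limit of \<open>r powr ((N - p) / (p - 1)) * w\<close> by \<open>exp (\<kappa> \<alpha> c)\<close>.
\<close>
lemma increasing_profile:
  assumes sol: "solves \<epsilon> {..<0} y z"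
    and W: "((\<lambda>t. exp (- \<gamma> * t) * y t) \<longlongrightarrow> 0) at_bot"
    and V: "((\<lambda>t. exp (- \<kappa> * t) * z t) \<longlongrightarrow> - V0) at_bot" "V0 > 0" and k: "k > 0"
  obtains c d where "d > 0" "solves \<epsilon> {..< - c} (\<lambda>t. y (t + c)) (\<lambda>t. z (t + c))"
    "(profile (\<lambda>t. y (t + c)) \<longlongrightarrow> 0) (at_right 0)"
    "((\<lambda>r. r powr ((N - p) / (p - 1)) * profile (\<lambda>t. y (t + c)) r) \<longlongrightarrow> k) (at_right 0)"
    "((\<lambda>r. r powr ((N - 1) / (p - 1)) * deriv (profile (\<lambda>t. y (t + c))) r) \<longlongrightarrow> d) (at_right 0)"
proof -
  define k0 where "k0 = a * (\<gamma> * V0 powr \<alpha> / (\<kappa> * \<alpha> - \<gamma>))"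
  have k0: "k0 > 0" unfolding k0_def using astar(1) gam_pos V(2) A_pos by (intro mult_pos_pos divide_pos_pos) auto
  have ka: "\<kappa> * \<alpha> > 0" using kappa_pos alpha by (rule mult_pos_pos)
  define c where "c = ln (k / k0) / (\<kappa> * \<alpha>)"
  have ec: "exp (\<kappa> * \<alpha> * c) = k / k0"
  proof -
    have cancel: "x * (l / x) = l" if "x > 0" for x l :: real using that by simp
    have "\<kappa> * \<alpha> * c = ln (k / k0)" unfolding c_def by (rule cancel[OF ka])
    then show ?thesis using k k0 by simp
  qed
  define yc where "yc = (\<lambda>t. y (t + c))"
  define zc where "zc = (\<lambda>t. z (t + c))"
  have "{t. t + c \<in> {..<0}} = {..< - c}" by auto
  then have solc: "solves \<epsilon> {..< - c} yc zc" unfolding yc_def zc_def using solves_shift[OF sol, of c] by simp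
  have "((\<lambda>t. exp (\<gamma> * c) * (exp (- \<gamma> * (t + c)) * y (t + c))) \<longlongrightarrow> exp (\<gamma> * c) * 0) at_bot"
    by (intro tendsto_mult tendsto_const filterlim_compose[OF W filterlim_shift_at_bot])
  moreover have "exp (\<gamma> * c) * (exp (- \<gamma> * (t + c)) * y (t + c)) = exp (- \<gamma> * t) * yc t" for t
    unfolding exp_assoc yc_def by (simp add: algebra_simps)
  ultimately have Wc: "((\<lambda>t. exp (- \<gamma> * t) * yc t) \<longlongrightarrow> 0) at_bot" by (simp only: mult_zero_right)
  have "((\<lambda>t. exp (\<kappa> * c) * (exp (- \<kappa> * (t + c)) * z (t + c))) \<longlongrightarrow> exp (\<kappa> * c) * - V0) at_bot"
    by (intro tendsto_mult tendsto_const filterlim_compose[OF V(1) filterlim_shift_at_bot])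
  moreover have "exp (\<kappa> * c) * (exp (- \<kappa> * (t + c)) * z (t + c)) = exp (- \<kappa> * t) * zc t" for t
    unfolding exp_assoc zc_def by (simp add: algebra_simps)
  moreover define V1 where "V1 = exp (\<kappa> * c) * V0"
  ultimately have Vc: "((\<lambda>t. exp (- \<kappa> * t) * zc t) \<longlongrightarrow> - V1) at_bot" by (simp only: mult_minus_right)
  have V1: "V1 > 0" using V(2) by (simp add: V1_def)
  have "V1 powr \<alpha> = exp (\<kappa> * \<alpha> * c) * V0 powr \<alpha>" unfolding V1_def using V(2)
    by (subst powr_mult) (auto simp: powr_def mult_ac)
  then have kV: "a * (\<gamma> * V1 powr \<alpha> / (\<kappa> * \<alpha> - \<gamma>)) = k"
  proof -
    assume e: "V1 powr \<alpha> = exp (\<kappa> * \<alpha> * c) * V0 powr \<alpha>"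
    have "a * (\<gamma> * V1 powr \<alpha> / (\<kappa> * \<alpha> - \<gamma>)) = exp (\<kappa> * \<alpha> * c) * k0"
      unfolding e k0_def by (simp only: times_divide_eq_right mult_ac)
    then show ?thesis unfolding ec using k0 by simp
  qed
  have ev: "\<forall>\<^sub>F r in at_right 0. 0 < r \<and> r < exp (- c)" by (rule eventually_at_right_0) simp
  have lim0: "(profile yc \<longlongrightarrow> 0) (at_right 0)"
  proof (rule Lim_transform_eventually)
    have "((\<lambda>r. a * (exp (- \<gamma> * ln r) * yc (ln r))) \<longlongrightarrow> a * 0) (at_right 0)"
      by (intro tendsto_mult tendsto_const) (rule filterlim_compose[OF Wc ln_at_0])
    then show "((\<lambda>r. a * (exp (- \<gamma> * ln r) * yc (ln r))) \<longlongrightarrow> 0) (at_right 0)" by (simp only: mult_zero_right)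
    show "\<forall>\<^sub>F r in at_right 0. a * (exp (- \<gamma> * ln r) * yc (ln r)) = profile yc r"
      using ev by eventually_elim (simp add: profile_exp)
  qed
  have kae: "\<kappa> * \<alpha> = \<gamma> + (p - N) * \<alpha>"
  proof -
    have "\<kappa> * \<alpha> = \<alpha> * (p - 1) * \<gamma> + (p - N) * \<alpha>" by (simp only: algebra_simps)
    then show ?thesis using p1 by simp
  qed
  have lim1: "((\<lambda>r. r powr ((N - p) / (p - 1)) * profile yc r) \<longlongrightarrow> k) (at_right 0)"
  proof (rule Lim_transform_eventually)
    show "((\<lambda>r. a * (exp (- (\<kappa> * \<alpha>) * ln r) * yc (ln r))) \<longlongrightarrow> k) (at_right 0)"
      unfolding kV[symmetric]
      by (intro tendsto_mult tendsto_const) (rule filterlim_compose[OF value_limit_of_flux[OF solc Wc Vc V1] ln_at_0])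
    show "\<forall>\<^sub>F r in at_right 0. a * (exp (- (\<kappa> * \<alpha>) * ln r) * yc (ln r)) = r powr ((N - p) / (p - 1)) * profile yc r"
      using ev
    proof eventually_elim
      case (elim r)
      have "(N - p) / (p - 1) + - \<gamma> = - (\<kappa> * \<alpha>)" unfolding kae using p1 by (simp add: field_simps)
      then have "r powr ((N - p) / (p - 1)) * r powr (- \<gamma>) = r powr (- (\<kappa> * \<alpha>))" by (simp only: powr_add[symmetric])
      also have "\<dots> = exp (- (\<kappa> * \<alpha>) * ln r)" using elim by (simp add: powr_def)
      finally have e: "r powr ((N - p) / (p - 1)) * r powr (- \<gamma>) = exp (- (\<kappa> * \<alpha>) * ln r)" .
      show ?case unfolding profile_def e[symmetric] by (simp only: mult_ac)
    qed
  qed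
  have lim2: "((\<lambda>r. r powr ((N - 1) / (p - 1)) * deriv (profile yc) r) \<longlongrightarrow> \<gamma> * a * V1 powr \<alpha>) (at_right 0)"
  proof (rule Lim_transform_eventually)
    have "((\<lambda>r. - (\<gamma> * a) * spow \<alpha> (exp (- \<kappa> * ln r) * zc (ln r))) \<longlongrightarrow> - (\<gamma> * a) * spow \<alpha> (- V1)) (at_right 0)"
      by (intro tendsto_mult tendsto_const isCont_tendsto_compose[OF isCont_spow[OF alpha]])
        (rule filterlim_compose[OF Vc ln_at_0])
    moreover have "- (\<gamma> * a) * spow \<alpha> (- V1) = \<gamma> * a * V1 powr \<alpha>" using V1 by (simp add: spow_minus spow_pos)
    ultimately show "((\<lambda>r. - (\<gamma> * a) * spow \<alpha> (exp (- \<kappa> * ln r) * zc (ln r))) \<longlongrightarrow> \<gamma> * a * V1 powr \<alpha>) (at_right 0)"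
      by (simp only:)
    show "\<forall>\<^sub>F r in at_right 0. - (\<gamma> * a) * spow \<alpha> (exp (- \<kappa> * ln r) * zc (ln r))
        = r powr ((N - 1) / (p - 1)) * deriv (profile yc) r"
      using ev
    proof eventually_elim
      case (elim r)
      have d: "deriv (profile yc) r = - (\<gamma> * a * r powr (- \<gamma> - 1)) * spow \<alpha> (zc (ln r))"
        by (rule profile_solution(2)[OF solc, of "{0<..<exp (- c)}"])
          (use elim in \<open>auto, metis exp_gt_zero ln_exp ln_less_cancel_iff\<close>)
      have "(p - N) * \<alpha> = 1 + (1 - N) * \<alpha>" using p1 by (simp add: field_simps)
      then have "(N - 1) / (p - 1) + (- \<gamma> - 1) = - (\<alpha> * \<kappa>)" unfolding mult.commute[of \<alpha> \<kappa>] kae using p1 by (simp add: field_simps)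
      then have "r powr ((N - 1) / (p - 1)) * r powr (- \<gamma> - 1) = r powr (- (\<alpha> * \<kappa>))" by (simp only: powr_add[symmetric])
      also have "\<dots> = exp (- (\<alpha> * \<kappa>) * ln r)" using elim by (simp add: powr_def)
      also have "- (\<alpha> * \<kappa>) * ln r = \<alpha> * (- \<kappa> * ln r)"
        by (simp only: mult_minus_left mult_minus_right mult.assoc)
      finally have e: "r powr ((N - 1) / (p - 1)) * r powr (- \<gamma> - 1) = exp (\<alpha> * (- \<kappa> * ln r))" .
      have "r powr ((N - 1) / (p - 1)) * deriv (profile yc) r
          = - (\<gamma> * a) * (exp (\<alpha> * (- \<kappa> * ln r)) * spow \<alpha> (zc (ln r)))"
        unfolding d mult_reassoc e ..
      then show ?case unfolding spow_exp by (rule sym)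
    qed
  qed
  show thesis
    by (rule that[of "\<gamma> * a * V1 powr \<alpha>" c]) (use gam_pos astar(1) V1 solc lim0 lim1 lim2 in \<open>auto simp: yc_def zc_def\<close>)
qed

section \<open>Solutions that do not extend to the half-line\<close>

lemma no_source_solution: "\<not> positive_solution N p q \<sigma> 1 {r0<..} w" if "r0 \<ge> 0"
proof
  assume "positive_solution N p q \<sigma> 1 {r0<..} w"
  from solves_of_solution[OF this] have "solves 1 {t. exp t \<in> {r0<..}} (\<lambda>t. exp (\<gamma> * t) * w (exp t) / a)
    (\<lambda>t. - (exp (m * t) * flux p (deriv w (exp t)) / (\<gamma> * a) powr (p - 1)))" by simp
  then have "solves 1 {ln (r0 + 1)<..} (\<lambda>t. exp (\<gamma> * t) * w (exp t) / a)
    (\<lambda>t. - (exp (m * t) * flux p (deriv w (exp t)) / (\<gamma> * a) powr (p - 1)))"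
  proof (rule solves_subset)
    show "{ln (r0 + 1)<..} \<subseteq> {t. exp t \<in> {r0<..}}"
    proof
      fix t assume "t \<in> {ln (r0 + 1)<..}"
      then have "exp (ln (r0 + 1)) < exp t" by simp
      then show "t \<in> {t. exp t \<in> {r0<..}}" using \<open>r0 \<ge> 0\<close> by simp
    qed
  qed
  then show False using no_source_solution_at_infinity by blast
qed

lemma nonglobal_source: "nonglobal N p q \<sigma> 1 I w"
  using no_source_solution[of 0] by (auto simp: nonglobal_def)

lemma nonglobal_vanishing:
  assumes r0: "r0 > 0" and w: "(w \<longlongrightarrow> 0) (at_left r0)"
  shows "nonglobal N p q \<sigma> \<epsilon> {0<..<r0} w"
  unfolding nonglobal_def
proof
  assume "\<exists>v. positive_solution N p q \<sigma> \<epsilon> {0<..} v \<and> (\<forall>r\<in>{0<..<r0}. v r = w r)"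
  then obtain v where v: "positive_solution N p q \<sigma> \<epsilon> {0<..} v" "\<forall>r\<in>{0<..<r0}. v r = w r" by blast
  then have v0: "v r0 > 0" "v differentiable at r0" using r0 by (auto simp: positive_solution_def)
  have "isCont v r0" by (rule differentiable_imp_continuous_within[OF v0(2)])
  then have "(v \<longlongrightarrow> v r0) (at_left r0)" by (rule tendsto_within_subset[OF isContD subset_UNIV])
  then have "(w \<longlongrightarrow> v r0) (at_left r0)"
    by (rule Lim_transform_eventually) (use eventually_at_left_pos[OF r0] in eventually_elim, use v(2) in auto)
  then show False using tendsto_unique[OF _ w] v0(1) by fastforce
qed

lemma nonglobal_blowup:
  assumes r0: "r0 > 0" and w: "filterlim w at_top (at_right r0)"
  shows "nonglobal N p q \<sigma> \<epsilon> {r0<..} w"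
  unfolding nonglobal_def
proof
  assume "\<exists>v. positive_solution N p q \<sigma> \<epsilon> {0<..} v \<and> (\<forall>r\<in>{r0<..}. v r = w r)"
  then obtain v where v: "positive_solution N p q \<sigma> \<epsilon> {0<..} v" "\<forall>r\<in>{r0<..}. v r = w r" by blast
  then have "v differentiable at r0" using r0 by (auto simp: positive_solution_def)
  then have "isCont v r0" by (rule differentiable_imp_continuous_within)
  then have "(v \<longlongrightarrow> v r0) (at_right r0)" by (rule tendsto_within_subset[OF isContD subset_UNIV])
  then have "\<forall>\<^sub>F r in at_right r0. v r < v r0 + 1" by (rule order_tendstoD) simp
  moreover have "\<forall>\<^sub>F r in at_right r0. v r0 + 1 \<le> w r" using w by (simp add: filterlim_at_top)
  moreover have "\<forall>\<^sub>F r in at_right r0. r > r0" by (rule eventually_at_right_less)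
  ultimately have "\<forall>\<^sub>F r in at_right r0. False" by eventually_elim (use v(2) in auto)
  then show False by simp
qed

lemma nonglobal_increasing:
  assumes I: "open I" "I \<subseteq> {0<..}" "r1 \<in> I" and d: "deriv w r1 > 0"
  shows "nonglobal N p q \<sigma> (-1) I w"
  unfolding nonglobal_def
proof
  assume "\<exists>v. positive_solution N p q \<sigma> (-1) {0<..} v \<and> (\<forall>r\<in>I. v r = w r)"
  then obtain v where v: "positive_solution N p q \<sigma> (-1) {0<..} v" "\<forall>r\<in>I. v r = w r" by blast
  have r1: "r1 > 0" using I by auto
  have "deriv v r1 = deriv w r1"
  proof (rule deriv_cong_ev)
    have "\<forall>\<^sub>F r in nhds r1. r \<in> I" using I by (intro eventually_nhds_in_open)
    then show "\<forall>\<^sub>F r in nhds r1. v r = w r" by eventually_elim (use v(2) in auto)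
  qed simp
  then have "flux p (deriv v r1) > 0" using d by (simp add: flux_spow spow_pos)
  then have z: "- (exp (m * ln r1) * flux p (deriv v (exp (ln r1))) / (\<gamma> * a) powr (p - 1)) < 0"
    using r1 gam_pos astar(1) by simp
  have "solves (-1) {ln r1 - 1<..} (\<lambda>t. exp (\<gamma> * t) * v (exp t) / a)
    (\<lambda>t. - (exp (m * t) * flux p (deriv v (exp t)) / (\<gamma> * a) powr (p - 1)))"
    by (rule solves_subset[OF solves_of_solution[OF v(1)]]) auto
  from no_absorption_solution_increasing[OF this _ z] show False by simp
qed

section \<open>The solutions of the radial equation\<close>

lemma profile_solution_near_0:
  assumes sol: "solves \<epsilon> {..<t0} y z"
  shows "positive_solution N p q \<sigma> \<epsilon> {0<..<exp t0} (profile y)"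
  by (rule profile_solution(1)[OF sol]) (auto intro: less_exp_imp_ln_less)

theorem local_solutions_positive_limit:
  assumes \<epsilon>: "\<epsilon> \<in> {1, -1}" and w0: "w0 > 0"
  shows "\<exists>r0>0. \<exists>w. \<exists>D>0.
          positive_solution N p q \<sigma> \<epsilon> {0<..<r0} w \<and>
          nonglobal N p q \<sigma> \<epsilon> {0<..<r0} w \<and>
          (w \<longlongrightarrow> w0) (at_right 0) \<and>
          ((\<lambda>r. r powr (- ((\<sigma> + 1) / (p - 1))) * deriv w r) \<longlongrightarrow> \<epsilon> * D) (at_right 0)"
proof (cases "\<epsilon> = 1")
  case True
  have sgn: "1 \<in> {1, -1::real}" by simp
  obtain y z W0 where s: "W0 > 0" "solves 1 {..<0} y z" "((\<lambda>t. exp (- \<gamma> * t) * y t) \<longlongrightarrow> W0) at_bot"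
    by (rule local_bounded_source) (rule that)
  obtain c D where D: "D > 0" "solves 1 {t. t + c \<in> {..<0}} (\<lambda>t. y (t + c)) (\<lambda>t. z (t + c))"
    "(profile (\<lambda>t. y (t + c)) \<longlongrightarrow> w0) (at_right 0)"
    "((\<lambda>r. r powr (- ((\<sigma> + 1) / (p - 1))) * deriv (profile (\<lambda>t. y (t + c))) r) \<longlongrightarrow> 1 * D) (at_right 0)"
    by (rule bounded_profile[OF s(2) order_refl sgn s(3,1) w0]) (rule that)
  have "{t. t + c \<in> {..<0}} = {..< - c}" by auto
  with D(2) have p: "positive_solution N p q \<sigma> 1 {0<..<exp (- c)} (profile (\<lambda>t. y (t + c)))"
    by (intro profile_solution_near_0) simp
  show ?thesis unfolding True
    by (rule exI[of _ "exp (- c)"], rule conjI, simp, rule exI[of _ "profile (\<lambda>t. y (t + c))"], rule exI[of _ D],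
        intro conjI D(1,3,4) nonglobal_source p)
next
  case False
  then have e: "\<epsilon> = -1" using \<epsilon> by simp
  have sgn: "-1 \<in> {1, -1::real}" by simp
  obtain y z W0 where s: "W0 > 0" "solves (-1) {..<0} y z" "((\<lambda>t. exp (- \<gamma> * t) * y t) \<longlongrightarrow> W0) at_bot"
    "(y \<longlongrightarrow> 0) (at_left 0)"
    by (rule local_bounded_vanishing) (rule that)
  obtain c D where D: "D > 0" "solves (-1) {t. t + c \<in> {..<0}} (\<lambda>t. y (t + c)) (\<lambda>t. z (t + c))"
    "(profile (\<lambda>t. y (t + c)) \<longlongrightarrow> w0) (at_right 0)"
    "((\<lambda>r. r powr (- ((\<sigma> + 1) / (p - 1))) * deriv (profile (\<lambda>t. y (t + c))) r) \<longlongrightarrow> -1 * D) (at_right 0)"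
    by (rule bounded_profile[OF s(2) order_refl sgn s(3,1) w0]) (rule that)
  have "{t. t + c \<in> {..<0}} = {..< - c}" by auto
  with D(2) have p: "positive_solution N p q \<sigma> (-1) {0<..<exp (- c)} (profile (\<lambda>t. y (t + c)))"
    by (intro profile_solution_near_0) simp
  have yc: "((\<lambda>t. y (t + c)) \<longlongrightarrow> 0) (at_left (- c))" by (rule filterlim_compose[OF s(4) filterlim_shift_at_left])
  have "(profile (\<lambda>t. y (t + c)) \<longlongrightarrow> a * exp (- c) powr (- \<gamma>) * 0) (at_left (exp (- c)))"
    unfolding profile_def[abs_def]
    by (intro tendsto_mult tendsto_const tendsto_powr tendsto_ident_at filterlim_compose[OF yc filterlim_ln_at_left]) simp
  then have ng: "nonglobal N p q \<sigma> (-1) {0<..<exp (- c)} (profile (\<lambda>t. y (t + c)))"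
    by (intro nonglobal_vanishing) auto
  show ?thesis unfolding e
    by (rule exI[of _ "exp (- c)"], rule conjI, simp, rule exI[of _ "profile (\<lambda>t. y (t + c))"], rule exI[of _ D],
        intro conjI D(1,3,4) ng p)
qed

theorem local_solutions_vanishing_at_0:
  assumes \<epsilon>: "\<epsilon> \<in> {1, -1}" and k: "k > 0"
  shows "\<exists>r0>0. \<exists>w. \<exists>d>0.
          positive_solution N p q \<sigma> \<epsilon> {0<..<r0} w \<and>
          nonglobal N p q \<sigma> \<epsilon> {0<..<r0} w \<and>
          (w \<longlongrightarrow> 0) (at_right 0) \<and>
          ((\<lambda>r. r powr ((N - p) / (p - 1)) * w r) \<longlongrightarrow> k) (at_right 0) \<and>
          ((\<lambda>r. r powr ((N - 1) / (p - 1)) * deriv w r) \<longlongrightarrow> d) (at_right 0)"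
proof -
  obtain y z V0 where s: "V0 > 0" "solves \<epsilon> {..<0} y z" "\<forall>t<0. z t < 0"
    "((\<lambda>t. exp (- \<gamma> * t) * y t) \<longlongrightarrow> 0) at_bot" "((\<lambda>t. exp (- \<kappa> * t) * z t) \<longlongrightarrow> - V0) at_bot"
    by (rule local_increasing[OF \<epsilon>]) (rule that)
  obtain c d where d: "d > 0" "solves \<epsilon> {..< - c} (\<lambda>t. y (t + c)) (\<lambda>t. z (t + c))"
    "(profile (\<lambda>t. y (t + c)) \<longlongrightarrow> 0) (at_right 0)"
    "((\<lambda>r. r powr ((N - p) / (p - 1)) * profile (\<lambda>t. y (t + c)) r) \<longlongrightarrow> k) (at_right 0)"
    "((\<lambda>r. r powr ((N - 1) / (p - 1)) * deriv (profile (\<lambda>t. y (t + c))) r) \<longlongrightarrow> d) (at_right 0)"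
    by (rule increasing_profile[OF s(2,4,5,1) k]) (rule that)
  let ?w = "profile (\<lambda>t. y (t + c))"
  have p: "positive_solution N p q \<sigma> \<epsilon> {0<..<exp (- c)} ?w" by (rule profile_solution_near_0[OF d(2)])
  have ng: "nonglobal N p q \<sigma> \<epsilon> {0<..<exp (- c)} ?w"
  proof (cases "\<epsilon> = 1")
    case True then show ?thesis by (simp add: nonglobal_source)
  next
    case False
    define r1 where "r1 = exp (- c - 1)"
    have "deriv ?w r1 = - (\<gamma> * a * r1 powr (- \<gamma> - 1)) * spow \<alpha> (z (ln r1 + c))"
      by (rule profile_solution(2)[OF d(2), of "{0<..<exp (- c)}"]) (auto simp: r1_def intro: less_exp_imp_ln_less)
    moreover have "spow \<alpha> (z (ln r1 + c)) < 0"
      using spow_less[OF alpha, of "z (ln r1 + c)" 0] s(3) by (simp add: r1_def)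
    moreover have "\<gamma> * a * r1 powr (- \<gamma> - 1) > 0" using gam_pos astar(1) by (simp add: r1_def)
    ultimately have "deriv ?w r1 > 0" by (simp only: mult_minus_left neg_0_less_iff_less) (rule mult_pos_neg)
    then have "nonglobal N p q \<sigma> (-1) {0<..<exp (- c)} ?w"
      by (intro nonglobal_increasing[of _ r1]) (auto simp: r1_def)
    then show ?thesis using False \<epsilon> by simp
  qed
  show ?thesis
    by (rule exI[of _ "exp (- c)"], rule conjI, simp, rule exI[of _ ?w], rule exI[of _ d],
        intro conjI d(1,3,4,5) p ng)
qed

theorem global_solutions_positive_limit:
  assumes w0: "w0 > 0"
  shows "\<exists>w. \<exists>d<0.
          positive_solution N p q \<sigma> (-1) {0<..} w \<and>
          (w \<longlongrightarrow> w0) (at_right 0) \<and>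
          ((\<lambda>r. r powr (- ((\<sigma> + 1) / (p - 1))) * deriv w r) \<longlongrightarrow> d) (at_right 0) \<and>
          w \<sim>[at_top] wstar N p q \<sigma>"
proof -
  have sgn: "-1 \<in> {1, -1::real}" by simp
  obtain y z W0 where s: "solves (-1) UNIV y z" "(y \<longlongrightarrow> 1) at_top" "W0 > 0"
    "((\<lambda>t. exp (- \<gamma> * t) * y t) \<longlongrightarrow> W0) at_bot"
    by (rule connecting_branch) (rule that)
  obtain c D where D: "D > 0" "solves (-1) {t. t + c \<in> UNIV} (\<lambda>t. y (t + c)) (\<lambda>t. z (t + c))"
    "(profile (\<lambda>t. y (t + c)) \<longlongrightarrow> w0) (at_right 0)"
    "((\<lambda>r. r powr (- ((\<sigma> + 1) / (p - 1))) * deriv (profile (\<lambda>t. y (t + c))) r) \<longlongrightarrow> -1 * D) (at_right 0)"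
    by (rule bounded_profile[where ?t1.0 = 0, OF s(1) subset_UNIV sgn s(4,3) w0]) (rule that)
  let ?w = "profile (\<lambda>t. y (t + c))"
  have p: "positive_solution N p q \<sigma> (-1) {0<..} ?w" by (rule profile_solution(1)[OF D(2)]) auto
  have "filterlim (\<lambda>t::real. c + t) at_top at_top"
    by (rule filterlim_tendsto_add_at_top[OF tendsto_const filterlim_ident])
  then have "((\<lambda>t. y (c + t)) \<longlongrightarrow> 1) at_top" by (rule filterlim_compose[OF s(2)])
  then have "((\<lambda>t. y (t + c)) \<longlongrightarrow> 1) at_top" by (simp add: add.commute)
  then have "?w \<sim>[at_top] wstar N p q \<sigma>" by (rule profile_asymp[OF _ ln_at_top eventually_gt_at_top])
  then show ?thesis
    by - (rule exI[of _ ?w], rule exI[of _ "-1 * D"], rule conjI, (use D(1) in simp),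
        intro conjI D(3,4) p, assumption)
qed

theorem singular_solution_vanishing:
  "\<exists>r0>0. \<exists>w.
          positive_solution N p q \<sigma> (-1) {0<..<r0} w \<and>
          w r0 = 0 \<and> (w \<longlongrightarrow> 0) (at_left r0) \<and>
          w \<sim>[at_right 0] wstar N p q \<sigma>"
proof -
  obtain t0 y z where s: "solves (-1) {..<t0} y z" "(y \<longlongrightarrow> 1) at_bot" "y t0 = 0" "(y \<longlongrightarrow> 0) (at_left t0)"
    by (rule singular_vanishing_branch) (rule that)
  have "(profile y \<longlongrightarrow> a * exp t0 powr (- \<gamma>) * 0) (at_left (exp t0))"
    unfolding profile_def[abs_def]
    by (intro tendsto_mult tendsto_const tendsto_powr tendsto_ident_at filterlim_compose[OF s(4) filterlim_ln_at_left]) simp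
  moreover have "profile y (exp t0) = 0" by (simp add: profile_def s(3))
  moreover have "profile y \<sim>[at_right 0] wstar N p q \<sigma>"
    by (rule profile_asymp[OF s(2) ln_at_0 eventually_at_right_less])
  ultimately show ?thesis
    by - (rule exI[of _ "exp t0"], rule conjI, simp, rule exI[of _ "profile y"],
        intro conjI profile_solution_near_0[OF s(1)], simp_all)
qed

lemma profile_at_top:
  assumes y: "filterlim y at_top G" and l: "filterlim ln G F" and F: "((\<lambda>r. r) \<longlongrightarrow> r0) F" "r0 > 0"
  shows "filterlim (profile y) at_top F"
proof -
  have "((\<lambda>r. a * r powr (- \<gamma>)) \<longlongrightarrow> a * r0 powr (- \<gamma>)) F"
    using F(2) by (intro tendsto_mult tendsto_const tendsto_powr F(1)) simp
  then show ?thesis unfolding profile_def[abs_def]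
    by (rule filterlim_tendsto_pos_mult_at_top[OF _ _ filterlim_compose[OF y l]]) (use F(2) astar(1) in simp)
qed

theorem singular_solution_blowup:
  "\<exists>r0>0. \<exists>w.
          positive_solution N p q \<sigma> (-1) {0<..<r0} w \<and>
          filterlim w at_top (at_left r0) \<and>
          w \<sim>[at_right 0] wstar N p q \<sigma>"
proof -
  obtain t0 y z where s: "solves (-1) {..<t0} y z" "(y \<longlongrightarrow> 1) at_bot" "filterlim y at_top (at_left t0)"
    by (rule singular_blowup_branch) (rule that)
  have "filterlim (profile y) at_top (at_left (exp t0))"
    by (rule profile_at_top[OF s(3) filterlim_ln_at_left tendsto_ident_at]) simp
  moreover have "profile y \<sim>[at_right 0] wstar N p q \<sigma>"
    by (rule profile_asymp[OF s(2) ln_at_0 eventually_at_right_less])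
  ultimately show ?thesis
    by - (rule exI[of _ "exp t0"], rule conjI, simp, rule exI[of _ "profile y"],
        intro conjI profile_solution_near_0[OF s(1)], simp_all)
qed

theorem exterior_solution_blowup:
  "\<exists>r0>0. \<exists>w.
          positive_solution N p q \<sigma> (-1) {r0<..} w \<and>
          nonglobal N p q \<sigma> (-1) {r0<..} w \<and>
          w \<sim>[at_top] wstar N p q \<sigma> \<and>
          filterlim w at_top (at_right r0)"
proof -
  obtain t0 y z where s: "solves (-1) {t0<..} y z" "(y \<longlongrightarrow> 1) at_top" "filterlim y at_top (at_right t0)"
    by (rule exterior_blowup_branch) (rule that)
  have b: "filterlim (profile y) at_top (at_right (exp t0))"
    by (rule profile_at_top[OF s(3) filterlim_ln_at_right tendsto_ident_at]) simp
  have pos: "r > 0" if "r > exp t0" for r using that exp_gt_zero[of t0] by linarith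
  have p: "positive_solution N p q \<sigma> (-1) {exp t0<..} (profile y)"
    by (rule profile_solution(1)[OF s(1)]) (use pos in \<open>auto intro: exp_less_imp_less_ln\<close>)
  have "profile y \<sim>[at_top] wstar N p q \<sigma>" by (rule profile_asymp[OF s(2) ln_at_top eventually_gt_at_top])
  then show ?thesis
    by - (rule exI[of _ "exp t0"], rule conjI, simp, rule exI[of _ "profile y"],
        intro conjI p b nonglobal_blowup, simp_all)
qed

end

theorem theorem4p16:
  fixes N p q \<sigma> :: real
  assumes "q > p - 1" and "p - 1 > 0" and "p > - \<sigma>" and "- \<sigma> > N"
  shows
    "(\<forall>\<epsilon>\<in>{1, -1}.
       (\<forall>w0>0. \<exists>r0>0. \<exists>w. \<exists>D>0.
          positive_solution N p q \<sigma> \<epsilon> {0<..<r0} w \<and>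
          nonglobal N p q \<sigma> \<epsilon> {0<..<r0} w \<and>
          (w \<longlongrightarrow> w0) (at_right 0) \<and>
          ((\<lambda>r. r powr (- ((\<sigma> + 1) / (p - 1))) * deriv w r) \<longlongrightarrow> \<epsilon> * D) (at_right 0)) \<and>
       (\<forall>k>0. \<exists>r0>0. \<exists>w. \<exists>d>0.
          positive_solution N p q \<sigma> \<epsilon> {0<..<r0} w \<and>
          nonglobal N p q \<sigma> \<epsilon> {0<..<r0} w \<and>
          (w \<longlongrightarrow> 0) (at_right 0) \<and>
          ((\<lambda>r. r powr ((N - p) / (p - 1)) * w r) \<longlongrightarrow> k) (at_right 0) \<and>
          ((\<lambda>r. r powr ((N - 1) / (p - 1)) * deriv w r) \<longlongrightarrow> d) (at_right 0)))
     \<and> positive_solution N p q \<sigma> (-1) {0<..} (wstar N p q \<sigma>)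
     \<and> (\<forall>w0>0. \<exists>w. \<exists>d<0.
          positive_solution N p q \<sigma> (-1) {0<..} w \<and>
          (w \<longlongrightarrow> w0) (at_right 0) \<and>
          ((\<lambda>r. r powr (- ((\<sigma> + 1) / (p - 1))) * deriv w r) \<longlongrightarrow> d) (at_right 0) \<and>
          w \<sim>[at_top] wstar N p q \<sigma>)
     \<and> (\<exists>r0>0. \<exists>w.
          positive_solution N p q \<sigma> (-1) {0<..<r0} w \<and>
          w r0 = 0 \<and> (w \<longlongrightarrow> 0) (at_left r0) \<and>
          w \<sim>[at_right 0] wstar N p q \<sigma>)
     \<and> (\<exists>r0>0. \<exists>w.
          positive_solution N p q \<sigma> (-1) {0<..<r0} w \<and>
          filterlim w at_top (at_left r0) \<and>
          w \<sim>[at_right 0] wstar N p q \<sigma>)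
     \<and> (\<exists>r0>0. \<exists>w.
          positive_solution N p q \<sigma> (-1) {r0<..} w \<and>
          nonglobal N p q \<sigma> (-1) {r0<..} w \<and>
          w \<sim>[at_top] wstar N p q \<sigma> \<and>
          filterlim w at_top (at_right r0))
     \<and> (\<forall>r0>0. \<not> (\<exists>w. positive_solution N p q \<sigma> 1 {r0<..} w))"
proof -
  interpret weighted_p_laplace N p q \<sigma>
    using assms by unfold_locales
  show ?thesis
    by (intro conjI ballI allI impI; (rule local_solutions_positive_limit local_solutions_vanishing_at_0
        wstar_solution global_solutions_positive_limit singular_solution_vanishing singular_solution_blowup
        exterior_solution_blowup)?; (assumption | (use no_source_solution in \<open>simp add: less_imp_le\<close>)))
qed

end
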